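(* Let $u_1,\dots,u_7$ be real constants satisfying one of the following sets of relations (with nonvanishing denominators and real square roots; in (2) and (3) upper or lower signs are taken throughout): (1) $u_2=\frac{(u_1-2u_3)u_7^2-(2u_1-u_3)((u_1-2u_3)(u_1+u_3)+u_4^2)}{6u_4u_7}$, $u_5=\frac{(u_1-2u_3)(u_1+u_3)+u_4^2-2u_7^2}{3u_7}$, $u_6=\frac{-(2u_1-u_3)(u_1+u_3)-2u_4^2+u_7^2}{3u_4}$; (2) $u_7=0$, $u_1=\tfrac12\big(u_3\pm\sqrt{9u_3^2-4u_4^2}\big)$, $u_2=\mp\frac{u_5\sqrt{9u_3^2-4u_4^2}}{2u_4}$, $u_6=\mp\frac{u_3(\pm3u_3+\sqrt{9u_3^2-4u_4^2})}{2u_4}$; (3) $u_4=0$, $u_1=\tfrac14\big(-u_3\mp\sqrt{9u_3^2+8u_7^2}\big)$, $u_2=\mp\frac{u_6(\pm9u_3+\sqrt{9u_3^2+8u_7^2})}{8u_7}$, $u_5=\frac{-4u_7^2\pm u_3(\mp3u_3+\sqrt{9u_3^2+8u_7^2})}{8u_7}$; (4) $u_1=u_3=u_4=u_5=u_7=0$; (5) $u_1=-u_3$, $u_4=u_5=u_6=u_7=0$; (6) $u_1=u_3=u_4=u_6=u_7=0$. Put $k_7=2u_1^2+u_2^2+u_1u_3+2u_4^2+u_5^2+3u_4u_6+u_6^2+u_5u_7$. Then the system (S$_u$) of the context is the system of Maurer--Cartan equations of a $12$-dimensional (local) Lie group $\mathcal G^{12}$, and $g,\Upsilon,\omega$ built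 from the $\theta^i$ descend to a nearly integrable irreducible $SO(3)\times SO(3)$ geometry on the (local) homogeneous space $M^9=\mathcal G^{12}/H$, $H=SO(3)_R$, having $\mathcal G^{12}$ as a symmetry group, for which: (a) the torsion $T$ of the characteristic connection $\Gamma$ lies in $V_{[0,6]}\subset\Lambda^3\mathbb R^9$; (b) the curvature $\Omega^+$ of the $\mathfrak{so}(3)_L$-part of $\Gamma$ vanishes; (c) the curvature of $\Gamma$ is $\Omega=\Omega^-=\tfrac1{36}\|T\|^2\sum_A\kappa_0^{A'}e_{A'}$, where $\|T\|^2=T_{ijk}T^{ijk}=36k_7$; (d) in the basis dual to $(\theta^i,\gamma^{A'})$ the Killing form of $\mathcal G^{12}$ is $-8\,\mathrm{diag}(k_7,k_7,k_7,k_7,k_7,k_7,k_7,k_7,k_7,1,1,1)$; (e) if $k_7\ne0$, then $(M^9,g)$ is not locally symmetric; if $k_7=0$, then $\Gamma$ is flat and $(M^9,g)$ is locally symmetric; (f) for every value of $k_7$ the metric $g$ is Einstein, with Levi-Civita Ricci tensor $3k_7g$, and $g$ is not conformally flat unless $(u_1,\dots,u_7)=0$; (g) the $\mathfrak{so}(3)_R$-part $\Gamma^-$ of $\Gamma$ is Einstein, with Ricci tensor $R^-_{ij}=2k_7g_{ij}$, and it is flat ($\Omega^-=0$) if and only if $k_7=0$.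
   Context: Algebra. Identify $\mathbb R^9$ with $M_3(\mathbb R)$ via $\sigma(a)=\begin{pmatrix} a^1 & a^2 & a^3 \\ a^4 & a^5 & a^6 \\ a^7 & a^8 & a^9 \end{pmatrix}$; $SO(3)_L\times SO(3)_R$ acts by $X\mapsto h_LXh_R^{-1}$. With elementary matrices $E_{ij}$ put $L_1=E_{21}-E_{12}$, $L_2=E_{31}-E_{13}$, $L_3=E_{32}-E_{23}$, and let $e_A,e_{A'}$ ($A=1,2,3$) be the $9\times9$ matrices with $\sigma(e_Aa)=L_A\sigma(a)$, $\sigma(e_{A'}a)=-\sigma(a)L_A$ (bases of $\mathfrak{so}(3)_L,\mathfrak{so}(3)_R\subset\mathfrak{so}(9)$). $V_{[0,6]}\subset\Lambda^3\mathbb R^9$ is the unique submodule on which $SO(3)_R$ acts trivially and $SO(3)_L$ acts by its $7$-dimensional irreducible representation. Write $\theta^{ij}=\theta^i\wedge\theta^j$ etc., and $-\kappa_0^{1'}=\theta^{12}+\theta^{45}+\theta^{78}$, $-\kappa_0^{2'}=\theta^{13}+\theta^{46}+\theta^{79}$, $-\kappa_0^{3'}=\theta^{23}+\theta^{56}+\theta^{89}$. Geometry. An irreducible $SO(3)\times SO(3)$ geometry $(M^9,g,\Upsilon,\omega)$ is a $9$-manifold with tensor fields which near every point have, in some local coframe $(\theta^i)$ (called adapted), the form $g=\sum_i(\theta^i)^2$, $\Upsilon=\det\sigma(\theta)$ (symmetric products), $\omega=\theta^{1245}+\theta^{1278}+\theta^{1346}+\theta^{1379}+\theta^{2356}+\theta^{2389}+\theta^{4578}+\theta^{4679}+\theta^{5689}$.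 It is nearly integrable if $(\nabla^{LC}_X\Upsilon)(X,X,X)=0$ for all $X$; then it has a unique $\mathfrak{so}(3)_L\oplus\mathfrak{so}(3)_R$-valued connection $\Gamma=\sum_A(\gamma^Ae_A+\gamma^{A'}e_{A'})$ with totally skew torsion $T^i=d\theta^i+\Gamma^i{}_j\wedge\theta^j=\tfrac12T_{ijk}\theta^{jk}$ (the characteristic connection). Its parts $\Gamma^+=\gamma^Ae_A$, $\Gamma^-=\gamma^{A'}e_{A'}$ are connections with curvatures $\Omega^\pm=d\Gamma^\pm+\Gamma^\pm\wedge\Gamma^\pm=(\tfrac12R^{\pm\,i}{}_{jkl}\theta^{kl})$ and Ricci tensors $R^\pm_{ij}=R^{\pm\,k}{}_{ikj}$; the curvature of $\Gamma$ is $\Omega=\Omega^++\Omega^-$. A symmetry is a diffeomorphism preserving $g$ and $\Upsilon$. System (S$_u$). On a $12$-manifold with coframe $(\theta^1,\dots,\theta^9,\gamma^{1'},\gamma^{2'},\gamma^{3'})$: $\gamma^A=0$, and $$d\theta^i=-\sum_A\gamma^{A'}(e_{A'})^i{}_j\wedge\theta^j+T^i,$$ $$d\gamma^{1'}=-\gamma^{2'}\wedge\gamma^{3'}+k_7\kappa_0^{1'},\quad d\gamma^{2'}=-\gamma^{3'}\wedge\gamma^{1'}+k_7\kappa_0^{2'},\quad d\gamma^{3'}=-\gamma^{1'}\wedge\gamma^{2'}+k_7\kappa_0^{3'},$$ where $T^i=X_i\lrcorner\,\mathcal T$ ($X_i$ dual to $\theta^i$), $\mathcal T=\tfrac16T_{ijk}\theta^{ijk}=\sum_{a,b,c=1}^3S_{abc}\,\sigma(\theta)_{a1}\wedge\sigma(\theta)_{b2}\wedge\sigma(\theta)_{c3}$,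 and $S_{abc}$ is totally symmetric with $S_{111}=-(u_1+u_3)$, $S_{122}=u_1$, $S_{133}=u_3$, $S_{112}=-(u_4+u_6)$, $S_{222}=u_4$, $S_{233}=u_6$, $S_{113}=-(u_5+u_7)$, $S_{223}=u_5$, $S_{333}=u_7$, $S_{123}=-u_2$. $H=SO(3)_R$ is the subgroup whose Lie algebra is annihilated by all $\theta^i$. *)

theory Defs
  imports "HOL-Analysis.Analysis" "HOL-Library.Multiset"
begin

section \<open>Calculus on open subsets of Euclidean space\<close>

text \<open>
  The statement is local, so manifolds are nonempty open subsets of \<open>real ^ 'n\<close>, with tangent spaces
  identified with \<open>real ^ 'n\<close>.  A covariant tensor field is a function of the point and of tangent
  vectors; a differential form with values in a vector space takes its values there.
\<close>

primrec Ck_on :: "nat \<Rightarrow> 'a::real_normed_vector set \<Rightarrow> ('a \<Rightarrow> 'b::real_normed_vector) \<Rightarrow> bool" where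
  "Ck_on 0 S f \<longleftrightarrow> continuous_on S f"
| "Ck_on (Suc k) S f \<longleftrightarrow> (\<forall>x\<in>S. f differentiable (at x)) \<and>
     (\<forall>v. Ck_on k S (\<lambda>x. frechet_derivative f (at x) v))"

text \<open>Only used for open \<open>S\<close>.\<close>

definition smooth_on :: "'a::real_normed_vector set \<Rightarrow> ('a \<Rightarrow> 'b::real_normed_vector) \<Rightarrow> bool" where
  "smooth_on S f \<longleftrightarrow> (\<forall>k. Ck_on k S f)"

definition one_form_on :: "'a::real_normed_vector set \<Rightarrow> ('a \<Rightarrow> 'a \<Rightarrow> 'b::real_normed_vector) \<Rightarrow> bool" where
  "one_form_on U \<alpha> \<longleftrightarrow> (\<forall>x\<in>U. linear (\<alpha> x)) \<and> (\<forall>v. smooth_on U (\<lambda>x. \<alpha> x v))"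

text \<open>Exterior derivative of a one-form, evaluated on two (constant) vectors; wedge products are
  normalised by \<open>(\<alpha> \<and> \<beta>)(v, w) = \<alpha> v \<beta> w - \<alpha> w \<beta> v\<close>.\<close>

definition ext_d :: "('a::real_normed_vector \<Rightarrow> 'a \<Rightarrow> 'b::real_normed_vector) \<Rightarrow> 'a \<Rightarrow> 'a \<Rightarrow> 'a \<Rightarrow> 'b" where
  "ext_d \<alpha> x v w = frechet_derivative (\<lambda>y. \<alpha> y w) (at x) v - frechet_derivative (\<lambda>y. \<alpha> y v) (at x) w"

definition wedge :: "('v \<Rightarrow> real) list \<Rightarrow> 'v list \<Rightarrow> real" where
  "wedge \<alpha>s vs = (\<Sum>p | p permutes {..<length \<alpha>s}. of_int (sign p) * (\<Prod>k<length \<alpha>s. (\<alpha>s ! k) (vs ! p k)))"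

section \<open>Levi-Civita connection and curvature\<close>

text \<open>\<open>levi_civita g x\<close> is the Christoffel map of the torsion-free metric connection:
  \<open>\<nabla>\<^sub>u Y = D\<^sub>u Y + levi_civita g x u Y\<close>.\<close>

definition levi_civita ::
  "(real^'n \<Rightarrow> real^'n \<Rightarrow> real^'n \<Rightarrow> real) \<Rightarrow> real^'n \<Rightarrow> real^'n \<Rightarrow> real^'n \<Rightarrow> real^'n" where
  "levi_civita g x = (THE C. bilinear C \<and> (\<forall>u v. C u v = C v u) \<and>
     (\<forall>u v w. frechet_derivative (\<lambda>y. g y v w) (at x) u = g x (C u v) w + g x v (C u w)))"

text \<open>\<open>riemann g x u v w\<close> is \<open>R(u, v) w\<close> with \<open>R(u, v) = [\<nabla>\<^sub>u, \<nabla>\<^sub>v] - \<nabla>\<^bsub>[u, v]\<^esub>\<close>.\<close>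

definition riemann ::
  "(real^'n \<Rightarrow> real^'n \<Rightarrow> real^'n \<Rightarrow> real) \<Rightarrow> real^'n \<Rightarrow> real^'n \<Rightarrow> real^'n \<Rightarrow> real^'n \<Rightarrow> real^'n" where
  "riemann g x u v w =
     frechet_derivative (\<lambda>y. levi_civita g y v w) (at x) u
   - frechet_derivative (\<lambda>y. levi_civita g y u w) (at x) v
   + levi_civita g x u (levi_civita g x v w) - levi_civita g x v (levi_civita g x u w)"

definition ricci :: "(real^'n \<Rightarrow> real^'n \<Rightarrow> real^'n \<Rightarrow> real) \<Rightarrow> real^'n \<Rightarrow> real^'n \<Rightarrow> real^'n \<Rightarrow> real" where
  "ricci g x v w = trace (matrix (\<lambda>u. riemann g x u v w))"

definition nabla_riemann ::
  "(real^'n \<Rightarrow> real^'n \<Rightarrow> real^'n \<Rightarrow> real) \<Rightarrow> real^'n \<Rightarrow> real^'n \<Rightarrow> real^'n \<Rightarrow> real^'n \<Rightarrow> real^'n \<Rightarrow> real^'n" where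
  "nabla_riemann g x z u v w =
     frechet_derivative (\<lambda>y. riemann g y u v w) (at x) z + levi_civita g x z (riemann g x u v w)
   - riemann g x (levi_civita g x z u) v w - riemann g x u (levi_civita g x z v) w
   - riemann g x u v (levi_civita g x z w)"

definition locally_symmetric :: "(real^'n) set \<Rightarrow> (real^'n \<Rightarrow> real^'n \<Rightarrow> real^'n \<Rightarrow> real) \<Rightarrow> bool" where
  "locally_symmetric M g \<longleftrightarrow> (\<forall>x\<in>M. \<forall>z u v w. nabla_riemann g x z u v w = 0)"

text \<open>Near every point the metric becomes flat after multiplication by a positive function.\<close>

definition conformally_flat :: "(real^'n) set \<Rightarrow> (real^'n \<Rightarrow> real^'n \<Rightarrow> real^'n \<Rightarrow> real) \<Rightarrow> bool" where
  "conformally_flat M g \<longleftrightarrow> (\<forall>p\<in>M. \<exists>V f. open V \<and> p \<in> V \<and> V \<subseteq> M \<and> smooth_on V f \<and>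
     (\<forall>x\<in>V. \<forall>u v w. riemann (\<lambda>y a b. exp (2 * f y) * g y a b) x u v w = 0))"

section \<open>The algebra of \<open>SO(3)\<^sub>L \<times> SO(3)\<^sub>R\<close> acting on 3 by 3 matrices\<close>

text \<open>In the index types \<open>3\<close>, \<open>7\<close> and \<open>9\<close> the numerals \<open>1, \<dots>, n\<close> are pairwise distinct, the last one
  being equal to \<open>0\<close>; so indices run from \<open>1\<close> to \<open>n\<close>.\<close>

definition sigma :: "real^9 \<Rightarrow> real^3^3" where
  "sigma a = vector [vector [a$1, a$2, a$3], vector [a$4, a$5, a$6], vector [a$7, a$8, a$9]]"

definition elem :: "3 \<Rightarrow> 3 \<Rightarrow> real^3^3" where
  "elem i j = (\<chi> r c. if r = i \<and> c = j then 1 else 0)"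

definition Lmat :: "3 \<Rightarrow> real^3^3" where
  "Lmat A = (if A = 1 then elem 2 1 - elem 1 2
             else if A = 2 then elem 3 1 - elem 1 3
             else elem 3 2 - elem 2 3)"

definition eL :: "3 \<Rightarrow> real^9^9" where
  "eL A = matrix (\<lambda>a. inv sigma (Lmat A ** sigma a))"

definition eR :: "3 \<Rightarrow> real^9^9" where
  "eR A = matrix (\<lambda>a. inv sigma (- (sigma a ** Lmat A)))"

definition SO3 :: "(real^3^3) set" where
  "SO3 = {h. rotation_matrix h}"

definition rho :: "real^3^3 \<Rightarrow> real^3^3 \<Rightarrow> real^9^9" where
  "rho hL hR = matrix (\<lambda>a. inv sigma (hL ** sigma a ** matrix_inv hR))"

text \<open>Three-forms on \<open>\<real>\<^sup>9\<close> are given by their components \<open>T\<^sub>i\<^sub>j\<^sub>k\<close>.\<close>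

definition Lambda3 :: "(real^9^9^9) set" where
  "Lambda3 = {T. \<forall>i j k. T $ i $ j $ k = - T $ j $ i $ k \<and> T $ i $ j $ k = - T $ i $ k $ j}"

text \<open>Induced action of an orthogonal matrix, for which vectors and covectors transform alike.\<close>

definition act3 :: "real^9^9 \<Rightarrow> real^9^9^9 \<Rightarrow> real^9^9^9" where
  "act3 h T = (\<chi> i j k. \<Sum>a\<in>UNIV. \<Sum>b\<in>UNIV. \<Sum>c\<in>UNIV. h $ i $ a * h $ j $ b * h $ k $ c * T $ a $ b $ c)"

text \<open>\<open>V\<close> is the (unique) submodule \<open>V\<^bsub>[0,6]\<^esub>\<close>.\<close>

definition is_V06 :: "(real^9^9^9) set \<Rightarrow> bool" where
  "is_V06 V \<longleftrightarrow> subspace V \<and> V \<subseteq> Lambda3 \<and>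
     (\<forall>hL\<in>SO3. \<forall>hR\<in>SO3. act3 (rho hL hR) ` V \<subseteq> V) \<and>
     (\<forall>hR\<in>SO3. \<forall>T\<in>V. act3 (rho (mat 1) hR) T = T) \<and>
     dim V = 7 \<and>
     (\<forall>W. subspace W \<and> W \<subseteq> V \<and> (\<forall>hL\<in>SO3. act3 (rho hL (mat 1)) ` W \<subseteq> W) \<longrightarrow> W = {0} \<or> W = V)"

definition th :: "9 list \<Rightarrow> (real^9) list \<Rightarrow> real" where
  "th is = wedge (map (\<lambda>i v. v $ i) is)"

definition kappa0 :: "3 \<Rightarrow> real^9 \<Rightarrow> real^9 \<Rightarrow> real" where
  "kappa0 A a b =
     - (if A = 1 then th [1,2] [a,b] + th [4,5] [a,b] + th [7,8] [a,b]
        else if A = 2 then th [1,3] [a,b] + th [4,6] [a,b] + th [7,9] [a,b]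
        else th [2,3] [a,b] + th [5,6] [a,b] + th [8,9] [a,b])"

text \<open>\<open>det \<circ> \<sigma>\<close> as a symmetric trilinear form: \<open>Upsilon0 a a a = det (sigma a)\<close>.\<close>

definition Upsilon0 :: "real^9 \<Rightarrow> real^9 \<Rightarrow> real^9 \<Rightarrow> real" where
  "Upsilon0 a b c =
     (let D = (\<lambda>x y z. det (vector [sigma x $ 1, sigma y $ 2, sigma z $ 3] :: real^3^3))
      in (D a b c + D b c a + D c a b + D a c b + D b a c + D c b a) / 6)"

definition omega0 :: "real^9 \<Rightarrow> real^9 \<Rightarrow> real^9 \<Rightarrow> real^9 \<Rightarrow> real" where
  "omega0 a b c d =
     (\<Sum>is\<leftarrow>[[1,2,4,5], [1,2,7,8], [1,3,4,6], [1,3,7,9], [2,3,5,6], [2,3,8,9], [4,5,7,8], [4,6,7,9], [5,6,8,9]].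
        th is [a, b, c, d])"

section \<open>Irreducible \<open>SO(3) \<times> SO(3)\<close> geometries\<close>

type_synonym tensor2 = "real^9 \<Rightarrow> real^9 \<Rightarrow> real^9 \<Rightarrow> real"
type_synonym tensor3 = "real^9 \<Rightarrow> real^9 \<Rightarrow> real^9 \<Rightarrow> real^9 \<Rightarrow> real"
type_synonym tensor4 = "real^9 \<Rightarrow> real^9 \<Rightarrow> real^9 \<Rightarrow> real^9 \<Rightarrow> real^9 \<Rightarrow> real"

text \<open>A coframe \<open>(\<theta>\<^sup>1, \<dots>, \<theta>\<^sup>9)\<close> is an \<open>\<real>\<^sup>9\<close>-valued one-form that is pointwise bijective.\<close>

definition adapted_coframe ::
  "tensor2 \<Rightarrow> tensor3 \<Rightarrow> tensor4 \<Rightarrow> (real^9) set \<Rightarrow> (real^9 \<Rightarrow> real^9 \<Rightarrow> real^9) \<Rightarrow> bool" where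
  "adapted_coframe g \<Upsilon> \<omega> U \<theta> \<longleftrightarrow> open U \<and> one_form_on U \<theta> \<and> (\<forall>x\<in>U. bij (\<theta> x)) \<and>
     (\<forall>x\<in>U. \<forall>a b c d.
        g x a b = (\<Sum>i\<in>UNIV. \<theta> x a $ i * \<theta> x b $ i) \<and>
        \<Upsilon> x a b c = Upsilon0 (\<theta> x a) (\<theta> x b) (\<theta> x c) \<and>
        \<omega> x a b c d = omega0 (\<theta> x a) (\<theta> x b) (\<theta> x c) (\<theta> x d))"

definition irreducible_geometry :: "(real^9) set \<Rightarrow> tensor2 \<Rightarrow> tensor3 \<Rightarrow> tensor4 \<Rightarrow> bool" where
  "irreducible_geometry M g \<Upsilon> \<omega> \<longleftrightarrow> open M \<and> M \<noteq> {} \<and>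
     (\<forall>p\<in>M. \<exists>U \<theta>. p \<in> U \<and> U \<subseteq> M \<and> adapted_coframe g \<Upsilon> \<omega> U \<theta>)"

definition nabla_Upsilon ::
  "tensor2 \<Rightarrow> tensor3 \<Rightarrow> real^9 \<Rightarrow> real^9 \<Rightarrow> real^9 \<Rightarrow> real^9 \<Rightarrow> real^9 \<Rightarrow> real" where
  "nabla_Upsilon g \<Upsilon> x z a b c =
     frechet_derivative (\<lambda>y. \<Upsilon> y a b c) (at x) z - \<Upsilon> x (levi_civita g x z a) b c
   - \<Upsilon> x a (levi_civita g x z b) c - \<Upsilon> x a b (levi_civita g x z c)"

definition nearly_integrable :: "(real^9) set \<Rightarrow> tensor2 \<Rightarrow> tensor3 \<Rightarrow> bool" where
  "nearly_integrable M g \<Upsilon> \<longleftrightarrow> (\<forall>x\<in>M. \<forall>X. nabla_Upsilon g \<Upsilon> x X X X X = 0)"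

text \<open>Connections are matrix-valued one-forms relative to a coframe \<open>\<theta>\<close>; \<open>conn_L\<close> and \<open>conn_R\<close> are
  the parts \<open>\<Gamma>\<^sup>+ = \<gamma>\<^sup>A e\<^sub>A\<close> and \<open>\<Gamma>\<^sup>- = \<gamma>\<^bsup>A'\<^esup> e\<^bsub>A'\<^esub>\<close>.\<close>

definition conn_L :: "('a \<Rightarrow> 'a \<Rightarrow> real^3) \<Rightarrow> 'a \<Rightarrow> 'a \<Rightarrow> real^9^9" where
  "conn_L \<gamma> x v = (\<Sum>A\<in>UNIV. (\<gamma> x v $ A) *\<^sub>R eL A)"

definition conn_R :: "('a \<Rightarrow> 'a \<Rightarrow> real^3) \<Rightarrow> 'a \<Rightarrow> 'a \<Rightarrow> real^9^9" where
  "conn_R \<gamma> x v = (\<Sum>A\<in>UNIV. (\<gamma> x v $ A) *\<^sub>R eR A)"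

definition conn :: "('a \<Rightarrow> 'a \<Rightarrow> real^3) \<Rightarrow> ('a \<Rightarrow> 'a \<Rightarrow> real^3) \<Rightarrow> 'a \<Rightarrow> 'a \<Rightarrow> real^9^9" where
  "conn \<gamma>L \<gamma>R x v = conn_L \<gamma>L x v + conn_R \<gamma>R x v"

definition conn_wedge ::
  "('a \<Rightarrow> 'a \<Rightarrow> real^9^9) \<Rightarrow> ('a \<Rightarrow> 'a \<Rightarrow> real^9) \<Rightarrow> 'a \<Rightarrow> 'a \<Rightarrow> 'a \<Rightarrow> real^9" where
  "conn_wedge \<Gamma> \<theta> x v w = \<Gamma> x v *v \<theta> x w - \<Gamma> x w *v \<theta> x v"

text \<open>\<open>\<Omega> = d\<Gamma> + \<Gamma> \<and> \<Gamma>\<close>.\<close>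

definition curvature_form ::
  "('a::real_normed_vector \<Rightarrow> 'a \<Rightarrow> real^9^9) \<Rightarrow> 'a \<Rightarrow> 'a \<Rightarrow> 'a \<Rightarrow> real^9^9" where
  "curvature_form \<Gamma> x v w = ext_d \<Gamma> x v w + \<Gamma> x v ** \<Gamma> x w - \<Gamma> x w ** \<Gamma> x v"

definition frame :: "('a \<Rightarrow> 'a \<Rightarrow> real^9) \<Rightarrow> 'a \<Rightarrow> 9 \<Rightarrow> 'a" where
  "frame \<theta> x i = inv (\<theta> x) (axis i 1)"

text \<open>The components \<open>T\<^sub>i\<^sub>j\<^sub>k\<close> of the torsion \<open>d\<theta> + \<Gamma> \<and> \<theta>\<close>, and its squared norm.\<close>

definition torsion ::
  "('a::real_normed_vector \<Rightarrow> 'a \<Rightarrow> real^9) \<Rightarrow> ('a \<Rightarrow> 'a \<Rightarrow> real^9^9) \<Rightarrow> 'a \<Rightarrow> real^9^9^9" where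
  "torsion \<theta> \<Gamma> x = (\<chi> i j k.
     (ext_d \<theta> x (frame \<theta> x j) (frame \<theta> x k) + conn_wedge \<Gamma> \<theta> x (frame \<theta> x j) (frame \<theta> x k)) $ i)"

definition norm_sq3 :: "real^9^9^9 \<Rightarrow> real" where
  "norm_sq3 T = (\<Sum>i\<in>UNIV. \<Sum>j\<in>UNIV. \<Sum>k\<in>UNIV. T $ i $ j $ k * T $ i $ j $ k)"

definition characteristic_connection ::
  "(real^9) set \<Rightarrow> (real^9 \<Rightarrow> real^9 \<Rightarrow> real^9) \<Rightarrow> (real^9 \<Rightarrow> real^9 \<Rightarrow> real^3) \<Rightarrow> (real^9 \<Rightarrow> real^9 \<Rightarrow> real^3) \<Rightarrow> bool" where
  "characteristic_connection U \<theta> \<gamma>L \<gamma>R \<longleftrightarrow> one_form_on U \<gamma>L \<and> one_form_on U \<gamma>R \<and>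
     (\<forall>x\<in>U. torsion \<theta> (conn \<gamma>L \<gamma>R) x \<in> Lambda3)"

text \<open>\<open>R\<^sub>i\<^sub>j = R\<^sup>k\<^sub>i\<^sub>k\<^sub>j\<close>, where \<open>R\<^sup>i\<^sub>j\<^sub>k\<^sub>l\<close> is the \<open>(i, j)\<close> entry of the curvature on the frame vectors \<open>k\<close>, \<open>l\<close>.\<close>

definition ricci_form ::
  "('a::real_normed_vector \<Rightarrow> 'a \<Rightarrow> real^9) \<Rightarrow> ('a \<Rightarrow> 'a \<Rightarrow> real^9^9) \<Rightarrow> 'a \<Rightarrow> 9 \<Rightarrow> 9 \<Rightarrow> real" where
  "ricci_form \<theta> \<Gamma> x i j = (\<Sum>k\<in>UNIV. curvature_form \<Gamma> x (frame \<theta> x k) (frame \<theta> x j) $ k $ i)"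

text \<open>A symmetry between two open subsets of \<open>M\<close>.\<close>

definition symmetry_on :: "(real^9) set \<Rightarrow> tensor2 \<Rightarrow> tensor3 \<Rightarrow> (real^9) set \<Rightarrow> (real^9 \<Rightarrow> real^9) \<Rightarrow> bool" where
  "symmetry_on M g \<Upsilon> W \<phi> \<longleftrightarrow> open W \<and> W \<subseteq> M \<and> open (\<phi> ` W) \<and> \<phi> ` W \<subseteq> M \<and>
     inj_on \<phi> W \<and> smooth_on W \<phi> \<and> smooth_on (\<phi> ` W) (inv_into W \<phi>) \<and>
     (\<forall>x\<in>W. let d = frechet_derivative \<phi> (at x) in
        \<forall>a b c. g (\<phi> x) (d a) (d b) = g x a b \<and> \<Upsilon> (\<phi> x) (d a) (d b) (d c) = \<Upsilon> x a b c)"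

section \<open>Local Lie groups\<close>

text \<open>Multiplication and inversion are partial, with open domains \<open>mult_dom\<close> and \<open>inv_dom\<close>.\<close>

record 'a local_group =
  lcarrier :: "'a set"
  mult_dom :: "('a \<times> 'a) set"
  lmult :: "'a \<Rightarrow> 'a \<Rightarrow> 'a"
  inv_dom :: "'a set"
  linv :: "'a \<Rightarrow> 'a"
  lone :: 'a

definition local_lie_group :: "('a::euclidean_space) local_group \<Rightarrow> bool" where
  "local_lie_group G \<longleftrightarrow>
     open (lcarrier G) \<and> lone G \<in> lcarrier G \<and>
     open (mult_dom G) \<and> mult_dom G \<subseteq> lcarrier G \<times> lcarrier G \<and>
     lcarrier G \<times> {lone G} \<subseteq> mult_dom G \<and> {lone G} \<times> lcarrier G \<subseteq> mult_dom G \<and>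
     (\<forall>(a, b)\<in>mult_dom G. lmult G a b \<in> lcarrier G) \<and>
     smooth_on (mult_dom G) (\<lambda>(a, b). lmult G a b) \<and>
     open (inv_dom G) \<and> lone G \<in> inv_dom G \<and> inv_dom G \<subseteq> lcarrier G \<and>
     (\<forall>a\<in>inv_dom G. linv G a \<in> lcarrier G) \<and> smooth_on (inv_dom G) (linv G) \<and>
     (\<forall>a b c. (a, b) \<in> mult_dom G \<and> (b, c) \<in> mult_dom G \<and>
        (lmult G a b, c) \<in> mult_dom G \<and> (a, lmult G b c) \<in> mult_dom G \<longrightarrow>
        lmult G (lmult G a b) c = lmult G a (lmult G b c)) \<and>
     (\<forall>a\<in>lcarrier G. lmult G a (lone G) = a \<and> lmult G (lone G) a = a) \<and>
     (\<forall>a\<in>inv_dom G. (a, linv G a) \<in> mult_dom G \<and> (linv G a, a) \<in> mult_dom G \<and>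
        lmult G a (linv G a) = lone G \<and> lmult G (linv G a) a = lone G)"

definition dleft :: "('a::euclidean_space) local_group \<Rightarrow> 'a \<Rightarrow> 'a \<Rightarrow> 'a \<Rightarrow> 'a" where
  "dleft G a b = frechet_derivative (lmult G a) (at b)"

definition left_invariant_form ::
  "('a::euclidean_space) local_group \<Rightarrow> ('a \<Rightarrow> 'a \<Rightarrow> 'b::real_normed_vector) \<Rightarrow> bool" where
  "left_invariant_form G \<alpha> \<longleftrightarrow> one_form_on (lcarrier G) \<alpha> \<and>
     (\<forall>(a, b)\<in>mult_dom G. \<forall>v. \<alpha> (lmult G a b) (dleft G a b v) = \<alpha> b v)"

text \<open>The Lie algebra is the tangent space at the identity; its bracket is that of the left-invariant
  vector fields \<open>\<lambda>a. dleft G a (lone G) v\<close>.\<close>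

definition lie_bracket_fields :: "('a::euclidean_space \<Rightarrow> 'a) \<Rightarrow> ('a \<Rightarrow> 'a) \<Rightarrow> 'a \<Rightarrow> 'a" where
  "lie_bracket_fields X Y x = frechet_derivative Y (at x) (X x) - frechet_derivative X (at x) (Y x)"

definition lie_alg_bracket :: "('a::euclidean_space) local_group \<Rightarrow> 'a \<Rightarrow> 'a \<Rightarrow> 'a" where
  "lie_alg_bracket G v w =
     lie_bracket_fields (\<lambda>a. dleft G a (lone G) v) (\<lambda>a. dleft G a (lone G) w) (lone G)"

definition killing_form :: "(real^'n) local_group \<Rightarrow> real^'n \<Rightarrow> real^'n \<Rightarrow> real" where
  "killing_form G v w = trace (matrix (\<lambda>z. lie_alg_bracket G v (lie_alg_bracket G w z)))"

text \<open>\<open>\<pi>\<close> is the projection of \<open>G\<close> onto the space \<open>M\<close> of left cosets of the subgroup \<open>H\<close> with Lie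
  algebra \<open>\<hh>\<close>: a submersion whose fibres are connected and consist, as far as products are defined, of
  left cosets.  In particular \<open>H\<close> is the fibre through the identity, so it is a submanifold closed under
  the partial operations, and its tangent space there is the kernel of the derivative of \<open>\<pi>\<close>.\<close>

definition local_homogeneous_space ::
  "('a::euclidean_space) local_group \<Rightarrow> 'a set \<Rightarrow> 'a set \<Rightarrow> ('b::euclidean_space) set \<Rightarrow> ('a \<Rightarrow> 'b) \<Rightarrow> bool" where
  "local_homogeneous_space G H \<hh> M \<pi> \<longleftrightarrow>
     H \<subseteq> lcarrier G \<and> open M \<and> \<pi> ` lcarrier G = M \<and> smooth_on (lcarrier G) \<pi> \<and>
     (\<forall>a\<in>lcarrier G. surj (frechet_derivative \<pi> (at a))) \<and>
     (\<forall>(a, h)\<in>mult_dom G. \<pi> (lmult G a h) = \<pi> a \<longleftrightarrow> h \<in> H) \<and>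
     (\<forall>x\<in>M. connected {a \<in> lcarrier G. \<pi> a = x}) \<and>
     {v. frechet_derivative \<pi> (at (lone G)) v = 0} = \<hh>"

text \<open>The local action of \<open>G\<close> on \<open>M\<close> induced by left multiplication, with domain \<open>D\<close>, consists of
  symmetries and is effective near the identity.\<close>

definition symmetry_group ::
  "('a::euclidean_space) local_group \<Rightarrow> (real^9) set \<Rightarrow> ('a \<Rightarrow> real^9) \<Rightarrow> tensor2 \<Rightarrow> tensor3 \<Rightarrow> bool" where
  "symmetry_group G M \<pi> g \<Upsilon> \<longleftrightarrow> (\<exists>D act.
     open D \<and> D \<subseteq> lcarrier G \<times> M \<and> {lone G} \<times> M \<subseteq> D \<and> smooth_on D (\<lambda>(a, x). act a x) \<and>
     (\<forall>a\<in>lcarrier G. symmetry_on M g \<Upsilon> {x. (a, x) \<in> D} (act a)) \<and>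
     (\<forall>x\<in>M. act (lone G) x = x) \<and>
     (\<forall>a b x. (a, b) \<in> mult_dom G \<and> (b, x) \<in> D \<and> (a, act b x) \<in> D \<and> (lmult G a b, x) \<in> D \<longrightarrow>
        act a (act b x) = act (lmult G a b) x) \<and>
     (\<forall>a b. (a, b) \<in> mult_dom G \<and> (a, \<pi> b) \<in> D \<longrightarrow> act a (\<pi> b) = \<pi> (lmult G a b)) \<and>
     (\<exists>N. open N \<and> lone G \<in> N \<and> N \<subseteq> lcarrier G \<and>
        (\<forall>a\<in>N. (\<forall>x. (a, x) \<in> D \<longrightarrow> act a x = x) \<longrightarrow> a = lone G)))"

section \<open>The system \<open>(S\<^sub>u)\<close>\<close>

definition S_tensor :: "real^7 \<Rightarrow> 3 \<Rightarrow> 3 \<Rightarrow> 3 \<Rightarrow> real" where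
  "S_tensor u a b c =
     (let m = {#a, b, c#} in
      if m = {#1,1,1#} then - (u$1 + u$3)
      else if m = {#1,2,2#} then u$1
      else if m = {#1,3,3#} then u$3
      else if m = {#1,1,2#} then - (u$4 + u$6)
      else if m = {#2,2,2#} then u$4
      else if m = {#2,3,3#} then u$6
      else if m = {#1,1,3#} then - (u$5 + u$7)
      else if m = {#2,2,3#} then u$5
      else if m = {#3,3,3#} then u$7
      else - u$2)"

definition T_form :: "real^7 \<Rightarrow> real^9 \<Rightarrow> real^9 \<Rightarrow> real^9 \<Rightarrow> real" where
  "T_form u x y z = (\<Sum>a\<in>UNIV. \<Sum>b\<in>UNIV. \<Sum>c\<in>UNIV.
     S_tensor u a b c * wedge [\<lambda>v. sigma v $ a $ 1, \<lambda>v. sigma v $ b $ 2, \<lambda>v. sigma v $ c $ 3] [x, y, z])"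

text \<open>\<open>\<theta>\<close> and \<open>\<gamma>\<close> stand for \<open>(\<theta>\<^sup>1, \<dots>, \<theta>\<^sup>9)\<close> and \<open>(\<gamma>\<^bsup>1'\<^esup>, \<gamma>\<^bsup>2'\<^esup>, \<gamma>\<^bsup>3'\<^esup>)\<close>.  The term \<open>T_form\<close> is the interior
  product of \<open>\<T>\<close> with the dual frame, as a two-form in \<open>\<theta>\<close>.\<close>

definition system_S ::
  "real^7 \<Rightarrow> real \<Rightarrow> (real^12) set \<Rightarrow> (real^12 \<Rightarrow> real^12 \<Rightarrow> real^9) \<Rightarrow> (real^12 \<Rightarrow> real^12 \<Rightarrow> real^3) \<Rightarrow> bool" where
  "system_S u k7 U \<theta> \<gamma> \<longleftrightarrow> (\<forall>x\<in>U. \<forall>v w.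
     ext_d \<theta> x v w = - conn_wedge (conn_R \<gamma>) \<theta> x v w + (\<chi> i. T_form u (axis i 1) (\<theta> x v) (\<theta> x w)) \<and>
     (\<forall>(A, B, C)\<in>{(1, 2, 3), (2, 3, 1), (3, 1, 2)}.
        ext_d \<gamma> x v w $ A =
          - (\<gamma> x v $ B * \<gamma> x w $ C - \<gamma> x w $ B * \<gamma> x v $ C) + k7 * kappa0 A (\<theta> x v) (\<theta> x w)))"

text \<open>A left-invariant coframe satisfying the system: the latter consists of the Maurer-Cartan equations
  of \<open>G\<close>.\<close>

definition maurer_cartan_system ::
  "real^7 \<Rightarrow> real \<Rightarrow> (real^12) local_group \<Rightarrow> (real^12 \<Rightarrow> real^12 \<Rightarrow> real^9) \<Rightarrow> (real^12 \<Rightarrow> real^12 \<Rightarrow> real^3) \<Rightarrow> bool" where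
  "maurer_cartan_system u k7 G \<theta> \<gamma> \<longleftrightarrow>
     left_invariant_form G \<theta> \<and> left_invariant_form G \<gamma> \<and>
     (\<forall>x\<in>lcarrier G. bij (\<lambda>v. (\<theta> x v, \<gamma> x v))) \<and> system_S u k7 (lcarrier G) \<theta> \<gamma>"

text \<open>The basis of the Lie algebra dual to \<open>(\<theta>\<^sup>i, \<gamma>\<^bsup>A'\<^esup>)\<close>.\<close>

definition dual_theta ::
  "'a local_group \<Rightarrow> ('a \<Rightarrow> 'a \<Rightarrow> real^9) \<Rightarrow> ('a \<Rightarrow> 'a \<Rightarrow> real^3) \<Rightarrow> 9 \<Rightarrow> 'a" where
  "dual_theta G \<theta> \<gamma> i = inv (\<lambda>v. (\<theta> (lone G) v, \<gamma> (lone G) v)) (axis i 1, 0)"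

definition dual_gamma ::
  "'a local_group \<Rightarrow> ('a \<Rightarrow> 'a \<Rightarrow> real^9) \<Rightarrow> ('a \<Rightarrow> 'a \<Rightarrow> real^3) \<Rightarrow> 3 \<Rightarrow> 'a" where
  "dual_gamma G \<theta> \<gamma> A = inv (\<lambda>v. (\<theta> (lone G) v, \<gamma> (lone G) v)) (0, axis A 1)"

definition descends ::
  "('a::euclidean_space) set \<Rightarrow> ('a \<Rightarrow> 'a \<Rightarrow> real^9) \<Rightarrow> ('a \<Rightarrow> real^9) \<Rightarrow> tensor2 \<Rightarrow> tensor3 \<Rightarrow> tensor4 \<Rightarrow> bool" where
  "descends U \<theta> \<pi> g \<Upsilon> \<omega> \<longleftrightarrow> (\<forall>p\<in>U. let d = frechet_derivative \<pi> (at p) in \<forall>x y z w.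
     g (\<pi> p) (d x) (d y) = (\<Sum>i\<in>UNIV. \<theta> p x $ i * \<theta> p y $ i) \<and>
     \<Upsilon> (\<pi> p) (d x) (d y) (d z) = Upsilon0 (\<theta> p x) (\<theta> p y) (\<theta> p z) \<and>
     \<omega> (\<pi> p) (d x) (d y) (d z) (d w) = omega0 (\<theta> p x) (\<theta> p y) (\<theta> p z) (\<theta> p w))"

text \<open>The sign \<open>\<epsilon>\<close> distinguishes upper (\<open>1\<close>) from lower (\<open>-1\<close>) signs.\<close>

definition relations :: "real^7 \<Rightarrow> bool" where
  "relations u \<longleftrightarrow>
    (let u1 = u$1; u2 = u$2; u3 = u$3; u4 = u$4; u5 = u$5; u6 = u$6; u7 = u$7 in
      (u4 \<noteq> 0 \<and> u7 \<noteq> 0 \<and>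
        u2 = ((u1 - 2*u3) * u7\<^sup>2 - (2*u1 - u3) * ((u1 - 2*u3) * (u1 + u3) + u4\<^sup>2)) / (6*u4*u7) \<and>
        u5 = ((u1 - 2*u3) * (u1 + u3) + u4\<^sup>2 - 2*u7\<^sup>2) / (3*u7) \<and>
        u6 = (- (2*u1 - u3) * (u1 + u3) - 2*u4\<^sup>2 + u7\<^sup>2) / (3*u4))
    \<or> (u4 \<noteq> 0 \<and> 9*u3\<^sup>2 - 4*u4\<^sup>2 \<ge> 0 \<and> u7 = 0 \<and>
        (\<exists>\<epsilon>\<in>{1, -1}. let s = sqrt (9*u3\<^sup>2 - 4*u4\<^sup>2) in
          u1 = (u3 + \<epsilon> * s) / 2 \<and>
          u2 = - \<epsilon> * (u5 * s / (2*u4)) \<and>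
          u6 = - \<epsilon> * (u3 * (\<epsilon> * 3 * u3 + s) / (2*u4))))
    \<or> (u7 \<noteq> 0 \<and> u4 = 0 \<and>
        (\<exists>\<epsilon>\<in>{1, -1}. let s = sqrt (9*u3\<^sup>2 + 8*u7\<^sup>2) in
          u1 = (- u3 - \<epsilon> * s) / 4 \<and>
          u2 = - \<epsilon> * (u6 * (\<epsilon> * 9 * u3 + s) / (8*u7)) \<and>
          u5 = (- 4*u7\<^sup>2 + \<epsilon> * u3 * (- \<epsilon> * 3 * u3 + s)) / (8*u7)))
    \<or> (u1 = 0 \<and> u3 = 0 \<and> u4 = 0 \<and> u5 = 0 \<and> u7 = 0)
    \<or> (u1 = - u3 \<and> u4 = 0 \<and> u5 = 0 \<and> u6 = 0 \<and> u7 = 0)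
    \<or> (u1 = 0 \<and> u3 = 0 \<and> u4 = 0 \<and> u6 = 0 \<and> u7 = 0))"

end

theory Submission
  imports Defs
begin

text \<open>
  Let \<open>A\<close> be the vector space \<open>\<real> \<oplus> \<real>\<^sup>3\<close> with the commutative product
  \<open>e\<^sub>a e\<^sub>b = k \<delta>\<^sub>a\<^sub>b - \<Sum>\<^sub>c S\<^sub>a\<^sub>b\<^sub>c e\<^sub>c\<close>.  The form \<open>\<gamma> + \<Sum>\<^sub>a \<theta>\<^sub>a e\<^sub>a\<close> turns the system into
  the Maurer-Cartan equation of \<open>so(3) \<otimes> A\<close>, so the relations between the \<open>u\<^sub>i\<close> express that \<open>A\<close> is
  associative.  Only their consequence \<open>\<Sum>\<^sub>c\<^sub>d S\<^sub>a\<^sub>c\<^sub>d S\<^sub>b\<^sub>c\<^sub>d = 2 k \<delta>\<^sub>a\<^sub>b\<close> is needed: for a traceless cubic form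
  it implies that some rotation takes \<open>S\<close> to the form with \<open>S\<^sub>1\<^sub>2\<^sub>3 = - t\<close> as only component, where
  \<open>t\<^sup>2 = k\<close>.  For this form the idempotents of \<open>A\<close> are the vertices of a regular tetrahedron
  (if \<open>t \<noteq> 0\<close>, then \<open>A = \<real>\<^sup>4\<close>), and the group is locally \<open>SO(3)\<^sup>4\<close>, or the semidirect product of
  \<open>SO(3)\<close> with \<open>\<real>\<^sup>9\<close> if \<open>t = 0\<close>.  In Cayley coordinates both cases are given by the same rational formulas:
  the homogeneous space is the third power of a group \<open>N\<close>, deforming \<open>SO(3)\<close> into \<open>\<real>\<^sup>3\<close> as \<open>t\<close> tends to \<open>0\<close>,
  on which \<open>SO(3)\<close> acts by rotations.  In the resulting global coframe the Levi-Civita connection and the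
  curvature have constant coefficients, so the assertions on the geometry become polynomial identities.
\<close>

section \<open>Smooth maps\<close>

text \<open>The identity for S is a trace of associativity: the vector part of (e_a e_c) e_d = e_a
  (e_c e_d) is S_acf S_fdg - S_cdf S_afg = k (delta_cd delta_ag - delta_ac delta_dg), summed over f;
  putting c = d and summing, tracelessness leaves 2 k delta_ag. The rotation normalising S acts on
  the row index of \<open>sigma\<close>, that is through SO(3)_L, which fixes g, Upsilon, omega and
  the \<open>kappa0\<close> forms. So the geometry of M depends on u only through t, and the
  rotation Q enters only the coframe on the group. In standard form the e_a / t multiply like the
  involutions of Klein's four-group. For a character \<epsilon> of it, the idempotent (1 + sum of
  \<epsilon>_a e_a / t) / 4 has a pole at t = 0, while the so(3)-component \<gamma> + t (sum of
  \<epsilon>_a \<theta>_a) has none. To reach k = 0 without dividing by t, the factors are written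
  with quaternions 1 + 2 t x, whose product, divided by its real part, deforms addition. On M the
  component with all \<epsilon>_a = 1 is gauged to zero; this leaves three factors and gives the
  connection - t (sum of the \<theta>_a).\<close>

lemma Ck_on_cong:
  assumes "open S" "\<And>x. x \<in> S \<Longrightarrow> f x = g x"
  shows "Ck_on k S f \<longleftrightarrow> Ck_on k S g"
  using assms(2)
proof (induction k arbitrary: f g)
  case 0
  then show ?case by (simp cong: continuous_on_cong)
next
  case (Suc k)
  have hd: "(f has_derivative D) (at x) \<longleftrightarrow> (g has_derivative D) (at x)" if "x \<in> S" for x D
    using has_derivative_transform_within_open[of f D x UNIV S g]
      has_derivative_transform_within_open[of g D x UNIV S f] assms(1) that Suc.prems by auto
  have "frechet_derivative f (at x) = frechet_derivative g (at x)" if "x \<in> S" for x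
    unfolding frechet_derivative_def using hd[OF that] by simp
  then have "Ck_on k S (\<lambda>x. frechet_derivative f (at x) v) \<longleftrightarrow> Ck_on k S (\<lambda>x. frechet_derivative g (at x) v)" for v
    by (intro Suc.IH) simp
  moreover have "f differentiable (at x) \<longleftrightarrow> g differentiable (at x)" if "x \<in> S" for x
    unfolding differentiable_def using hd[OF that] by simp
  ultimately show ?case by simp
qed

lemma Ck_on_Suc_imp_Ck_on: "Ck_on (Suc k) S f \<Longrightarrow> Ck_on k S f"
proof (induction k arbitrary: f)
  case 0
  then show ?case
    by (simp add: continuous_at_imp_continuous_on differentiable_imp_continuous_within)
qed auto

text \<open>\<open>Ck_on\<close> is phrased with \<open>frechet_derivative\<close>; this rule
  accepts an explicit derivative instead, so each closure property is an induction on the order in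
  which the derivative is again built from the same operations.\<close>

lemma Ck_on_SucI:
  assumes "open S" "\<And>x. x \<in> S \<Longrightarrow> (f has_derivative D x) (at x)" "\<And>v. Ck_on k S (\<lambda>x. D x v)"
  shows "Ck_on (Suc k) S f"
proof -
  have "frechet_derivative f (at x) = D x" if "x \<in> S" for x
    using frechet_derivative_at[OF assms(2)[OF that]] by simp
  then have "Ck_on k S (\<lambda>x. frechet_derivative f (at x) v) \<longleftrightarrow> Ck_on k S (\<lambda>x. D x v)" for v
    by (intro Ck_on_cong[OF assms(1)]) auto
  then show ?thesis using assms by (auto simp: differentiable_def)
qed

lemma Ck_on_has_derivative:
  "Ck_on (Suc k) S f \<Longrightarrow> x \<in> S \<Longrightarrow> (f has_derivative frechet_derivative f (at x)) (at x)"
  using frechet_derivative_works by auto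

lemma Ck_on_const: "open S \<Longrightarrow> Ck_on k S (\<lambda>x. c)"
proof (induction k arbitrary: c)
  case (Suc k)
  show ?case by (rule Ck_on_SucI[OF Suc.prems has_derivative_const Suc.IH[OF Suc.prems]])
qed simp

lemma Ck_on_bounded_linear:
  assumes "open S" "bounded_linear L" "Ck_on k S f"
  shows "Ck_on k S (\<lambda>x. L (f x))"
  using assms(3)
proof (induction k arbitrary: f)
  case 0
  then show ?case by (auto intro: bounded_linear.continuous_on[OF assms(2)])
next
  case (Suc k)
  show ?case
  proof (rule Ck_on_SucI[OF assms(1)])
    show "((\<lambda>x. L (f x)) has_derivative (\<lambda>v. L (frechet_derivative f (at x) v))) (at x)" if "x \<in> S" for x
      using bounded_linear.has_derivative[OF assms(2) Ck_on_has_derivative[OF Suc.prems that]] .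
    show "Ck_on k S (\<lambda>x. L (frechet_derivative f (at x) v))" for v
      using Suc by auto
  qed
qed

lemma Ck_on_add:
  assumes "open S" "Ck_on k S f" "Ck_on k S g"
  shows "Ck_on k S (\<lambda>x. f x + g x)"
  using assms(2,3)
proof (induction k arbitrary: f g)
  case 0
  then show ?case by (auto intro: continuous_intros)
next
  case (Suc k)
  show ?case
  proof (rule Ck_on_SucI[OF assms(1)])
    show "((\<lambda>x. f x + g x) has_derivative
        (\<lambda>v. frechet_derivative f (at x) v + frechet_derivative g (at x) v)) (at x)" if "x \<in> S" for x
      using Suc.prems that by (intro has_derivative_add Ck_on_has_derivative)
    show "Ck_on k S (\<lambda>x. frechet_derivative f (at x) v + frechet_derivative g (at x) v)" for v
      using Suc by auto
  qed
qed

lemma Ck_on_bounded_bilinear: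
  assumes "open S" "bounded_bilinear B" "Ck_on k S f" "Ck_on k S g"
  shows "Ck_on k S (\<lambda>x. B (f x) (g x))"
  using assms(3,4)
proof (induction k arbitrary: f g)
  case 0
  then show ?case by (auto intro: bounded_bilinear.continuous_on[OF assms(2)])
next
  case (Suc k)
  show ?case
  proof (rule Ck_on_SucI[OF assms(1)])
    show "((\<lambda>x. B (f x) (g x)) has_derivative
        (\<lambda>v. B (f x) (frechet_derivative g (at x) v) + B (frechet_derivative f (at x) v) (g x))) (at x)"
      if "x \<in> S" for x
      using Suc.prems that
      by (intro bounded_bilinear.FDERIV[OF assms(2)] Ck_on_has_derivative)
    show "Ck_on k S (\<lambda>x. B (f x) (frechet_derivative g (at x) v) + B (frechet_derivative f (at x) v) (g x))" for v
    proof (intro Ck_on_add[OF assms(1)] Suc.IH)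
      \<comment> \<open>The product rule pairs a derivative with an undifferentiated factor, and the
        latter has to be lowered to order k.\<close>
      show "Ck_on k S f" "Ck_on k S g" using Suc.prems by (auto intro: Ck_on_Suc_imp_Ck_on simp del: Ck_on.simps)
    qed (use Suc.prems in auto)
  qed
qed

lemma Ck_on_inverse:
  fixes f :: "'a::real_normed_vector \<Rightarrow> real"
  assumes "open S" "\<And>x. x \<in> S \<Longrightarrow> f x \<noteq> 0" "Ck_on k S f"
  shows "Ck_on k S (\<lambda>x. inverse (f x))"
  using assms(3)
proof (induction k)
  case 0
  then show ?case using assms by (auto intro: continuous_intros)
next
  case (Suc k)
  show ?case
  proof (rule Ck_on_SucI[OF assms(1)])
    show "((\<lambda>x. inverse (f x)) has_derivative
        (\<lambda>v. (- 1) *\<^sub>R (inverse (f x) * frechet_derivative f (at x) v * inverse (f x)))) (at x)"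
      if "x \<in> S" for x
      using Deriv.has_derivative_inverse[OF assms(2)[OF that] Ck_on_has_derivative[OF Suc.prems that]] by simp
    have i: "Ck_on k S (\<lambda>x. inverse (f x))"
      by (rule Suc.IH[OF Ck_on_Suc_imp_Ck_on[OF Suc.prems]])
    have d: "Ck_on k S (\<lambda>x. frechet_derivative f (at x) v)" for v
      using Suc.prems by simp
    show "Ck_on k S (\<lambda>x. (- 1) *\<^sub>R (inverse (f x) * frechet_derivative f (at x) v * inverse (f x)))" for v
      by (rule Ck_on_bounded_linear[OF assms(1) bounded_linear_scaleR_right
            Ck_on_bounded_bilinear[OF assms(1) bounded_bilinear_mult
              Ck_on_bounded_bilinear[OF assms(1) bounded_bilinear_mult i d] i]])
  qed
qed

lemma smooth_on_cong:
  assumes "open S" "\<And>x. x \<in> S \<Longrightarrow> f x = g x"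
  shows "smooth_on S f \<longleftrightarrow> smooth_on S g"
  unfolding smooth_on_def by (intro iff_allI Ck_on_cong[OF assms])

lemma smooth_on_const [intro]: "open S \<Longrightarrow> smooth_on S (\<lambda>x. c)"
  by (simp add: smooth_on_def Ck_on_const)

lemma smooth_on_linear:
  fixes L :: "'b::euclidean_space \<Rightarrow> 'c::real_normed_vector"
  shows "open S \<Longrightarrow> linear L \<Longrightarrow> smooth_on S f \<Longrightarrow> smooth_on S (\<lambda>x. L (f x))"
  by (simp add: smooth_on_def Ck_on_bounded_linear linear_conv_bounded_linear)

lemma smooth_on_ident [intro]: "open S \<Longrightarrow> smooth_on S (\<lambda>x::'a::real_normed_vector. x)"
proof -
  assume S: "open S"
  have "Ck_on k S (\<lambda>x::'a. x)" for k
  proof (cases k)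
    case (Suc j)
    show ?thesis unfolding Suc by (rule Ck_on_SucI[OF S has_derivative_ident Ck_on_const[OF S]])
  qed simp
  then show ?thesis by (simp add: smooth_on_def)
qed

lemma smooth_on_add: "open S \<Longrightarrow> smooth_on S f \<Longrightarrow> smooth_on S g \<Longrightarrow> smooth_on S (\<lambda>x. f x + g x)"
  by (simp add: smooth_on_def Ck_on_add)

lemma smooth_on_bilinear:
  "open S \<Longrightarrow> bounded_bilinear B \<Longrightarrow> smooth_on S f \<Longrightarrow> smooth_on S g \<Longrightarrow> smooth_on S (\<lambda>x. B (f x) (g x))"
  by (simp add: smooth_on_def Ck_on_bounded_bilinear)

lemma smooth_on_scaleR:
  "open S \<Longrightarrow> smooth_on S f \<Longrightarrow> smooth_on S g \<Longrightarrow> smooth_on S (\<lambda>x. f x *\<^sub>R g x)"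
  by (rule smooth_on_bilinear[OF _ bounded_bilinear_scaleR])

lemma smooth_on_mult:
  fixes f g :: "'a::real_normed_vector \<Rightarrow> real"
  shows "open S \<Longrightarrow> smooth_on S f \<Longrightarrow> smooth_on S g \<Longrightarrow> smooth_on S (\<lambda>x. f x * g x)"
  by (rule smooth_on_bilinear[OF _ bounded_bilinear_mult])

lemma smooth_on_inner:
  "open S \<Longrightarrow> smooth_on S f \<Longrightarrow> smooth_on S g \<Longrightarrow> smooth_on S (\<lambda>x. f x \<bullet> g x)"
  by (rule smooth_on_bilinear[OF _ bounded_bilinear_inner])

lemma smooth_on_diff:
  assumes "open S" "smooth_on S f" "smooth_on S g"
  shows "smooth_on S (\<lambda>x. f x - g x)"
  using smooth_on_add[OF assms(1,2) smooth_on_scaleR[OF assms(1) smooth_on_const[OF assms(1), of "- 1"] assms(3)]]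
  by simp

lemma smooth_on_divide:
  fixes f g :: "'a::real_normed_vector \<Rightarrow> real"
  assumes "open S" "smooth_on S f" "smooth_on S g" "\<And>x. x \<in> S \<Longrightarrow> g x \<noteq> 0"
  shows "smooth_on S (\<lambda>x. f x / g x)"
proof -
  have "smooth_on S (\<lambda>x. inverse (g x))"
    using assms by (simp add: smooth_on_def Ck_on_inverse)
  from smooth_on_mult[OF assms(1,2) this] show ?thesis by (simp add: divide_inverse)
qed

lemma smooth_on_sum:
  "open S \<Longrightarrow> (\<And>i. i \<in> I \<Longrightarrow> smooth_on S (f i)) \<Longrightarrow> smooth_on S (\<lambda>x. \<Sum>i\<in>I. f i x)"
  by (induction I rule: infinite_finite_induct) (auto intro!: smooth_on_add)

lemma smooth_on_vec_lambda:
  assumes "open S" "\<And>i. smooth_on S (\<lambda>x. f x i)"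
  shows "smooth_on S (\<lambda>x. (\<chi> i. f x i) :: 'b::euclidean_space ^ 'n)"
proof -
  have l: "linear (\<lambda>b. axis i b :: 'b^'n)" for i
    by (rule linearI) (auto simp: vec_eq_iff axis_def)
  have "smooth_on S (\<lambda>x. \<Sum>i\<in>UNIV. axis i (f x i) :: 'b^'n)"
    using assms by (intro smooth_on_sum smooth_on_linear[OF _ l]) auto
  moreover have "(\<Sum>i\<in>UNIV. axis i (f x i)) = ((\<chi> i. f x i) :: 'b^'n)" for x
    by (simp add: vec_eq_iff axis_def)
  ultimately show ?thesis by simp
qed

lemma smooth_on_has_derivative:
  "smooth_on S f \<Longrightarrow> x \<in> S \<Longrightarrow> (f has_derivative frechet_derivative f (at x)) (at x)"
  unfolding smooth_on_def using Ck_on_has_derivative by blast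

lemma smooth_on_frechet_derivative:
  assumes "smooth_on S f"
  shows "smooth_on S (\<lambda>x. frechet_derivative f (at x) v)"
proof -
  have "Ck_on (Suc k) S f" for k using assms smooth_on_def by blast
  then show ?thesis by (simp add: smooth_on_def)
qed

lemma smooth_on_cross3:
  "open S \<Longrightarrow> smooth_on S f \<Longrightarrow> smooth_on S g \<Longrightarrow> smooth_on S (\<lambda>x. cross3 (f x) (g x))"
  by (rule smooth_on_bilinear[OF _ bilinear_conv_bounded_bilinear[THEN iffD1, OF bilinear_cross]])

section \<open>Curvature in a moving frame\<close>

text \<open>A product rule that asks only for derivatives of \<open>L y w\<close> at fixed w: in
  finite dimension the moving argument \<open>F y\<close> can be expanded in
  \<open>Basis\<close>.\<close>

lemma has_derivative_linear_family:
  fixes L :: "'a::real_normed_vector \<Rightarrow> 'b::euclidean_space \<Rightarrow> 'c::real_normed_vector"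
  assumes "open V" "x \<in> V" "\<And>y. y \<in> V \<Longrightarrow> linear (L y)"
    and L': "\<And>w. ((\<lambda>y. L y w) has_derivative (\<lambda>u. L' u w)) (at x)"
    and F: "(F has_derivative F') (at x)"
  shows "((\<lambda>y. L y (F y)) has_derivative (\<lambda>u. L' u (F x) + L x (F' u))) (at x)"
proof -
  have exp: "L y w = (\<Sum>b\<in>Basis. (w \<bullet> b) *\<^sub>R L y b)" if "y \<in> V" for y w
  proof -
    have "L y w = L y (\<Sum>b\<in>Basis. (w \<bullet> b) *\<^sub>R b)" by (simp add: euclidean_representation)
    then show ?thesis using assms(3)[OF that] by (simp add: linear_sum linear_scale)
  qed
  have "((\<lambda>y. \<Sum>b\<in>Basis. (F y \<bullet> b) *\<^sub>R L y b) has_derivative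
      (\<lambda>u. \<Sum>b\<in>Basis. (F x \<bullet> b) *\<^sub>R L' u b + (F' u \<bullet> b) *\<^sub>R L x b)) (at x)"
    by (intro has_derivative_sum has_derivative_scaleR has_derivative_inner_left F L')
  note D = this
  \<comment> \<open>The expansion and \<open>L y (F x)\<close> agree near x, so their derivatives
    agree; thus \<open>L'\<close> inherits linearity from \<open>L\<close>.\<close>
  have 1: "(\<Sum>b\<in>Basis. (F x \<bullet> b) *\<^sub>R L' u b) = L' u (F x)" for u
  proof (rule fun_cong[of "\<lambda>u. \<Sum>b\<in>Basis. (F x \<bullet> b) *\<^sub>R L' u b"], rule has_derivative_unique)
    show "((\<lambda>y. \<Sum>b\<in>Basis. (F x \<bullet> b) *\<^sub>R L y b) has_derivative
        (\<lambda>u. \<Sum>b\<in>Basis. (F x \<bullet> b) *\<^sub>R L' u b)) (at x)"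
      by (intro has_derivative_sum has_derivative_scaleR_right L')
    show "((\<lambda>y. \<Sum>b\<in>Basis. (F x \<bullet> b) *\<^sub>R L y b) has_derivative (\<lambda>u. L' u (F x))) (at x)"
      by (rule has_derivative_transform_within_open[OF L'[of "F x"] assms(1,2)]) (rule exp)
  qed
  from D have "((\<lambda>y. \<Sum>b\<in>Basis. (F y \<bullet> b) *\<^sub>R L y b) has_derivative
      (\<lambda>u. L' u (F x) + L x (F' u))) (at x)"
    unfolding sum.distrib 1 exp[OF assms(2), symmetric] .
  then show ?thesis
    by (rule has_derivative_transform_within_open[OF _ assms(1,2)]) (rule exp[symmetric])
qed

text \<open>\<open>levi_civita\<close> is a definite description; nondegeneracy of
  \<open>g x\<close> supplies the uniqueness that makes it computable.\<close>

lemma levi_civita_eqI: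
  assumes C: "bilinear C" "\<And>u v. C u v = C v u"
    "\<And>u v w. frechet_derivative (\<lambda>y. g y v w) (at x) u = g x (C u v) w + g x v (C u w)"
    and g: "bilinear (g x)" "\<And>v w. g x v w = g x w v" "\<And>v. (\<And>w. g x v w = 0) \<Longrightarrow> v = 0"
  shows "levi_civita g x = C"
  unfolding levi_civita_def
proof (rule the_equality)
  fix D
  assume D: "bilinear D \<and> (\<forall>u v. D u v = D v u) \<and>
    (\<forall>u v w. frechet_derivative (\<lambda>y. g y v w) (at x) u = g x (D u v) w + g x v (D u w))"
  define Z where "Z u v = D u v - C u v" for u v
  have skew: "g x (Z u v) w = - g x v (Z u w)" for u v w
  proof -
    have "g x (D u v) w + g x v (D u w) = g x (C u v) w + g x v (C u w)"
      using D C(3)[where u=u and v=v and w=w] by metis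
    then show ?thesis unfolding Z_def by (simp add: bilinear_lsub[OF g(1)] bilinear_rsub[OF g(1)])
  qed
  have Zs: "Z u v = Z v u" for u v unfolding Z_def using D C(2) by metis
  \<comment> \<open>The form is symmetric in u, v and skew in v, w; alternating the two rules leads
    back to the same arguments with the opposite sign.\<close>
  have "g x (Z u v) w = 0" for u v w
    using skew[of u v w] skew[of w v u] skew[of v w u] Zs g(2) by (smt (verit))
  then have "Z u v = 0" for u v using g(3) by blast
  then show "D = C" by (simp add: Z_def fun_eq_iff)
qed (use C in auto)

text \<open>In a coframe \<open>\<theta>\<close> with dual frame \<open>E\<close>, a linear connection is \<open>\<theta> (\<nabla>\<^sub>v w) = \<theta>' v w + K v (\<theta> w)\<close>
  for constant \<open>w\<close>, where \<open>\<theta>'\<close> and \<open>\<theta>''\<close> are the first two derivatives of \<open>\<theta>\<close>.\<close>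

locale coframe_field =
  fixes \<theta> E :: "real^'n \<Rightarrow> real^'n \<Rightarrow> real^'n"
    and \<theta>' :: "real^'n \<Rightarrow> real^'n \<Rightarrow> real^'n \<Rightarrow> real^'n"
    and \<theta>'' :: "real^'n \<Rightarrow> real^'n \<Rightarrow> real^'n \<Rightarrow> real^'n \<Rightarrow> real^'n"
  assumes lin: "linear (\<theta> x)"
    and E_theta [simp]: "E x (\<theta> x v) = v"
    and theta_E [simp]: "\<theta> x (E x v) = v"
    and d1: "((\<lambda>y. \<theta> y w) has_derivative (\<lambda>u. \<theta>' x u w)) (at x)"
    and d2: "((\<lambda>y. \<theta>' y u w) has_derivative (\<lambda>z. \<theta>'' x z u w)) (at x)"
    and sym2: "\<theta>'' x z u w = \<theta>'' x u z w"
    and dE: "(\<lambda>y. E y w) differentiable (at x)"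
begin

lemma linE: "linear (E x)"
proof (rule linearI)
  show "E x (a + b) = E x a + E x b" for a b
    using E_theta[of x "E x a + E x b"] by (simp add: linear_add[OF lin])
  show "E x (c *\<^sub>R a) = c *\<^sub>R E x a" for a c
    using E_theta[of x "c *\<^sub>R E x a"] by (simp add: linear_scale[OF lin])
qed

lemma bilinear_deriv: "bilinear (\<theta>' x)"
  unfolding bilinear_def
proof (intro conjI allI)
  show "linear (\<lambda>w. \<theta>' x u w)" for u
  proof (rule linearI)
    fix a b
    have "(\<lambda>u. \<theta>' x u (a + b)) = (\<lambda>u. \<theta>' x u a + \<theta>' x u b)"
      by (rule has_derivative_unique[OF d1])
        (simp add: linear_add[OF lin] has_derivative_add d1)
    then show "\<theta>' x u (a + b) = \<theta>' x u a + \<theta>' x u b" by (rule fun_cong)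
  next
    fix c a
    have "(\<lambda>u. \<theta>' x u (c *\<^sub>R a)) = (\<lambda>u. c *\<^sub>R \<theta>' x u a)"
      by (rule has_derivative_unique[OF d1])
        (simp add: linear_scale[OF lin] has_derivative_scaleR_right d1)
    then show "\<theta>' x u (c *\<^sub>R a) = c *\<^sub>R \<theta>' x u a" by (rule fun_cong)
  qed
  show "linear (\<lambda>u. \<theta>' x u w)" for w
    using has_derivative_linear[OF d1] .
qed

text \<open>Differentiating \<open>\<theta> y (E y w) = w\<close> determines the derivative of the
  inverse; \<open>dE\<close> supplies its existence.\<close>

lemma has_derivative_E:
  "((\<lambda>y. E y w) has_derivative (\<lambda>u. - E x (\<theta>' x u (E x w)))) (at x)"
proof -
  obtain E' where E': "((\<lambda>y. E y w) has_derivative E') (at x)"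
    using dE unfolding differentiable_def by blast
  have "((\<lambda>y. \<theta> y (E y w)) has_derivative (\<lambda>u. \<theta>' x u (E x w) + \<theta> x (E' u))) (at x)"
    by (rule has_derivative_linear_family[OF open_UNIV UNIV_I lin d1 E'])
  moreover have "((\<lambda>y. \<theta> y (E y w)) has_derivative (\<lambda>u. 0)) (at x)" by simp
  ultimately have "(\<lambda>u. \<theta>' x u (E x w) + \<theta> x (E' u)) = (\<lambda>u. 0)"
    by (rule has_derivative_unique)
  then have "\<theta>' x u (E x w) + \<theta> x (E' u) = 0" for u by (rule fun_cong)
  then have "\<theta> x (E' u) = - \<theta>' x u (E x w)" for u
    by (simp add: eq_neg_iff_add_eq_0 add.commute)
  then have "E' u = - E x (\<theta>' x u (E x w))" for u
    using E_theta[of x "E' u"] by (simp add: linear_neg[OF linE])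
  then have "E' = (\<lambda>u. - E x (\<theta>' x u (E x w)))" by (rule ext)
  then show ?thesis using E' by simp
qed

text \<open>Serves g itself (c = 1, \<alpha> = 0) and its conformal multiples (\<alpha> the
  differential of half the logarithm of c). The coframe is not rescaled, so \<open>K\<close> is skew
  only up to the term with \<alpha>.\<close>

lemma levi_civita_scaled:
  assumes g: "g = (\<lambda>y a b. c y * (\<theta> y a \<bullet> \<theta> y b))" and c: "c x > 0"
    and c': "(c has_derivative (\<lambda>u. 2 * c x * \<alpha> u)) (at x)"
    and K: "bilinear K" "\<And>u X Y. K u X \<bullet> Y + X \<bullet> K u Y = 2 * \<alpha> u * (X \<bullet> Y)"
      "\<And>v w. \<theta>' x v w - \<theta>' x w v = K w (\<theta> x v) - K v (\<theta> x w)"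
  shows "levi_civita g x = (\<lambda>v w. E x (\<theta>' x v w + K v (\<theta> x w)))"
proof (rule levi_civita_eqI)
  show "bilinear (\<lambda>v w. E x (\<theta>' x v w + K v (\<theta> x w)))"
    using bilinear_deriv[of x] K(1) lin[of x] linE[of x]
    unfolding bilinear_def linear_iff by (auto simp: algebra_simps)
  show "E x (\<theta>' x v w + K v (\<theta> x w)) = E x (\<theta>' x w v + K w (\<theta> x v))" for v w
    using K(3)[of v w] by (simp add: algebra_simps)
  show "bilinear (g x)"
    using lin[of x] unfolding bilinear_def linear_iff g by (auto simp: algebra_simps inner_simps)
  show "g x v w = g x w v" for v w by (simp add: g inner_commute)
  show "v = 0" if "\<And>w. g x v w = 0" for v
  proof -
    have "\<theta> x v = 0" using that[of v] c by (simp add: g)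
    then show ?thesis using E_theta[of x v] by (simp add: linear_0[OF linE])
  qed
  show "frechet_derivative (\<lambda>y. g y v w) (at x) u
      = g x (E x (\<theta>' x u v + K u (\<theta> x v))) w + g x v (E x (\<theta>' x u w + K u (\<theta> x w)))" for u v w
  proof -
    have "((\<lambda>y. g y v w) has_derivative (\<lambda>u. c x * (\<theta> x v \<bullet> \<theta>' x u w + \<theta>' x u v \<bullet> \<theta> x w)
        + 2 * c x * \<alpha> u * (\<theta> x v \<bullet> \<theta> x w))) (at x)"
      unfolding g by (intro has_derivative_mult c' has_derivative_inner d1)
    note fd = frechet_derivative_at[OF this, symmetric]
    have "c x * (K u (\<theta> x v) \<bullet> \<theta> x w) + c x * (\<theta> x v \<bullet> K u (\<theta> x w)) = 2 * c x * \<alpha> u * (\<theta> x v \<bullet> \<theta> x w)"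
      using arg_cong[OF K(2)[of u "\<theta> x v" "\<theta> x w"], of "\<lambda>r. c x * r"] by (simp add: distrib_left)
    then show ?thesis unfolding fd by (simp add: g inner_add_left inner_add_right distrib_left)
  qed
qed

lemma riemann_frame:
  assumes V: "open V" "x \<in> V"
    and lc: "\<And>y. y \<in> V \<Longrightarrow> levi_civita g y = (\<lambda>v w. E y (\<theta>' y v w + K y v (\<theta> y w)))"
    and K: "\<And>y v. y \<in> V \<Longrightarrow> linear (K y v)"
    and K': "\<And>v F. ((\<lambda>y. K y v F) has_derivative (\<lambda>u. K' u v F)) (at x)"
  shows "riemann g x u v w = E x (K' u v (\<theta> x w) - K' v u (\<theta> x w)
    + K x u (K x v (\<theta> x w)) - K x v (K x u (\<theta> x w)))"
proof -
  define F where "F v = \<theta>' x v w + K x v (\<theta> x w)" for v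
  \<comment> \<open>Taken together with the quadratic term, the derivative of \<open>E\<close>
    cancels the \<open>\<theta>'\<close> part of the outer Christoffel map. The remaining terms with
    \<open>\<theta>'\<close> and \<open>\<theta>''\<close> are symmetric in u and v and drop out of
    the curvature.\<close>
  have D: "frechet_derivative (\<lambda>y. levi_civita g y v w) (at x) u + levi_civita g x u (levi_civita g x v w)
    = E x (\<theta>'' x u v w + K' u v (\<theta> x w) + K x v (\<theta>' x u w) + K x u (F v))" for u v
  proof -
    have dF: "((\<lambda>y. \<theta>' y v w + K y v (\<theta> y w)) has_derivative
        (\<lambda>u. \<theta>'' x u v w + (K' u v (\<theta> x w) + K x v (\<theta>' x u w)))) (at x)"
      using K by (intro has_derivative_add d2 has_derivative_linear_family[OF V _ K' d1])
    have "((\<lambda>y. E y (\<theta>' y v w + K y v (\<theta> y w))) has_derivative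
        (\<lambda>u. - E x (\<theta>' x u (E x (F v))) + E x (\<theta>'' x u v w + (K' u v (\<theta> x w) + K x v (\<theta>' x u w))))) (at x)"
      using has_derivative_linear_family[OF open_UNIV UNIV_I linE has_derivative_E dF] by (simp add: F_def)
    then have "((\<lambda>y. levi_civita g y v w) has_derivative
        (\<lambda>u. - E x (\<theta>' x u (E x (F v))) + E x (\<theta>'' x u v w + (K' u v (\<theta> x w) + K x v (\<theta>' x u w))))) (at x)"
      by (rule has_derivative_transform_within_open[OF _ V]) (simp add: lc)
    note fd = frechet_derivative_at[OF this, symmetric]
    have 1: "levi_civita g x v w = E x (F v)" by (simp add: lc[OF V(2)] F_def)
    have 2: "levi_civita g x u (E x (F v)) = E x (\<theta>' x u (E x (F v)) + K x u (F v))"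
      by (simp add: lc[OF V(2)])
    show ?thesis unfolding 1 2 fd by (simp add: linear_add[OF linE])
  qed
  have "riemann g x u v w =
      (frechet_derivative (\<lambda>y. levi_civita g y v w) (at x) u + levi_civita g x u (levi_civita g x v w))
    - (frechet_derivative (\<lambda>y. levi_civita g y u w) (at x) v + levi_civita g x v (levi_civita g x u w))"
    by (simp add: riemann_def)
  also have "\<dots> = E x ((\<theta>'' x u v w + K' u v (\<theta> x w) + K x v (\<theta>' x u w) + K x u (F v))
      - (\<theta>'' x v u w + K' v u (\<theta> x w) + K x u (\<theta>' x v w) + K x v (F u)))"
    unfolding D by (simp add: linear_diff[OF linE])
  also have "\<dots> = E x (K' u v (\<theta> x w) - K' v u (\<theta> x w)
    + K x u (K x v (\<theta> x w)) - K x v (K x u (\<theta> x w)))"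
    by (rule arg_cong[where f="E x"]) (simp add: F_def linear_add[OF K[OF V(2)]] sym2[of x v u])
  finally show ?thesis .
qed

end

text \<open>The connection coefficients \<open>\<Gamma>\<close> in the frame are the same at all
  points, as for an invariant metric on a Lie group. Curvature and its derivative thereby become
  polynomials in \<open>\<Gamma>\<close>.\<close>

locale parallel_frame = coframe_field \<theta> E \<theta>' \<theta>''
  for \<theta> E \<theta>' and \<theta>'' :: "real^'n \<Rightarrow> real^'n \<Rightarrow> real^'n \<Rightarrow> real^'n \<Rightarrow> real^'n" +
  fixes \<Gamma> :: "real^'n \<Rightarrow> real^'n \<Rightarrow> real^'n" and g
  assumes bil: "bilinear \<Gamma>"
    and skew: "\<Gamma> X Y \<bullet> Z = - (Y \<bullet> \<Gamma> X Z)"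
    and torsion_free: "\<theta>' x v w - \<theta>' x w v = \<Gamma> (\<theta> x w) (\<theta> x v) - \<Gamma> (\<theta> x v) (\<theta> x w)"
    and g_def: "g = (\<lambda>y a b. \<theta> y a \<bullet> \<theta> y b)"
begin

lemmas lin2 = bil[unfolded bilinear_def, THEN conjunct1, rule_format]
  and lin1 = bil[unfolded bilinear_def, THEN conjunct2, rule_format]

text \<open>The last term is the connection along the bracket of two frame fields, which
  torsion-freeness expresses by the skew part of \<Gamma>. It arises from differentiating the
  \<theta> inside \<Gamma>.\<close>

definition Rc :: "real^'n \<Rightarrow> real^'n \<Rightarrow> real^'n \<Rightarrow> real^'n" where
  "Rc X Y Z = \<Gamma> X (\<Gamma> Y Z) - \<Gamma> Y (\<Gamma> X Z) - \<Gamma> (\<Gamma> X Y - \<Gamma> Y X) Z"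

lemma levi_civita: "levi_civita g x = (\<lambda>v w. E x (\<theta>' x v w + \<Gamma> (\<theta> x v) (\<theta> x w)))"
proof (rule levi_civita_scaled[where c="\<lambda>_. 1" and \<alpha>="\<lambda>_. 0"])
  show "bilinear (\<lambda>v. \<Gamma> (\<theta> x v))"
    using bil lin[of x] unfolding bilinear_def linear_iff by auto
qed (auto simp: g_def skew torsion_free)

lemma riemann: "riemann g x u v w = E x (Rc (\<theta> x u) (\<theta> x v) (\<theta> x w))"
proof -
  have "riemann g x u v w = E x (\<Gamma> (\<theta>' x u v) (\<theta> x w) - \<Gamma> (\<theta>' x v u) (\<theta> x w)
    + \<Gamma> (\<theta> x u) (\<Gamma> (\<theta> x v) (\<theta> x w)) - \<Gamma> (\<theta> x v) (\<Gamma> (\<theta> x u) (\<theta> x w)))"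
  proof (rule riemann_frame[OF open_UNIV UNIV_I levi_civita lin2])
    show "((\<lambda>y. \<Gamma> (\<theta> y v) F) has_derivative (\<lambda>u. \<Gamma> (\<theta>' x u v) F)) (at x)" for v F
      by (rule bounded_linear.has_derivative[OF linear_conv_bounded_linear[THEN iffD1, OF lin1] d1])
  qed
  moreover have "\<Gamma> (\<theta>' x u v) Z - \<Gamma> (\<theta>' x v u) Z = - \<Gamma> (\<Gamma> (\<theta> x u) (\<theta> x v) - \<Gamma> (\<theta> x v) (\<theta> x u)) Z" for Z
  proof -
    have "\<Gamma> (\<theta>' x u v) Z - \<Gamma> (\<theta>' x v u) Z = \<Gamma> (\<theta>' x u v - \<theta>' x v u) Z"
      by (simp add: linear_diff[OF lin1])
    also have "\<theta>' x u v - \<theta>' x v u = - (\<Gamma> (\<theta> x u) (\<theta> x v) - \<Gamma> (\<theta> x v) (\<theta> x u))"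
      using torsion_free[of x u v] by simp
    finally show ?thesis by (simp only: linear_neg[OF lin1])
  qed
  ultimately show ?thesis by (simp add: Rc_def algebra_simps)
qed

text \<open>\<open>Rc\<close> has constant coefficients in the frame, so its covariant derivative is
  the action of \<open>\<Gamma> (\<theta> x z)\<close> as a derivation.\<close>

lemma nabla_riemann:
  "nabla_riemann g x z u v w = E x (\<Gamma> (\<theta> x z) (Rc (\<theta> x u) (\<theta> x v) (\<theta> x w))
    - Rc (\<Gamma> (\<theta> x z) (\<theta> x u)) (\<theta> x v) (\<theta> x w) - Rc (\<theta> x u) (\<Gamma> (\<theta> x z) (\<theta> x v)) (\<theta> x w)
    - Rc (\<theta> x u) (\<theta> x v) (\<Gamma> (\<theta> x z) (\<theta> x w)))"
proof -
  have b: "bounded_bilinear \<Gamma>" using bil by (simp add: bilinear_conv_bounded_bilinear)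
  have add: "Rc (a + b) Y Z = Rc a Y Z + Rc b Y Z" "Rc X (a + b) Z = Rc X a Z + Rc X b Z"
    "Rc X Y (a + b) = Rc X Y a + Rc X Y b" for a b X Y Z
    by (simp_all add: Rc_def linear_add[OF lin1] linear_add[OF lin2] linear_diff[OF lin1] algebra_simps)
  let ?D = "\<lambda>z. Rc (\<theta>' x z u) (\<theta> x v) (\<theta> x w) + Rc (\<theta> x u) (\<theta>' x z v) (\<theta> x w) + Rc (\<theta> x u) (\<theta> x v) (\<theta>' x z w)"
  have dR: "((\<lambda>y. Rc (\<theta> y u) (\<theta> y v) (\<theta> y w)) has_derivative ?D) (at x)"
  proof -
    note FD = bounded_bilinear.FDERIV[OF b]
    have "((\<lambda>y. Rc (\<theta> y u) (\<theta> y v) (\<theta> y w)) has_derivative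
      (\<lambda>z. (\<Gamma> (\<theta> x u) (\<Gamma> (\<theta> x v) (\<theta>' x z w) + \<Gamma> (\<theta>' x z v) (\<theta> x w)) + \<Gamma> (\<theta>' x z u) (\<Gamma> (\<theta> x v) (\<theta> x w)))
       - (\<Gamma> (\<theta> x v) (\<Gamma> (\<theta> x u) (\<theta>' x z w) + \<Gamma> (\<theta>' x z u) (\<theta> x w)) + \<Gamma> (\<theta>' x z v) (\<Gamma> (\<theta> x u) (\<theta> x w)))
       - (\<Gamma> (\<Gamma> (\<theta> x u) (\<theta> x v) - \<Gamma> (\<theta> x v) (\<theta> x u)) (\<theta>' x z w)
          + \<Gamma> ((\<Gamma> (\<theta> x u) (\<theta>' x z v) + \<Gamma> (\<theta>' x z u) (\<theta> x v)) - (\<Gamma> (\<theta> x v) (\<theta>' x z u) + \<Gamma> (\<theta>' x z v) (\<theta> x u))) (\<theta> x w)))) (at x)"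
      unfolding Rc_def by (intro has_derivative_diff FD d1)
    then show ?thesis
      by (rule has_derivative_eq_rhs)
        (simp add: Rc_def fun_eq_iff linear_add[OF lin1] linear_add[OF lin2] linear_diff[OF lin1] algebra_simps)
  qed
  have "((\<lambda>y. E y (Rc (\<theta> y u) (\<theta> y v) (\<theta> y w))) has_derivative
      (\<lambda>z. - E x (\<theta>' x z (E x (Rc (\<theta> x u) (\<theta> x v) (\<theta> x w)))) + E x (?D z))) (at x)"
    by (rule has_derivative_linear_family[OF open_UNIV UNIV_I linE has_derivative_E dR])
  then have "((\<lambda>y. riemann g y u v w) has_derivative
      (\<lambda>z. - E x (\<theta>' x z (E x (Rc (\<theta> x u) (\<theta> x v) (\<theta> x w)))) + E x (?D z))) (at x)"
    by (simp add: riemann)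
  from frechet_derivative_at[OF this, symmetric] show ?thesis
    unfolding nabla_riemann_def
    by (simp add: riemann levi_civita add linear_add[OF linE] linear_diff[OF linE] linear_add[OF lin])
qed

text \<open>Conjugation by \<open>\<theta> x\<close> does not change a trace, so the trace may be
  computed in the frame.\<close>

lemma ricci: "ricci g x v w = (\<Sum>i\<in>UNIV. Rc (axis i 1) (\<theta> x v) (\<theta> x w) $ i)"
proof -
  let ?R = "\<lambda>X. Rc X (\<theta> x v) (\<theta> x w)"
  have R: "linear ?R"
    unfolding linear_iff
    by (simp add: Rc_def linear_add[OF lin1] linear_add[OF lin2] linear_diff[OF lin1] linear_diff[OF lin2]
        linear_scale[OF lin1] linear_scale[OF lin2] algebra_simps)
  have "ricci g x v w = trace (matrix (E x \<circ> (?R \<circ> \<theta> x)))"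
    by (simp add: ricci_def riemann o_def)
  also have "\<dots> = trace (matrix ((?R \<circ> \<theta> x) \<circ> E x))"
    unfolding matrix_compose[OF linear_compose[OF lin R] linE]
      matrix_compose[OF linE linear_compose[OF lin R]] by (rule trace_mul_sym)
  also have "\<dots> = (\<Sum>i\<in>UNIV. ?R (axis i 1) $ i)"
    by (simp add: o_def trace_def matrix_def)
  finally show ?thesis .
qed

text \<open>The Weyl tensor is conformally invariant and agrees with the curvature on four mutually orthogonal
  vectors.\<close>

lemma conformally_flat_curvature:
  assumes flat: "conformally_flat M g" and x: "x \<in> M"
    and orth: "X \<bullet> Y = 0" "X \<bullet> Z = 0" "X \<bullet> W = 0" "Y \<bullet> Z = 0" "Y \<bullet> W = 0" "Z \<bullet> W = 0"
  shows "Rc X Y Z \<bullet> W = 0"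
proof -
  obtain V f where V: "open V" "x \<in> V" and f: "smooth_on V f"
    and zero: "\<And>u v w. riemann (\<lambda>y a b. exp (2 * f y) * g y a b) x u v w = 0"
    using bspec[OF flat[unfolded conformally_flat_def] x] by (elim exE conjE) simp
  define df where "df y = frechet_derivative f (at y)" for y
  have df: "(f has_derivative df y) (at y)" if "y \<in> V" for y
    using smooth_on_has_derivative[OF f that] by (simp add: df_def)
  have lindf: "linear (df y)" if "y \<in> V" for y
    using has_derivative_linear[OF df[OF that]] .
  define ddf where "ddf u v = frechet_derivative (\<lambda>y. df y v) (at x) u" for u v
  have ddf: "((\<lambda>y. df y v) has_derivative (\<lambda>u. ddf u v)) (at x)" for v
    using smooth_on_has_derivative[OF smooth_on_frechet_derivative[OF f, of v] V(2)]
    by (simp add: ddf_def[abs_def] df_def)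
  \<comment> \<open>The gradient of f in frame components.\<close>
  define \<phi> where "\<phi> y = (\<Sum>b\<in>Basis. df y (E y b) *\<^sub>R b)" for y
  have \<phi>: "\<phi> y \<bullet> \<theta> y v = df y v" if "y \<in> V" for y v
  proof -
    have "\<phi> y \<bullet> \<theta> y v = (\<Sum>b\<in>Basis. (\<theta> y v \<bullet> b) * df y (E y b))"
      by (subst inner_commute) (simp add: \<phi>_def inner_sum_right mult.commute)
    also have "\<dots> = df y (E y (\<Sum>b\<in>Basis. (\<theta> y v \<bullet> b) *\<^sub>R b))"
      by (simp add: linear_sum[OF linE] linear_scale[OF linE] linear_sum[OF lindf[OF that]] linear_scale[OF lindf[OF that]])
    finally show ?thesis by (simp add: euclidean_representation)
  qed
  define \<phi>' where "\<phi>' u = (\<Sum>b\<in>Basis. (ddf u (E x b) + df x (- E x (\<theta>' x u (E x b)))) *\<^sub>R b)" for u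
  have \<phi>': "(\<phi> has_derivative \<phi>') (at x)"
    unfolding \<phi>_def[abs_def] \<phi>'_def[abs_def]
    by (intro has_derivative_sum has_derivative_scaleR_left
        has_derivative_linear_family[OF V lindf ddf has_derivative_E])
  \<comment> \<open>Conformal change of the connection in the unscaled coframe: nabla_v F + df(v) F
    + df(F) v - g(v, F) grad f.\<close>
  define K where "K y v F = \<Gamma> (\<theta> y v) F + df y v *\<^sub>R F + (\<phi> y \<bullet> F) *\<^sub>R \<theta> y v - (\<theta> y v \<bullet> F) *\<^sub>R \<phi> y" for y v F
  define K' where "K' u v F = \<Gamma> (\<theta>' x u v) F + ddf u v *\<^sub>R F + ((\<phi> x \<bullet> F) *\<^sub>R \<theta>' x u v + (\<phi>' u \<bullet> F) *\<^sub>R \<theta> x v)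
      - ((\<theta> x v \<bullet> F) *\<^sub>R \<phi>' u + (\<theta>' x u v \<bullet> F) *\<^sub>R \<phi> x)" for u v F
  have lc: "levi_civita (\<lambda>y a b. exp (2 * f y) * g y a b) y = (\<lambda>v w. E y (\<theta>' y v w + K y v (\<theta> y w)))"
    if y: "y \<in> V" for y
  proof (rule levi_civita_scaled[where c="\<lambda>y. exp (2 * f y)" and \<alpha>="df y"])
    show "((\<lambda>y. exp (2 * f y)) has_derivative (\<lambda>u. 2 * exp (2 * f y) * df y u)) (at y)"
      by (rule has_derivative_eq_rhs, rule has_derivative_exp, rule has_derivative_mult_right, rule df[OF y])
        (simp add: fun_eq_iff)
    show "bilinear (K y)"
      using bil lin[of y] lindf[OF y] unfolding bilinear_def linear_iff K_def
      by (simp add: inner_simps algebra_simps)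
    show "K y u X \<bullet> Y + X \<bullet> K y u Y = 2 * df y u * (X \<bullet> Y)" for u X Y
      unfolding K_def using skew[of "\<theta> y u" X Y] by (simp add: inner_simps algebra_simps inner_commute)
    show "\<theta>' y v w - \<theta>' y w v = K y w (\<theta> y v) - K y v (\<theta> y w)" for v w
      unfolding K_def using torsion_free[of y v w] \<phi>[OF y] by (simp add: inner_commute)
  qed (simp_all add: g_def)
  have K': "((\<lambda>y. K y v F) has_derivative (\<lambda>u. K' u v F)) (at x)" for v F
    unfolding K_def K'_def
    by (intro has_derivative_add has_derivative_diff has_derivative_scaleR has_derivative_scaleR_left
        has_derivative_inner_left d1 ddf \<phi>'
        bounded_linear.has_derivative[OF linear_conv_bounded_linear[THEN iffD1, OF lin1]])
  have linK: "linear (K y v)" for y v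
    unfolding linear_iff K_def
    by (simp add: linear_add[OF lin2] linear_scale[OF lin2] inner_simps algebra_simps)
  let ?u = "E x X" and ?v = "E x Y" and ?w = "E x Z"
  have "E x (K' ?u ?v Z - K' ?v ?u Z + K x ?u (K x ?v Z) - K x ?v (K x ?u Z)) = 0"
    using riemann_frame[OF V lc linK K', of ?u ?v ?w] zero[of ?u ?v ?w] by simp
  then have "K' ?u ?v Z - K' ?v ?u Z + K x ?u (K x ?v Z) - K x ?v (K x ?u Z) = 0"
    using theta_E[of x "K' ?u ?v Z - K' ?v ?u Z + K x ?u (K x ?v Z) - K x ?v (K x ?u Z)"]
    by (simp add: linear_0[OF lin])
  then have "(K' ?u ?v Z - K' ?v ?u Z + K x ?u (K x ?v Z) - K x ?v (K x ?u Z)) \<bullet> W = 0" by simp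
  moreover have "\<theta>' x ?u ?v = \<theta>' x ?v ?u + (\<Gamma> Y X - \<Gamma> X Y)"
    using torsion_free[of x ?u ?v] by (simp add: algebra_simps)
  \<comment> \<open>Paired with W, each term involving f has one of the six zero inner products as a
    factor or cancels by skewness of \<Gamma> and the structure equation. What remains is
    \<open>Rc\<close>.\<close>
  ultimately show ?thesis
    unfolding K'_def K_def Rc_def
    using orth skew[of X Z Y] skew[of Y Z X]
    by (simp add: linear_add[OF lin1] linear_add[OF lin2] linear_diff[OF lin1] linear_diff[OF lin2]
        linear_scale[OF lin1] linear_scale[OF lin2] inner_simps algebra_simps inner_commute)
qed

end

section \<open>Three by three matrices\<close>

lemma exhaust_9: "x = 1 \<or> x = 2 \<or> x = 3 \<or> x = 4 \<or> x = 5 \<or> x = 6 \<or> x = 7 \<or> x = 8 \<or> x = 9" for x :: 9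
proof (induct x)
  case (of_int z)
  then have "0 \<le> z" "z < 9" by simp_all
  then have "z = 0 \<or> z = 1 \<or> z = 2 \<or> z = 3 \<or> z = 4 \<or> z = 5 \<or> z = 6 \<or> z = 7 \<or> z = 8" by arith
  then show ?case by auto
qed

lemma UNIV_9: "(UNIV :: 9 set) = {1, 2, 3, 4, 5, 6, 7, 8, 9}"
  using exhaust_9 by auto

lemma sum_9: "sum f (UNIV :: 9 set) = f 1 + f 2 + f 3 + f 4 + f 5 + f 6 + f 7 + f 8 + f 9"
  unfolding UNIV_9 by (simp add: add.assoc)

lemma forall_9: "(\<forall>i::9. P i) \<longleftrightarrow> P 1 \<and> P 2 \<and> P 3 \<and> P 4 \<and> P 5 \<and> P 6 \<and> P 7 \<and> P 8 \<and> P 9"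
  by (metis exhaust_9)

definition mat9 :: "real^3^3 \<Rightarrow> real^9" where
  "mat9 A = (\<chi> i. if i = 1 then A$1$1 else if i = 2 then A$1$2 else if i = 3 then A$1$3
    else if i = 4 then A$2$1 else if i = 5 then A$2$2 else if i = 6 then A$2$3
    else if i = 7 then A$3$1 else if i = 8 then A$3$2 else A$3$3)"

lemma sigma_nth:
  "sigma a $ 1 $ 1 = a$1" "sigma a $ 1 $ 2 = a$2" "sigma a $ 1 $ 3 = a$3"
  "sigma a $ 2 $ 1 = a$4" "sigma a $ 2 $ 2 = a$5" "sigma a $ 2 $ 3 = a$6"
  "sigma a $ 3 $ 1 = a$7" "sigma a $ 3 $ 2 = a$8" "sigma a $ 3 $ 3 = a$9"
  by (simp_all add: sigma_def)

lemma mat9_nth: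
  "mat9 A $ 1 = A$1$1" "mat9 A $ 2 = A$1$2" "mat9 A $ 3 = A$1$3"
  "mat9 A $ 4 = A$2$1" "mat9 A $ 5 = A$2$2" "mat9 A $ 6 = A$2$3"
  "mat9 A $ 7 = A$3$1" "mat9 A $ 8 = A$3$2" "mat9 A $ 9 = A$3$3"
  by (simp_all add: mat9_def)

lemma sigma_mat9 [simp]: "sigma (mat9 A) = A"
  by (simp add: vec_eq_iff forall_3 sigma_nth mat9_nth)

lemma mat9_sigma [simp]: "mat9 (sigma a) = a"
  by (simp add: vec_eq_iff forall_9 sigma_nth mat9_nth)

lemma sigma_eq_iff: "a = b \<longleftrightarrow> (\<forall>r. sigma a $ r = sigma b $ r)"
  using mat9_sigma by (metis vec_eq_iff)

lemma inv_sigma: "inv sigma = mat9"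
  by (rule inv_equality) simp_all

lemma linear_sigma: "linear sigma"
  by (auto simp: linear_iff vec_eq_iff forall_3 sigma_nth)

lemma linear_mat9: "linear mat9"
  by (auto simp: linear_iff vec_eq_iff forall_9 mat9_nth)

lemma sigma_simps [simp]:
  "sigma (a + b) = sigma a + sigma b" "sigma (a - b) = sigma a - sigma b" "sigma (- a) = - sigma a"
  "sigma (c *\<^sub>R a) = c *\<^sub>R sigma a" "sigma 0 = 0"
  by (simp_all add: vec_eq_iff forall_3 sigma_nth)

lemma sigma_sum: "sigma (\<Sum>i\<in>I. f i) = (\<Sum>i\<in>I. sigma (f i))"
  by (rule linear_sum[OF linear_sigma])

lemma inner_sigma: "a \<bullet> b = (\<Sum>r\<in>UNIV. sigma a $ r \<bullet> sigma b $ r)"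
  by (simp add: inner_vec_def sum_9 sum_3 sigma_nth)

text \<open>Identifies \<open>\<real>\<^sup>3\<close>, with the basis \<open>L\<^sub>1, L\<^sub>2, L\<^sub>3\<close> of \<open>so(3)\<close>, with vectors acting by cross products.\<close>

definition hat3 :: "real^3 \<Rightarrow> real^3" where
  "hat3 c = vector [c$3, - c$2, c$1]"

lemma hat3_nth: "hat3 c $ 1 = c$3" "hat3 c $ 2 = - c$2" "hat3 c $ 3 = c$1"
  by (simp_all add: hat3_def)

lemma hat3_hat3 [simp]: "hat3 (hat3 c) = c"
  by (simp add: vec_eq_iff forall_3 hat3_nth)

lemma linear_hat3: "linear hat3"
  by (auto simp: linear_iff vec_eq_iff forall_3 hat3_nth)

lemma hat3_inner [simp]: "hat3 a \<bullet> hat3 b = a \<bullet> b"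
  by (simp add: inner_vec_def sum_3 hat3_nth)

lemma hat3_simps [simp]:
  "hat3 (a + b) = hat3 a + hat3 b" "hat3 (a - b) = hat3 a - hat3 b" "hat3 (- a) = - hat3 a"
  "hat3 (c *\<^sub>R a) = c *\<^sub>R hat3 a" "hat3 0 = 0"
  by (simp_all add: vec_eq_iff forall_3 hat3_nth)

lemma linear_matrix_mult_left: "linear (\<lambda>a. mat9 (L ** sigma a))"
  by (auto simp: linear_iff vec_eq_iff forall_9 mat9_nth matrix_matrix_mult_def sum_3 sigma_nth algebra_simps)

lemma linear_matrix_mult_right: "linear (\<lambda>a. mat9 (- (sigma a ** L)))"
  by (auto simp: linear_iff vec_eq_iff forall_9 mat9_nth matrix_matrix_mult_def sum_3 sigma_nth algebra_simps)

lemma eL_vec: "sigma (eL A *v x) = Lmat A ** sigma x"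
  using fun_cong[OF matrix_vector_mul(2)[OF linear_matrix_mult_left[of "Lmat A"]], of x]
  by (simp add: eL_def inv_sigma)

lemma eR_vec: "sigma (eR A *v x) = - (sigma x ** Lmat A)"
  using fun_cong[OF matrix_vector_mul(2)[OF linear_matrix_mult_right[of "Lmat A"]], of x]
  by (simp add: eR_def inv_sigma)

lemma Lmat_nth: "Lmat A $ i $ j = (if A = 1 then (if i = 2 \<and> j = 1 then 1 else if i = 1 \<and> j = 2 then - 1 else 0)
  else if A = 2 then (if i = 3 \<and> j = 1 then 1 else if i = 1 \<and> j = 3 then - 1 else 0)
  else (if i = 3 \<and> j = 2 then 1 else if i = 2 \<and> j = 3 then - 1 else 0))"
  by (simp add: Lmat_def elem_def)

lemma sum_matrix_vector: "(\<Sum>i\<in>I. M i) *v (x::real^'n) = (\<Sum>i\<in>I. M i *v x)"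
  by (induction I rule: infinite_finite_induct) (simp_all add: matrix_vector_mult_add_rdistrib)

text \<open>Each row of \<open>sigma\<close> is a copy of the vector representation of so(3)_R, each
  column one of so(3)_L. Cross products on rows and columns thus replace 9 by 9 matrices in the
  later computations.\<close>

lemma conn_R_vec: "sigma (conn_R \<gamma> x v *v y) $ r = cross3 (hat3 (\<gamma> x v)) (sigma y $ r)"
  by (simp add: conn_R_def sum_matrix_vector sum_3 scaleR_matrix_vector_assoc[symmetric] eR_vec
      vec_eq_iff forall_3 matrix_matrix_mult_def Lmat_nth cross3_def hat3_nth algebra_simps)

lemma conn_L_vec: "column c (sigma (conn_L \<gamma> x v *v y)) = cross3 (hat3 (\<gamma> x v)) (column c (sigma y))"
  by (simp add: conn_L_def sum_matrix_vector sum_3 scaleR_matrix_vector_assoc[symmetric] eL_vec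
      vec_eq_iff forall_3 matrix_matrix_mult_def Lmat_nth cross3_def hat3_nth column_def algebra_simps)

section \<open>Wedge products\<close>

lemma wedge_2: "wedge [\<alpha>, \<beta>] [x, y] = \<alpha> x * \<beta> y - \<alpha> y * \<beta> x"
proof -
  have f: "finite {1::nat}" "0 \<notin> {1::nat}" by auto
  have U: "{..<length [\<alpha>, \<beta>]} = {0, 1::nat}" by auto
  show ?thesis
    unfolding wedge_def U sum_over_permutations_insert[OF f]
    by (simp add: permutes_sing sign_swap_id permutation_swap_id sign_compose sign_id transpose_def)
qed

lemma wedge_3: "wedge [\<alpha>, \<beta>, \<gamma>] [x, y, z] = \<alpha> x * \<beta> y * \<gamma> z + \<alpha> y * \<beta> z * \<gamma> x + \<alpha> z * \<beta> x * \<gamma> y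
   - \<alpha> x * \<beta> z * \<gamma> y - \<alpha> y * \<beta> x * \<gamma> z - \<alpha> z * \<beta> y * \<gamma> x"
proof -
  have f1: "finite {1::nat, 2}" "0 \<notin> {1::nat, 2}" by auto
  have f2: "finite {2::nat}" "1 \<notin> {2::nat}" by auto
  have U: "{..<length [\<alpha>, \<beta>, \<gamma>]} = {0, 1, 2::nat}" by auto
  show ?thesis
    unfolding wedge_def U sum_over_permutations_insert[OF f1] sum_over_permutations_insert[OF f2]
    by (simp add: permutes_sing sign_swap_id permutation_swap_id sign_compose sign_id
        permutation_compose transpose_def algebra_simps)
qed

text \<open>The three two-forms are the components of a single vector-valued form, which makes their
  behaviour under rotations visible.\<close>

lemma kappa0_cross: "kappa0 A a b = - hat3 (\<Sum>r\<in>UNIV. cross3 (sigma a $ r) (sigma b $ r)) $ A"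
  using exhaust_3[of A]
  by (auto simp: kappa0_def th_def wedge_2 hat3_nth sum_3 cross3_def sigma_nth algebra_simps)

lemma S_tensor_commute: "S_tensor u a b c = S_tensor u b a c" "S_tensor u a b c = S_tensor u a c b"
  by (simp_all add: S_tensor_def add_mset_commute)

lemma S_tensor_values:
  "S_tensor u 1 1 1 = - (u$1 + u$3)" "S_tensor u 1 2 2 = u$1" "S_tensor u 1 3 3 = u$3"
  "S_tensor u 1 1 2 = - (u$4 + u$6)" "S_tensor u 2 2 2 = u$4" "S_tensor u 2 3 3 = u$6"
  "S_tensor u 1 1 3 = - (u$5 + u$7)" "S_tensor u 2 2 3 = u$5" "S_tensor u 3 3 3 = u$7"
  "S_tensor u 1 2 3 = - u$2"
  by (simp_all add: S_tensor_def add_eq_conv_diff)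

section \<open>Cayley coordinates\<close>

lemma vec3_eqI: "x$1 = y$1 \<Longrightarrow> x$2 = y$2 \<Longrightarrow> x$3 = y$3 \<Longrightarrow> x = y" for x y :: "'a^3"
  by (simp add: vec_eq_iff forall_3)

lemma inner_3: "x \<bullet> y = x$1 * y$1 + x$2 * y$2 + x$3 * y$3" for x y :: "real^3"
  by (simp add: inner_vec_def sum_3)

lemmas vec3_simps = cross_components inner_3 vector_add_component vector_minus_component
  vector_uminus_component vector_scaleR_component real_scaleR_def

text \<open>The product of the quaternions 1 + s x and 1 + s y, divided by its real part. For s = 0
  it is addition.\<close>

definition cay_mult :: "real \<Rightarrow> real^3 \<Rightarrow> real^3 \<Rightarrow> real^3" where
  "cay_mult s x y = (1 / (1 - s\<^sup>2 * (x \<bullet> y))) *\<^sub>R (x + y + s *\<^sub>R cross3 x y)"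

text \<open>The left-invariant Maurer-Cartan form of \<open>cay_mult\<close>: with q = 1 + s x, the
  imaginary part of q^(-1) dq divided by s.\<close>

definition cay_form :: "real \<Rightarrow> real^3 \<Rightarrow> real^3 \<Rightarrow> real^3" where
  "cay_form s x v = (1 / (1 + s\<^sup>2 * (x \<bullet> x))) *\<^sub>R (v - s *\<^sub>R cross3 x v)"

text \<open>The left-invariant vector field of \<open>cay_mult\<close> with value w at 0, inverse to
  \<open>cay_form s x\<close>.\<close>

definition cay_frame :: "real \<Rightarrow> real^3 \<Rightarrow> real^3 \<Rightarrow> real^3" where
  "cay_frame s x w = w + s *\<^sub>R cross3 x w + (s\<^sup>2 * (x \<bullet> w)) *\<^sub>R x"

text \<open>Conjugation of the imaginary quaternion x by d + h, before division by the norm. The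
  real part d stays free because 1 + h times 1 + k has real part 1 - h . k.\<close>

definition rot_num :: "real \<Rightarrow> real^3 \<Rightarrow> real^3 \<Rightarrow> real^3" where
  "rot_num d h x = (d\<^sup>2 - h \<bullet> h) *\<^sub>R x + (2 * (h \<bullet> x)) *\<^sub>R h + (2 * d) *\<^sub>R cross3 h x"

definition rot :: "real^3 \<Rightarrow> real^3 \<Rightarrow> real^3" where
  "rot h x = (1 / (1 + h \<bullet> h)) *\<^sub>R rot_num 1 h x"

lemma denom_pos: "1 + s\<^sup>2 * (x \<bullet> x) > 0" for x :: "'a::real_inner"
  by (simp add: add_pos_nonneg)

lemma denom_pos': "1 + x \<bullet> x > 0" for x :: "'a::real_inner"
  by (simp add: add_pos_nonneg)

lemma cay_form_frame: "cay_form s x (cay_frame s x w) = w"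
proof -
  have "cay_frame s x w - s *\<^sub>R cross3 x (cay_frame s x w) = (1 + s\<^sup>2 * (x \<bullet> x)) *\<^sub>R w"
    by (rule vec3_eqI; simp only: cay_frame_def vec3_simps; algebra)
  then show ?thesis using denom_pos[of s x] by (simp add: cay_form_def)
qed

lemma cay_frame_form: "cay_frame s x (cay_form s x v) = v"
proof -
  have "cay_frame s x (v - s *\<^sub>R cross3 x v) = (1 + s\<^sup>2 * (x \<bullet> x)) *\<^sub>R v"
    by (rule vec3_eqI; simp only: cay_frame_def vec3_simps; algebra)
  moreover have "cay_frame s x (c *\<^sub>R w) = c *\<^sub>R cay_frame s x w" for c w
    by (simp add: cay_frame_def cross_mult_right algebra_simps)
  ultimately show ?thesis using denom_pos[of s x] by (simp add: cay_form_def)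
qed

lemma rot_num_cross: "cross3 (rot_num d h x) (rot_num d h y) = (d\<^sup>2 + h \<bullet> h) *\<^sub>R rot_num d h (cross3 x y)"
  by (rule vec3_eqI; simp only: rot_num_def vec3_simps one_power2 mult_1 mult_1_right; algebra)

lemma rot_num_inner: "rot_num d h x \<bullet> rot_num d h y = (d\<^sup>2 + h \<bullet> h)\<^sup>2 * (x \<bullet> y)"
  by (simp only: rot_num_def vec3_simps one_power2 mult_1 mult_1_right; algebra)

lemma rot_num_inverse: "rot_num d (- h) (rot_num d h x) = (d\<^sup>2 + h \<bullet> h)\<^sup>2 *\<^sub>R x"
  by (rule vec3_eqI; simp only: rot_num_def vec3_simps one_power2 mult_1 mult_1_right; algebra)

lemma rot_num_mult: "rot_num (1 - h \<bullet> k) (h + k + cross3 h k) x = rot_num 1 h (rot_num 1 k x)"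
  by (rule vec3_eqI; simp only: rot_num_def vec3_simps one_power2 mult_1 mult_1_right; algebra)

text \<open>Multiplicativity of the quaternion norm, for the factors 1 + s h and 1 + s k.\<close>

lemma quaternion_norm_mult:
  "(1 - s\<^sup>2 * (h \<bullet> k))\<^sup>2 + s\<^sup>2 * ((h + k + s *\<^sub>R cross3 h k) \<bullet> (h + k + s *\<^sub>R cross3 h k))
    = (1 + s\<^sup>2 * (h \<bullet> h)) * (1 + s\<^sup>2 * (k \<bullet> k))"
  by (simp only: vec3_simps; algebra)

lemma linear_rot_num: "linear (rot_num d h)"
  by (auto simp: linear_iff rot_num_def cross_add_right cross_mult_right algebra_simps inner_simps)

lemma linear_rot: "linear (rot h)"
  using linear_rot_num[of 1 h] by (auto simp: linear_iff rot_def algebra_simps)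

lemma rot_simps [simp]:
  "rot h (x + y) = rot h x + rot h y" "rot h (x - y) = rot h x - rot h y" "rot h (- x) = - rot h x"
  "rot h (c *\<^sub>R x) = c *\<^sub>R rot h x" "rot h 0 = 0"
  by (simp_all add: linear_add[OF linear_rot] linear_diff[OF linear_rot] linear_neg[OF linear_rot]
      linear_scale[OF linear_rot] linear_0[OF linear_rot])

lemma rot_zero [simp]: "rot 0 x = x"
  by (simp add: rot_def rot_num_def)

lemma rot_cross: "cross3 (rot h x) (rot h y) = rot h (cross3 x y)"
  using denom_pos'[of h] by (simp add: rot_def cross_mult_left cross_mult_right rot_num_cross)

lemma rot_inner [simp]: "rot h x \<bullet> rot h y = x \<bullet> y"
  using denom_pos'[of h] by (simp add: rot_def rot_num_inner power2_eq_square)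

lemma rot_inverse [simp]: "rot (- h) (rot h x) = x" "rot h (rot (- h) x) = x"
proof -
  show *: "rot (- h) (rot h x) = x" for h
    using denom_pos'[of h]
    by (simp add: rot_def linear_scale[OF linear_rot_num] rot_num_inverse power2_eq_square)
  show "rot h (rot (- h) x) = x" using *[of "- h"] by simp
qed

text \<open>Normalised conjugation does not change when the quaternion is scaled by a real number,
  so the product of 1 + h and 1 + k may be divided by its real part \<open>d\<close>.\<close>

lemma rot_mult:
  assumes "1 - h \<bullet> k \<noteq> 0"
  shows "rot (cay_mult 1 h k) x = rot h (rot k x)"
proof -
  define d p where "d = 1 - h \<bullet> k" and "p = h + k + cross3 h k"
  have d0: "d \<noteq> 0" using assms by (simp add: d_def)
  have m: "cay_mult 1 h k = (1 / d) *\<^sub>R p" by (simp add: cay_mult_def d_def p_def)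
  have n: "d\<^sup>2 + p \<bullet> p = (1 + h \<bullet> h) * (1 + k \<bullet> k)"
    using quaternion_norm_mult[of 1 h k] by (simp add: d_def p_def)
  have sc: "rot_num 1 ((1 / d) *\<^sub>R p) x = (1 / d\<^sup>2) *\<^sub>R rot_num d p x"
    using d0 by (simp add: rot_num_def cross_mult_left scaleR_diff_left scaleR_add_right scaleR_diff_right
        power2_eq_square)
  have "1 + ((1 / d) *\<^sub>R p) \<bullet> ((1 / d) *\<^sub>R p) = (d\<^sup>2 + p \<bullet> p) / d\<^sup>2"
    using d0 by (simp add: power2_eq_square divide_simps)
  then have "rot (cay_mult 1 h k) x = (1 / (d\<^sup>2 + p \<bullet> p)) *\<^sub>R rot_num d p x"
    unfolding m rot_def sc using d0 by simp
  also have "rot_num d p x = rot_num 1 h (rot_num 1 k x)"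
    unfolding d_def p_def by (rule rot_num_mult)
  finally show ?thesis
    unfolding n by (simp add: rot_def linear_scale[OF linear_rot_num])
qed

lemma rot_cay_mult: "rot h (cay_mult s x y) = cay_mult s (rot h x) (rot h y)"
  by (simp add: cay_mult_def rot_cross)

lemma rot_cay_form: "rot h (cay_form s x v) = cay_form s (rot h x) (rot h v)"
  by (simp add: cay_form_def rot_cross)

lemma cay_mult_zero [simp]: "cay_mult s x 0 = x" "cay_mult s 0 x = x"
  by (simp_all add: cay_mult_def)

lemma cay_mult_minus [simp]: "cay_mult s x (- x) = 0" "cay_mult s (- x) x = 0"
  by (simp_all add: cay_mult_def)

lemma cay_form_zero [simp]: "cay_form s 0 v = v"
  by (simp add: cay_form_def)

text \<open>With denominators cleared, \<open>n\<close> and \<open>dd\<close> compare the imaginary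
  and the real parts of the triple quaternion product. The second claim carries nonvanishing from
  one outer denominator to the other, as needed to invert translations.\<close>

lemma cay_mult_assoc:
  assumes "1 - s\<^sup>2 * (x \<bullet> y) \<noteq> 0" "1 - s\<^sup>2 * (y \<bullet> z) \<noteq> 0"
  shows "cay_mult s (cay_mult s x y) z = cay_mult s x (cay_mult s y z)"
    and "(1 - s\<^sup>2 * (cay_mult s x y \<bullet> z)) * (1 - s\<^sup>2 * (x \<bullet> y)) = (1 - s\<^sup>2 * (x \<bullet> cay_mult s y z)) * (1 - s\<^sup>2 * (y \<bullet> z))"
proof -
  define d e where "d = 1 - s\<^sup>2 * (x \<bullet> y)" and "e = 1 - s\<^sup>2 * (y \<bullet> z)"
  define p q where "p = x + y + s *\<^sub>R cross3 x y" and "q = y + z + s *\<^sub>R cross3 y z"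
  have d0: "d \<noteq> 0" and e0: "e \<noteq> 0" using assms by (simp_all add: d_def e_def)
  have l: "cay_mult s x y = (1 / d) *\<^sub>R p" and r: "cay_mult s y z = (1 / e) *\<^sub>R q"
    by (simp_all add: cay_mult_def d_def e_def p_def q_def)
  have n: "p + d *\<^sub>R z + s *\<^sub>R cross3 p z = e *\<^sub>R x + q + s *\<^sub>R cross3 x q"
    unfolding d_def e_def p_def q_def by (rule vec3_eqI; simp only: vec3_simps; algebra)
  have dd: "d - s\<^sup>2 * (p \<bullet> z) = e - s\<^sup>2 * (x \<bullet> q)"
    unfolding d_def e_def p_def q_def by (simp only: vec3_simps; algebra)
  \<comment> \<open>This includes c = s^2 r, where both sides are 0 because division by 0 yields
    0.\<close>
  have inv: "1 / (1 - s\<^sup>2 * r / c) = c / (c - s\<^sup>2 * r)" if "c \<noteq> 0" for c r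
    using that by (cases "c - s\<^sup>2 * r = 0") (simp_all add: divide_simps)
  have "cay_mult s ((1 / d) *\<^sub>R p) z = (d / (d - s\<^sup>2 * (p \<bullet> z))) *\<^sub>R ((1 / d) *\<^sub>R p + z + (s / d) *\<^sub>R cross3 p z)"
    unfolding cay_mult_def by (simp add: cross_mult_left inv[OF d0])
  also have "\<dots> = (1 / (d - s\<^sup>2 * (p \<bullet> z))) *\<^sub>R (d *\<^sub>R ((1 / d) *\<^sub>R p + z + (s / d) *\<^sub>R cross3 p z))"
    by simp
  also have "d *\<^sub>R ((1 / d) *\<^sub>R p + z + (s / d) *\<^sub>R cross3 p z) = p + d *\<^sub>R z + s *\<^sub>R cross3 p z"
    using d0 by (simp add: scaleR_add_right)
  also have "\<dots> = e *\<^sub>R (x + (1 / e) *\<^sub>R q + (s / e) *\<^sub>R cross3 x q)"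
    using e0 by (simp add: n scaleR_add_right)
  also have "(1 / (d - s\<^sup>2 * (p \<bullet> z))) *\<^sub>R \<dots> = (e / (e - s\<^sup>2 * (x \<bullet> q))) *\<^sub>R (x + (1 / e) *\<^sub>R q + (s / e) *\<^sub>R cross3 x q)"
    by (simp add: dd)
  also have "\<dots> = cay_mult s x ((1 / e) *\<^sub>R q)"
    unfolding cay_mult_def by (simp add: cross_mult_right inv[OF e0])
  finally show "cay_mult s (cay_mult s x y) z = cay_mult s x (cay_mult s y z)" unfolding l r .
  have "(1 - s\<^sup>2 * (cay_mult s x y \<bullet> z)) * d = d - s\<^sup>2 * (p \<bullet> z)"
    unfolding l using d0 by (simp add: field_simps)
  also have "\<dots> = (1 - s\<^sup>2 * (x \<bullet> cay_mult s y z)) * e"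
    unfolding dd r using e0 by (simp add: field_simps)
  finally show "(1 - s\<^sup>2 * (cay_mult s x y \<bullet> z)) * (1 - s\<^sup>2 * (x \<bullet> y)) = (1 - s\<^sup>2 * (x \<bullet> cay_mult s y z)) * (1 - s\<^sup>2 * (y \<bullet> z))"
    unfolding d_def e_def .
qed

section \<open>Derivatives in Cayley coordinates\<close>

lemma has_derivative_quotient:
  fixes p :: "'a::real_normed_vector \<Rightarrow> 'b::real_normed_vector"
  assumes "(d has_derivative d') (at y)" "(p has_derivative p') (at y)" "d y \<noteq> 0"
  shows "((\<lambda>y. (c / d y) *\<^sub>R p y) has_derivative (\<lambda>v. (c / d y) *\<^sub>R p' v - (c * d' v / (d y)\<^sup>2) *\<^sub>R p y)) (at y)"
proof -
  have "((\<lambda>y. (c * inverse (d y)) *\<^sub>R p y) has_derivative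
      (\<lambda>v. (c * inverse (d y)) *\<^sub>R p' v + (c * - (inverse (d y) * d' v * inverse (d y))) *\<^sub>R p y)) (at y)"
    by (intro has_derivative_scaleR has_derivative_mult_right Deriv.has_derivative_inverse assms)
  then show ?thesis by (simp add: field_simps power2_eq_square)
qed

lemma bounded_bilinear_cross3: "bounded_bilinear cross3"
  using bilinear_cross by (simp add: bilinear_conv_bounded_bilinear)

lemmas has_derivative_cross3 = bounded_bilinear.FDERIV[OF bounded_bilinear_cross3]

definition cay_mult_deriv :: "real \<Rightarrow> real^3 \<Rightarrow> real^3 \<Rightarrow> real^3 \<Rightarrow> real^3" where
  "cay_mult_deriv s x y v = (1 / (1 - s\<^sup>2 * (x \<bullet> y))) *\<^sub>R (v + s *\<^sub>R cross3 x v)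
     + (s\<^sup>2 * (x \<bullet> v) / (1 - s\<^sup>2 * (x \<bullet> y))\<^sup>2) *\<^sub>R (x + y + s *\<^sub>R cross3 x y)"

lemma has_derivative_cay_mult:
  assumes "1 - s\<^sup>2 * (x \<bullet> y) \<noteq> 0"
  shows "(cay_mult s x has_derivative cay_mult_deriv s x y) (at y)"
proof -
  have d: "((\<lambda>y. 1 - s\<^sup>2 * (x \<bullet> y)) has_derivative (\<lambda>v. 0 - s\<^sup>2 * (x \<bullet> v))) (at y)"
    by (intro has_derivative_diff has_derivative_const has_derivative_mult_right has_derivative_inner_right
        has_derivative_ident)
  have p: "((\<lambda>y. x + y + s *\<^sub>R cross3 x y) has_derivative
      (\<lambda>v. 0 + v + s *\<^sub>R (cross3 x v + cross3 0 y))) (at y)"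
    by (intro has_derivative_add has_derivative_const has_derivative_scaleR_right has_derivative_cross3
        has_derivative_ident)
  show ?thesis
    unfolding cay_mult_def[abs_def]
    by (rule has_derivative_eq_rhs[OF has_derivative_quotient[OF d p assms]])
      (simp add: cay_mult_deriv_def fun_eq_iff)
qed

text \<open>For constant p, (p q)^(-1) d(p q) = q^(-1) dq. The denominators are matched by
  multiplicativity of the norm, with \<open>N\<close> and \<open>M\<close> the norms of the two
  factors.\<close>

lemma cay_form_mult:
  assumes "1 - s\<^sup>2 * (x \<bullet> y) \<noteq> 0"
  shows "cay_form s (cay_mult s x y) (cay_mult_deriv s x y v) = cay_form s y v"
proof -
  define d p where "d = 1 - s\<^sup>2 * (x \<bullet> y)" and "p = x + y + s *\<^sub>R cross3 x y"
  define w where "w = v + s *\<^sub>R cross3 x v"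
  define N M where "N = 1 + s\<^sup>2 * (x \<bullet> x)" and "M = 1 + s\<^sup>2 * (y \<bullet> y)"
  have d0: "d \<noteq> 0" using assms by (simp add: d_def)
  have N0: "N \<noteq> 0" and M0: "M \<noteq> 0"
    using denom_pos[of s x] denom_pos[of s y] by (simp_all add: N_def M_def)
  have key: "d *\<^sub>R w + (s\<^sup>2 * (x \<bullet> v)) *\<^sub>R p - s *\<^sub>R cross3 p w = N *\<^sub>R (v - s *\<^sub>R cross3 y v)"
    unfolding d_def p_def w_def N_def by (rule vec3_eqI; simp only: vec3_simps; algebra)
  have m: "cay_mult s x y = (1 / d) *\<^sub>R p" by (simp add: cay_mult_def d_def p_def)
  have D: "cay_mult_deriv s x y v = (1 / d) *\<^sub>R w + (s\<^sup>2 * (x \<bullet> v) / d\<^sup>2) *\<^sub>R p"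
    by (simp add: cay_mult_deriv_def d_def p_def w_def)
  have "(1 / d) *\<^sub>R w + (s\<^sup>2 * (x \<bullet> v) / d\<^sup>2) *\<^sub>R p - s *\<^sub>R cross3 ((1 / d) *\<^sub>R p) ((1 / d) *\<^sub>R w + (s\<^sup>2 * (x \<bullet> v) / d\<^sup>2) *\<^sub>R p)
      = (1 / d\<^sup>2) *\<^sub>R (d *\<^sub>R w + (s\<^sup>2 * (x \<bullet> v)) *\<^sub>R p - s *\<^sub>R cross3 p w)"
    using d0 by (simp add: cross_mult_left cross_mult_right cross_add_right scaleR_add_right scaleR_diff_right
        power2_eq_square)
  also have "\<dots> = (N / d\<^sup>2) *\<^sub>R (v - s *\<^sub>R cross3 y v)"
    unfolding key by simp
  finally have num: "(1 / d) *\<^sub>R w + (s\<^sup>2 * (x \<bullet> v) / d\<^sup>2) *\<^sub>R p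
      - s *\<^sub>R cross3 ((1 / d) *\<^sub>R p) ((1 / d) *\<^sub>R w + (s\<^sup>2 * (x \<bullet> v) / d\<^sup>2) *\<^sub>R p) = (N / d\<^sup>2) *\<^sub>R (v - s *\<^sub>R cross3 y v)" .
  have "d\<^sup>2 + s\<^sup>2 * (p \<bullet> p) = N * M"
    unfolding d_def p_def N_def M_def by (rule quaternion_norm_mult)
  then have den: "1 + s\<^sup>2 * ((1 / d) *\<^sub>R p \<bullet> (1 / d) *\<^sub>R p) = N * M / d\<^sup>2"
    using d0 by (simp add: field_simps power2_eq_square)
  show ?thesis
    unfolding cay_form_def m D num den M_def[symmetric] using d0 N0 by simp
qed

definition cay_form_deriv :: "real \<Rightarrow> real^3 \<Rightarrow> real^3 \<Rightarrow> real^3 \<Rightarrow> real^3" where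
  "cay_form_deriv s x u v = - (s / (1 + s\<^sup>2 * (x \<bullet> x))) *\<^sub>R cross3 u v
     - (2 * s\<^sup>2 * (x \<bullet> u) / (1 + s\<^sup>2 * (x \<bullet> x))\<^sup>2) *\<^sub>R (v - s *\<^sub>R cross3 x v)"

lemma has_derivative_cay_denom:
  "((\<lambda>x. 1 + s\<^sup>2 * (x \<bullet> x)) has_derivative (\<lambda>u. 2 * s\<^sup>2 * (x \<bullet> u))) (at x)" for x :: "'a::real_inner"
proof -
  have "((\<lambda>x. 1 + s\<^sup>2 * (x \<bullet> x)) has_derivative (\<lambda>u. 0 + s\<^sup>2 * (x \<bullet> u + u \<bullet> x))) (at x)"
    by (intro has_derivative_add has_derivative_const has_derivative_mult_right has_derivative_inner
        has_derivative_ident)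
  then show ?thesis by (simp add: inner_commute algebra_simps)
qed

lemma has_derivative_cay_num:
  "((\<lambda>x. v - s *\<^sub>R cross3 x v) has_derivative (\<lambda>u. - (s *\<^sub>R cross3 u v))) (at x)"
proof -
  have "((\<lambda>x. v - s *\<^sub>R cross3 x v) has_derivative (\<lambda>u. 0 - s *\<^sub>R (cross3 x 0 + cross3 u v))) (at x)"
    by (intro has_derivative_diff has_derivative_const has_derivative_scaleR_right has_derivative_cross3
        has_derivative_ident)
  then show ?thesis by simp
qed

lemma has_derivative_cay_form:
  "((\<lambda>x. cay_form s x v) has_derivative (\<lambda>u. cay_form_deriv s x u v)) (at x)"
proof -
  have "1 + s\<^sup>2 * (x \<bullet> x) \<noteq> 0" using denom_pos[of s x] by simp
  then show ?thesis
    unfolding cay_form_def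
    by (rule has_derivative_eq_rhs[OF has_derivative_quotient[OF has_derivative_cay_denom has_derivative_cay_num]])
      (simp add: cay_form_deriv_def fun_eq_iff)
qed

text \<open>The Maurer-Cartan equation; its constant 2 s reflects the commutator 2 (x cross y) of
  imaginary quaternions, scaled by s.\<close>

lemma cay_form_deriv_antisym:
  "cay_form_deriv s x u v - cay_form_deriv s x v u = - (2 * s) *\<^sub>R cross3 (cay_form s x u) (cay_form s x v)"
proof -
  define N where "N = 1 + s\<^sup>2 * (x \<bullet> x)"
  define U V where "U = u - s *\<^sub>R cross3 x u" and "V = v - s *\<^sub>R cross3 x v"
  have N0: "N \<noteq> 0" using denom_pos[of s x] by (simp add: N_def)
  have key: "- (s * N) *\<^sub>R cross3 u v - (2 * s\<^sup>2 * (x \<bullet> u)) *\<^sub>R V - (- (s * N) *\<^sub>R cross3 v u - (2 * s\<^sup>2 * (x \<bullet> v)) *\<^sub>R U)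
      = - (2 * s) *\<^sub>R cross3 U V"
    unfolding N_def U_def V_def by (rule vec3_eqI; simp only: vec3_simps; algebra)
  have "cay_form_deriv s x u v - cay_form_deriv s x v u = (1 / N\<^sup>2) *\<^sub>R (- (s * N) *\<^sub>R cross3 u v
      - (2 * s\<^sup>2 * (x \<bullet> u)) *\<^sub>R V - (- (s * N) *\<^sub>R cross3 v u - (2 * s\<^sup>2 * (x \<bullet> v)) *\<^sub>R U))"
    unfolding cay_form_deriv_def N_def[symmetric] U_def[symmetric] V_def[symmetric]
    using N0 by (simp add: scaleR_add_right scaleR_diff_right power2_eq_square)
  also have "\<dots> = - (2 * s) *\<^sub>R cross3 ((1 / N) *\<^sub>R U) ((1 / N) *\<^sub>R V)"
    unfolding key by (simp add: cross_mult_left cross_mult_right power2_eq_square)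
  finally show ?thesis by (simp add: cay_form_def N_def U_def V_def)
qed

text \<open>Second derivatives are needed for the conditions \<open>d2\<close> and
  \<open>sym2\<close> of \<open>coframe_field\<close>.\<close>

definition cay_form_deriv2 :: "real \<Rightarrow> real^3 \<Rightarrow> real^3 \<Rightarrow> real^3 \<Rightarrow> real^3 \<Rightarrow> real^3" where
  "cay_form_deriv2 s x z u v = (2 * s ^ 3 * (x \<bullet> z) / (1 + s\<^sup>2 * (x \<bullet> x))\<^sup>2) *\<^sub>R cross3 u v
     + (2 * s ^ 3 * (x \<bullet> u) / (1 + s\<^sup>2 * (x \<bullet> x))\<^sup>2) *\<^sub>R cross3 z v
     - (2 * s\<^sup>2 * (z \<bullet> u) / (1 + s\<^sup>2 * (x \<bullet> x))\<^sup>2) *\<^sub>R (v - s *\<^sub>R cross3 x v)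
     + (8 * s ^ 4 * (x \<bullet> u) * (x \<bullet> z) / (1 + s\<^sup>2 * (x \<bullet> x)) ^ 3) *\<^sub>R (v - s *\<^sub>R cross3 x v)"

lemma cay_form_deriv2_sym: "cay_form_deriv2 s x z u v = cay_form_deriv2 s x u z v"
  by (simp add: cay_form_deriv2_def inner_commute mult.commute mult.left_commute add.commute)

lemma has_derivative_cay_form_deriv:
  "((\<lambda>x. cay_form_deriv s x u v) has_derivative (\<lambda>z. cay_form_deriv2 s x z u v)) (at x)"
proof -
  define N where "N x = 1 + s\<^sup>2 * (x \<bullet> x)" for x :: "real^3"
  define V where "V x = v - s *\<^sub>R cross3 x v" for x
  have N0: "N x \<noteq> 0" using denom_pos[of s x] by (simp add: N_def)
  have dN: "(N has_derivative (\<lambda>z. 2 * s\<^sup>2 * (x \<bullet> z))) (at x)"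
    unfolding N_def[abs_def] by (rule has_derivative_cay_denom)
  have dV: "(V has_derivative (\<lambda>z. - (s *\<^sub>R cross3 z v))) (at x)"
    unfolding V_def[abs_def] by (rule has_derivative_cay_num)
  have N2: "((\<lambda>x. (N x)\<^sup>2) has_derivative (\<lambda>z. N x * (2 * s\<^sup>2 * (x \<bullet> z)) + (2 * s\<^sup>2 * (x \<bullet> z)) * N x)) (at x)"
    unfolding power2_eq_square[of "N _"] by (intro has_derivative_mult dN)
  have dW: "((\<lambda>x. (2 * s\<^sup>2 * (x \<bullet> u)) *\<^sub>R V x) has_derivative
      (\<lambda>z. (2 * s\<^sup>2 * (x \<bullet> u)) *\<^sub>R (- (s *\<^sub>R cross3 z v)) + (2 * s\<^sup>2 * (z \<bullet> u)) *\<^sub>R V x)) (at x)"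
    by (intro has_derivative_scaleR dV has_derivative_mult_right has_derivative_inner_left has_derivative_ident)
  have N20: "(N x)\<^sup>2 \<noteq> 0" using N0 by simp
  note q1 = has_derivative_quotient[OF dN has_derivative_const[of "cross3 u v"] N0, of "- s"]
    and q2 = has_derivative_quotient[OF N2 dW N20, of 1]
  have "((\<lambda>x. ((- s) / N x) *\<^sub>R cross3 u v - (1 / (N x)\<^sup>2) *\<^sub>R ((2 * s\<^sup>2 * (x \<bullet> u)) *\<^sub>R V x)) has_derivative
     (\<lambda>z. cay_form_deriv2 s x z u v)) (at x)"
    unfolding cay_form_deriv2_def N_def[symmetric] V_def[symmetric]
    by (rule has_derivative_eq_rhs[OF has_derivative_diff[OF q1 q2]])
      (use N0 in \<open>simp add: fun_eq_iff scaleR_diff_right scaleR_add_right power2_eq_square power3_eq_cube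
        power4_eq_xxxx mult_ac add.commute\<close>)
  then show ?thesis by (simp add: cay_form_deriv_def N_def V_def)
qed

text \<open>For R = \<open>rot h\<close>, d(R^(-1)) = - (R^(-1) dR) R^(-1), and R^(-1) dR is the
  cross product with twice \<open>cay_form 1 h v\<close>. The 2 is that of the double cover of SO(3)
  by unit quaternions.\<close>

lemma has_derivative_rot_minus:
  "((\<lambda>h. rot (- h) x) has_derivative (\<lambda>v. - 2 *\<^sub>R cross3 (cay_form 1 h v) (rot (- h) x))) (at h)"
proof -
  define N where "N h = 1 + h \<bullet> h" for h :: "real^3"
  have N0: "N h \<noteq> 0" using denom_pos'[of h] by (simp add: N_def)
  have dN: "(N has_derivative (\<lambda>v. 2 * (h \<bullet> v))) (at h)"
    using has_derivative_cay_denom[of 1 h] by (simp add: N_def[abs_def])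
  define D where "D v = (- 2 * (h \<bullet> v)) *\<^sub>R x + (2 * (v \<bullet> x)) *\<^sub>R h + (2 * (h \<bullet> x)) *\<^sub>R v - 2 *\<^sub>R cross3 v x" for v
  have "((\<lambda>h. (1 - h \<bullet> h) *\<^sub>R x + (2 * (h \<bullet> x)) *\<^sub>R h - 2 *\<^sub>R cross3 h x) has_derivative
     (\<lambda>v. ((1 - h \<bullet> h) *\<^sub>R 0 + (0 - (h \<bullet> v + v \<bullet> h)) *\<^sub>R x) + ((2 * (h \<bullet> x)) *\<^sub>R v + (2 * (v \<bullet> x)) *\<^sub>R h)
        - 2 *\<^sub>R (cross3 h 0 + cross3 v x))) (at h)"
    by (intro has_derivative_add has_derivative_diff has_derivative_scaleR has_derivative_scaleR_right
        has_derivative_mult_right has_derivative_inner has_derivative_inner_left has_derivative_cross3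
        has_derivative_const has_derivative_ident)
  then have dn: "((\<lambda>h. rot_num 1 (- h) x) has_derivative D) (at h)"
    by (simp add: rot_num_def D_def[abs_def] inner_commute algebra_simps)
  have key: "N h *\<^sub>R D v - (2 * (h \<bullet> v)) *\<^sub>R rot_num 1 (- h) x = - 2 *\<^sub>R cross3 (v - cross3 h v) (rot_num 1 (- h) x)" for v
    unfolding N_def D_def by (rule vec3_eqI; simp only: rot_num_def vec3_simps one_power2 mult_1 mult_1_right; algebra)
  have "((\<lambda>h. (1 / N h) *\<^sub>R rot_num 1 (- h) x) has_derivative
      (\<lambda>v. (1 / N h) *\<^sub>R D v - (1 * (2 * (h \<bullet> v)) / (N h)\<^sup>2) *\<^sub>R rot_num 1 (- h) x)) (at h)"
    by (rule has_derivative_quotient[OF dN dn N0])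
  moreover have "(1 / N h) *\<^sub>R D v - (1 * (2 * (h \<bullet> v)) / (N h)\<^sup>2) *\<^sub>R rot_num 1 (- h) x
      = - 2 *\<^sub>R cross3 (cay_form 1 h v) (rot (- h) x)" for v
  proof -
    have "(1 / N h) *\<^sub>R D v - (1 * (2 * (h \<bullet> v)) / (N h)\<^sup>2) *\<^sub>R rot_num 1 (- h) x
        = (1 / (N h)\<^sup>2) *\<^sub>R (N h *\<^sub>R D v - (2 * (h \<bullet> v)) *\<^sub>R rot_num 1 (- h) x)"
      using N0 by (simp add: scaleR_diff_right power2_eq_square)
    then show ?thesis
      unfolding key by (simp add: rot_def cay_form_def N_def cross_mult_left cross_mult_right power2_eq_square)
  qed
  ultimately show ?thesis by (simp add: rot_def N_def)
qed

section \<open>The quadratic relations between the parameters\<close>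

text \<open>The entries of \<open>\<Sum>\<^sub>c\<^sub>d S\<^sub>a\<^sub>c\<^sub>d S\<^sub>b\<^sub>c\<^sub>d = 2 k \<delta>\<^sub>a\<^sub>b\<close> in terms of \<open>u\<^sub>1, \<dots>, u\<^sub>7\<close>.\<close>

definition gram_relations :: "real \<Rightarrow> real \<Rightarrow> real \<Rightarrow> real \<Rightarrow> real \<Rightarrow> real \<Rightarrow> real \<Rightarrow> real \<Rightarrow> bool" where
  "gram_relations k x1 x2 x3 x4 x5 x6 x7 \<longleftrightarrow>
    (x1+x3)\<^sup>2 + 2*(x4+x6)\<^sup>2 + 2*(x5+x7)\<^sup>2 + x1\<^sup>2 + 2*x2\<^sup>2 + x3\<^sup>2 = 2*k \<and>
    (x4+x6)\<^sup>2 + x4\<^sup>2 + x6\<^sup>2 + 2*x1\<^sup>2 + 2*x2\<^sup>2 + 2*x5\<^sup>2 = 2*k \<and>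
    (x5+x7)\<^sup>2 + x5\<^sup>2 + x7\<^sup>2 + 2*x2\<^sup>2 + 2*x3\<^sup>2 + 2*x6\<^sup>2 = 2*k \<and>
    (x1+x3)*(x4+x6) + x1*x4 + x3*x6 - 2*(x4+x6)*x1 + 2*(x5+x7)*x2 - 2*x2*x5 = 0 \<and>
    (x1+x3)*(x5+x7) + x1*x5 + x3*x7 + 2*(x4+x6)*x2 - 2*(x5+x7)*x3 - 2*x2*x6 = 0 \<and>
    (x4+x6)*(x5+x7) + x4*x5 + x6*x7 - 2*x1*x2 - 2*x2*x3 + 2*x5*x6 = 0"

definition gram_constant :: "real \<Rightarrow> real \<Rightarrow> real \<Rightarrow> real \<Rightarrow> real \<Rightarrow> real \<Rightarrow> real \<Rightarrow> real" where
  "gram_constant x1 x2 x3 x4 x5 x6 x7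
    = 2 * x1\<^sup>2 + x2\<^sup>2 + x1 * x3 + 2 * x4\<^sup>2 + x5\<^sup>2 + 3 * x4 * x6 + x6\<^sup>2 + x5 * x7"


text \<open>The square of x2 cancels in the three diagonal equations, where x5 and x6 suffice. The
  off-diagonal ones are linear in x2 and have to be multiplied by x4, x7 or both before the
  relations can be inserted.\<close>

lemma gram_polynomials_case1:
  fixes x1 x2 x3 x4 x5 x6 x7 :: real
  assumes nz: "x4 \<noteq> 0" "x7 \<noteq> 0"
    and x2: "6*x4*x7*x2 = (x1 - 2*x3) * x7\<^sup>2 - (2*x1 - x3) * ((x1 - 2*x3) * (x1 + x3) + x4\<^sup>2)"
    and x5: "3*x7*x5 = (x1 - 2*x3) * (x1 + x3) + x4\<^sup>2 - 2*x7\<^sup>2"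
    and x6: "3*x4*x6 = - (2*x1 - x3) * (x1 + x3) - 2*x4\<^sup>2 + x7\<^sup>2"
  shows "gram_relations (gram_constant x1 x2 x3 x4 x5 x6 x7) x1 x2 x3 x4 x5 x6 x7"
  unfolding gram_relations_def gram_constant_def
proof (intro conjI)
  show "(x1+x3)\<^sup>2 + 2*(x4+x6)\<^sup>2 + 2*(x5+x7)\<^sup>2 + x1\<^sup>2 + 2*x2\<^sup>2 + x3\<^sup>2 = 2 * (2 * x1\<^sup>2 + x2\<^sup>2 + x1 * x3 + 2 * x4\<^sup>2 + x5\<^sup>2 + 3 * x4 * x6 + x6\<^sup>2 + x5 * x7)"
    using x5 x6 by algebra
  show "(x4+x6)\<^sup>2 + x4\<^sup>2 + x6\<^sup>2 + 2*x1\<^sup>2 + 2*x2\<^sup>2 + 2*x5\<^sup>2 = 2 * (2 * x1\<^sup>2 + x2\<^sup>2 + x1 * x3 + 2 * x4\<^sup>2 + x5\<^sup>2 + 3 * x4 * x6 + x6\<^sup>2 + x5 * x7)"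
    using x5 x6 by algebra
  show "(x5+x7)\<^sup>2 + x5\<^sup>2 + x7\<^sup>2 + 2*x2\<^sup>2 + 2*x3\<^sup>2 + 2*x6\<^sup>2 = 2 * (2 * x1\<^sup>2 + x2\<^sup>2 + x1 * x3 + 2 * x4\<^sup>2 + x5\<^sup>2 + 3 * x4 * x6 + x6\<^sup>2 + x5 * x7)"
    using x5 x6 by algebra
  have "x4 * ((x1+x3)*(x4+x6) + x1*x4 + x3*x6 - 2*(x4+x6)*x1 + 2*(x5+x7)*x2 - 2*x2*x5) = 0"
    using x5 x6 x2 by algebra
  then show "(x1+x3)*(x4+x6) + x1*x4 + x3*x6 - 2*(x4+x6)*x1 + 2*(x5+x7)*x2 - 2*x2*x5 = 0"
    using nz by simp
  have "x7 * ((x1+x3)*(x5+x7) + x1*x5 + x3*x7 + 2*(x4+x6)*x2 - 2*(x5+x7)*x3 - 2*x2*x6) = 0"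
    using x5 x6 x2 by algebra
  then show "(x1+x3)*(x5+x7) + x1*x5 + x3*x7 + 2*(x4+x6)*x2 - 2*(x5+x7)*x3 - 2*x2*x6 = 0"
    using nz by simp
  have "(x4 * x7) * ((x4+x6)*(x5+x7) + x4*x5 + x6*x7 - 2*x1*x2 - 2*x2*x3 + 2*x5*x6) = 0"
    using x5 x6 x2 by algebra
  then show "(x4+x6)*(x5+x7) + x4*x5 + x6*x7 - 2*x1*x2 - 2*x2*x3 + 2*x5*x6 = 0"
    using nz by simp
qed

text \<open>\<open>r\<close> is the square root together with its sign, so the upper and the lower
  signs are one case.\<close>

lemma gram_polynomials_case2:
  fixes x1 x2 x3 x4 x5 x6 x7 r :: real
  assumes nz: "x4 \<noteq> 0" and r: "r\<^sup>2 = 9*x3\<^sup>2 - 4*x4\<^sup>2" and x7: "x7 = 0" and x1: "2*x1 = x3 + r"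
    and x2: "2*x4*x2 = - (x5*r)" and x6: "2*x4*x6 = - (x3*(3*x3 + r))"
  shows "gram_relations (gram_constant x1 x2 x3 x4 x5 x6 x7) x1 x2 x3 x4 x5 x6 x7"
  unfolding gram_relations_def gram_constant_def
proof (intro conjI)
  show "(x1+x3)\<^sup>2 + 2*(x4+x6)\<^sup>2 + 2*(x5+x7)\<^sup>2 + x1\<^sup>2 + 2*x2\<^sup>2 + x3\<^sup>2 = 2 * (2 * x1\<^sup>2 + x2\<^sup>2 + x1 * x3 + 2 * x4\<^sup>2 + x5\<^sup>2 + 3 * x4 * x6 + x6\<^sup>2 + x5 * x7)"
    using x7 x1 x6 r by algebra
  show "(x4+x6)\<^sup>2 + x4\<^sup>2 + x6\<^sup>2 + 2*x1\<^sup>2 + 2*x2\<^sup>2 + 2*x5\<^sup>2 = 2 * (2 * x1\<^sup>2 + x2\<^sup>2 + x1 * x3 + 2 * x4\<^sup>2 + x5\<^sup>2 + 3 * x4 * x6 + x6\<^sup>2 + x5 * x7)"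
    using x7 x1 x6 r by algebra
  show "(x5+x7)\<^sup>2 + x5\<^sup>2 + x7\<^sup>2 + 2*x2\<^sup>2 + 2*x3\<^sup>2 + 2*x6\<^sup>2 = 2 * (2 * x1\<^sup>2 + x2\<^sup>2 + x1 * x3 + 2 * x4\<^sup>2 + x5\<^sup>2 + 3 * x4 * x6 + x6\<^sup>2 + x5 * x7)"
    using x7 x1 x6 r by algebra
  have "x4 * ((x1+x3)*(x4+x6) + x1*x4 + x3*x6 - 2*(x4+x6)*x1 + 2*(x5+x7)*x2 - 2*x2*x5) = 0"
    using x7 x1 x6 r x2 by algebra
  then show "(x1+x3)*(x4+x6) + x1*x4 + x3*x6 - 2*(x4+x6)*x1 + 2*(x5+x7)*x2 - 2*x2*x5 = 0"
    using nz by simp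
  show "(x1+x3)*(x5+x7) + x1*x5 + x3*x7 + 2*(x4+x6)*x2 - 2*(x5+x7)*x3 - 2*x2*x6 = 0"
    using x7 x1 x6 r x2 by algebra
  have "x4 * ((x4+x6)*(x5+x7) + x4*x5 + x6*x7 - 2*x1*x2 - 2*x2*x3 + 2*x5*x6) = 0"
    using x7 x1 x6 r x2 by algebra
  then show "(x4+x6)*(x5+x7) + x4*x5 + x6*x7 - 2*x1*x2 - 2*x2*x3 + 2*x5*x6 = 0"
    using nz by simp
qed

lemma gram_polynomials_case3:
  fixes x1 x2 x3 x4 x5 x6 x7 r :: real
  assumes nz: "x7 \<noteq> 0" and r: "r\<^sup>2 = 9*x3\<^sup>2 + 8*x7\<^sup>2" and x4: "x4 = 0" and x1: "4*x1 = - x3 - r"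
    and x2: "8*x7*x2 = - (x6*(9*x3 + r))" and x5: "8*x7*x5 = - 4*x7\<^sup>2 + x3*(- 3*x3 + r)"
  shows "gram_relations (gram_constant x1 x2 x3 x4 x5 x6 x7) x1 x2 x3 x4 x5 x6 x7"
  unfolding gram_relations_def gram_constant_def
proof (intro conjI)
  show "(x1+x3)\<^sup>2 + 2*(x4+x6)\<^sup>2 + 2*(x5+x7)\<^sup>2 + x1\<^sup>2 + 2*x2\<^sup>2 + x3\<^sup>2 = 2 * (2 * x1\<^sup>2 + x2\<^sup>2 + x1 * x3 + 2 * x4\<^sup>2 + x5\<^sup>2 + 3 * x4 * x6 + x6\<^sup>2 + x5 * x7)"
    using x4 x1 x5 r by algebra
  show "(x4+x6)\<^sup>2 + x4\<^sup>2 + x6\<^sup>2 + 2*x1\<^sup>2 + 2*x2\<^sup>2 + 2*x5\<^sup>2 = 2 * (2 * x1\<^sup>2 + x2\<^sup>2 + x1 * x3 + 2 * x4\<^sup>2 + x5\<^sup>2 + 3 * x4 * x6 + x6\<^sup>2 + x5 * x7)"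
    using x4 x1 x5 r by algebra
  show "(x5+x7)\<^sup>2 + x5\<^sup>2 + x7\<^sup>2 + 2*x2\<^sup>2 + 2*x3\<^sup>2 + 2*x6\<^sup>2 = 2 * (2 * x1\<^sup>2 + x2\<^sup>2 + x1 * x3 + 2 * x4\<^sup>2 + x5\<^sup>2 + 3 * x4 * x6 + x6\<^sup>2 + x5 * x7)"
    using x4 x1 x5 r by algebra
  show "(x1+x3)*(x4+x6) + x1*x4 + x3*x6 - 2*(x4+x6)*x1 + 2*(x5+x7)*x2 - 2*x2*x5 = 0"
    using x4 x1 x5 r x2 by algebra
  have "x7 * ((x1+x3)*(x5+x7) + x1*x5 + x3*x7 + 2*(x4+x6)*x2 - 2*(x5+x7)*x3 - 2*x2*x6) = 0"
    using x4 x1 x5 r x2 by algebra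
  then show "(x1+x3)*(x5+x7) + x1*x5 + x3*x7 + 2*(x4+x6)*x2 - 2*(x5+x7)*x3 - 2*x2*x6 = 0"
    using nz by simp
  have "x7 * ((x4+x6)*(x5+x7) + x4*x5 + x6*x7 - 2*x1*x2 - 2*x2*x3 + 2*x5*x6) = 0"
    using x4 x1 x5 r x2 by algebra
  then show "(x4+x6)*(x5+x7) + x4*x5 + x6*x7 - 2*x1*x2 - 2*x2*x3 + 2*x5*x6 = 0"
    using nz by simp
qed

lemma S_tensor_all:
  "S_tensor u 1 2 1 = - (u$4 + u$6)" "S_tensor u 2 1 1 = - (u$4 + u$6)"
  "S_tensor u 1 3 1 = - (u$5 + u$7)" "S_tensor u 3 1 1 = - (u$5 + u$7)"
  "S_tensor u 2 1 2 = u$1" "S_tensor u 2 2 1 = u$1" "S_tensor u 3 1 3 = u$3" "S_tensor u 3 3 1 = u$3"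
  "S_tensor u 2 3 2 = u$5" "S_tensor u 3 2 2 = u$5" "S_tensor u 3 2 3 = u$6" "S_tensor u 3 3 2 = u$6"
  "S_tensor u 1 3 2 = - u$2" "S_tensor u 2 1 3 = - u$2" "S_tensor u 2 3 1 = - u$2"
  "S_tensor u 3 1 2 = - u$2" "S_tensor u 3 2 1 = - u$2"
  using S_tensor_commute[of u] S_tensor_values[of u] by metis+

definition cubic_gram :: "(3 \<Rightarrow> 3 \<Rightarrow> 3 \<Rightarrow> real) \<Rightarrow> 3 \<Rightarrow> 3 \<Rightarrow> real" where
  "cubic_gram S a b = (\<Sum>c\<in>UNIV. \<Sum>d\<in>UNIV. S a c d * S b c d)"

lemma relations_gram:
  assumes "relations u"
    and k: "k7 = 2 * (u$1)\<^sup>2 + (u$2)\<^sup>2 + u$1 * u$3 + 2 * (u$4)\<^sup>2 + (u$5)\<^sup>2 + 3 * u$4 * u$6 + (u$6)\<^sup>2 + u$5 * u$7"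
  shows "cubic_gram (S_tensor u) a b = (if a = b then 2 * k7 else 0)"
proof -
  define x1 x2 x3 x4 x5 x6 x7 where x: "x1 = u$1" "x2 = u$2" "x3 = u$3" "x4 = u$4" "x5 = u$5" "x6 = u$6" "x7 = u$7"
  have k': "k7 = gram_constant x1 x2 x3 x4 x5 x6 x7"
    using k by (simp add: gram_constant_def x)
  note R = assms(1)[unfolded relations_def Let_def, folded x]
  have "gram_relations k7 x1 x2 x3 x4 x5 x6 x7" (is ?P)
    using R
  proof (elim disjE)
    assume *: "x4 \<noteq> 0 \<and> x7 \<noteq> 0 \<and>
      x2 = ((x1 - 2*x3) * x7\<^sup>2 - (2*x1 - x3) * ((x1 - 2*x3) * (x1 + x3) + x4\<^sup>2)) / (6*x4*x7) \<and>
      x5 = ((x1 - 2*x3) * (x1 + x3) + x4\<^sup>2 - 2*x7\<^sup>2) / (3*x7) \<and>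
      x6 = (- (2*x1 - x3) * (x1 + x3) - 2*x4\<^sup>2 + x7\<^sup>2) / (3*x4)"
    then have nz: "x4 \<noteq> 0" "x7 \<noteq> 0" by auto
    have e2: "6*x4*x7*x2 = (x1 - 2*x3) * x7\<^sup>2 - (2*x1 - x3) * ((x1 - 2*x3) * (x1 + x3) + x4\<^sup>2)"
      using * nz by (metis (no_types, opaque_lifting) mult_eq_0_iff nonzero_mult_div_cancel_left times_divide_eq_right zero_neq_numeral)
    have e5: "3*x7*x5 = (x1 - 2*x3) * (x1 + x3) + x4\<^sup>2 - 2*x7\<^sup>2"
      using * nz by (metis (no_types, opaque_lifting) mult_eq_0_iff nonzero_mult_div_cancel_left times_divide_eq_right zero_neq_numeral)
    have e6: "3*x4*x6 = - (2*x1 - x3) * (x1 + x3) - 2*x4\<^sup>2 + x7\<^sup>2"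
      using * nz by (metis (no_types, opaque_lifting) mult_eq_0_iff nonzero_mult_div_cancel_left times_divide_eq_right zero_neq_numeral)
    show ?P unfolding k' by (rule gram_polynomials_case1[OF nz e2 e5 e6])
  next
    assume "x4 \<noteq> 0 \<and> 9*x3\<^sup>2 - 4*x4\<^sup>2 \<ge> 0 \<and> x7 = 0 \<and>
      (\<exists>\<epsilon>\<in>{1, -1}. x1 = (x3 + \<epsilon> * sqrt (9*x3\<^sup>2 - 4*x4\<^sup>2)) / 2 \<and>
          x2 = - \<epsilon> * (x5 * sqrt (9*x3\<^sup>2 - 4*x4\<^sup>2) / (2*x4)) \<and>
          x6 = - \<epsilon> * (x3 * (\<epsilon> * 3 * x3 + sqrt (9*x3\<^sup>2 - 4*x4\<^sup>2)) / (2*x4)))"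
    then obtain \<epsilon> where *: "x4 \<noteq> 0" "9*x3\<^sup>2 - 4*x4\<^sup>2 \<ge> 0" "x7 = 0" "\<epsilon> \<in> {1, - 1}"
      "x1 = (x3 + \<epsilon> * sqrt (9*x3\<^sup>2 - 4*x4\<^sup>2)) / 2"
      "x2 = - \<epsilon> * (x5 * sqrt (9*x3\<^sup>2 - 4*x4\<^sup>2) / (2*x4))"
      "x6 = - \<epsilon> * (x3 * (\<epsilon> * 3 * x3 + sqrt (9*x3\<^sup>2 - 4*x4\<^sup>2)) / (2*x4))" by blast
    have e: "\<epsilon> * \<epsilon> = 1" using *(4) by auto
    define r where "r = \<epsilon> * sqrt (9*x3\<^sup>2 - 4*x4\<^sup>2)"
    have r: "r\<^sup>2 = 9*x3\<^sup>2 - 4*x4\<^sup>2"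
      using *(2) e by (simp add: r_def power_mult_distrib) (simp add: power2_eq_square)
    have e2: "2*x4*x2 = - (x5*r)" using *(1,6) by (simp add: r_def)
    have "2*x4*x6 = - (x3*((\<epsilon> * \<epsilon>) * 3*x3 + r))" using *(1,7) by (simp add: r_def field_simps)
    then have e6: "2*x4*x6 = - (x3*(3*x3 + r))" by (simp add: e)
    have e1: "2*x1 = x3 + r" using *(5) by (simp add: r_def)
    show ?P unfolding k' by (rule gram_polynomials_case2[OF *(1) r *(3) e1 e2 e6])
  next
    assume "x7 \<noteq> 0 \<and> x4 = 0 \<and>
      (\<exists>\<epsilon>\<in>{1, -1}. x1 = (- x3 - \<epsilon> * sqrt (9*x3\<^sup>2 + 8*x7\<^sup>2)) / 4 \<and>
          x2 = - \<epsilon> * (x6 * (\<epsilon> * 9 * x3 + sqrt (9*x3\<^sup>2 + 8*x7\<^sup>2)) / (8*x7)) \<and>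
          x5 = (- 4*x7\<^sup>2 + \<epsilon> * x3 * (- \<epsilon> * 3 * x3 + sqrt (9*x3\<^sup>2 + 8*x7\<^sup>2))) / (8*x7))"
    then obtain \<epsilon> where *: "x7 \<noteq> 0" "x4 = 0" "\<epsilon> \<in> {1, - 1}"
      "x1 = (- x3 - \<epsilon> * sqrt (9*x3\<^sup>2 + 8*x7\<^sup>2)) / 4"
      "x2 = - \<epsilon> * (x6 * (\<epsilon> * 9 * x3 + sqrt (9*x3\<^sup>2 + 8*x7\<^sup>2)) / (8*x7))"
      "x5 = (- 4*x7\<^sup>2 + \<epsilon> * x3 * (- \<epsilon> * 3 * x3 + sqrt (9*x3\<^sup>2 + 8*x7\<^sup>2))) / (8*x7)" by blast
    have e: "\<epsilon> * \<epsilon> = 1" using *(3) by auto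
    define r where "r = \<epsilon> * sqrt (9*x3\<^sup>2 + 8*x7\<^sup>2)"
    have r: "r\<^sup>2 = 9*x3\<^sup>2 + 8*x7\<^sup>2"
      using e by (simp add: r_def power_mult_distrib) (simp add: power2_eq_square)
    have "8*x7*x2 = - (x6*((\<epsilon> * \<epsilon>)*9*x3 + r))" using *(1,5) by (simp add: r_def field_simps)
    then have e2: "8*x7*x2 = - (x6*(9*x3 + r))" by (simp add: e)
    have "8*x7*x5 = - 4*x7\<^sup>2 + x3*(- (\<epsilon> * \<epsilon>)*3*x3 + r)" using *(1,6) by (simp add: r_def field_simps)
    then have e5: "8*x7*x5 = - 4*x7\<^sup>2 + x3*(- 3*x3 + r)" by (simp add: e)
    have e1: "4*x1 = - x3 - r" using *(4) by (simp add: r_def)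
    show ?P unfolding k' by (rule gram_polynomials_case3[OF *(1) r *(2) e1 e2 e5])
  next
    assume "x1 = 0 \<and> x3 = 0 \<and> x4 = 0 \<and> x5 = 0 \<and> x7 = 0"
    then show ?P unfolding k' gram_relations_def gram_constant_def by simp
  next
    assume "x1 = - x3 \<and> x4 = 0 \<and> x5 = 0 \<and> x6 = 0 \<and> x7 = 0"
    then show ?P unfolding k' gram_relations_def gram_constant_def by (simp add: power2_eq_square)
  next
    assume "x1 = 0 \<and> x3 = 0 \<and> x4 = 0 \<and> x6 = 0 \<and> x7 = 0"
    then show ?P unfolding k' gram_relations_def gram_constant_def by simp
  qed
  then show ?thesis
    unfolding gram_relations_def using exhaust_3[of a] exhaust_3[of b]
    by (elim conjE disjE; simp add: cubic_gram_def sum_3 S_tensor_values S_tensor_all flip: x;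
        simp add: power2_eq_square algebra_simps)
qed

section \<open>Rotating a cubic form\<close>

text \<open>Acting on one index at a time keeps the sums small: composition, commutation and
  contraction with an orthogonal matrix are checked for each index and then combined.\<close>

definition slot1 :: "real^3^3 \<Rightarrow> (3 \<Rightarrow> 3 \<Rightarrow> 3 \<Rightarrow> real) \<Rightarrow> 3 \<Rightarrow> 3 \<Rightarrow> 3 \<Rightarrow> real" where
  "slot1 Q S a b c = (\<Sum>i\<in>UNIV. Q$a$i * S i b c)"

definition slot2 :: "real^3^3 \<Rightarrow> (3 \<Rightarrow> 3 \<Rightarrow> 3 \<Rightarrow> real) \<Rightarrow> 3 \<Rightarrow> 3 \<Rightarrow> 3 \<Rightarrow> real" where
  "slot2 Q S a b c = (\<Sum>i\<in>UNIV. Q$b$i * S a i c)"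

definition slot3 :: "real^3^3 \<Rightarrow> (3 \<Rightarrow> 3 \<Rightarrow> 3 \<Rightarrow> real) \<Rightarrow> 3 \<Rightarrow> 3 \<Rightarrow> 3 \<Rightarrow> real" where
  "slot3 Q S a b c = (\<Sum>i\<in>UNIV. Q$c$i * S a b i)"

definition act_cubic :: "real^3^3 \<Rightarrow> (3 \<Rightarrow> 3 \<Rightarrow> 3 \<Rightarrow> real) \<Rightarrow> 3 \<Rightarrow> 3 \<Rightarrow> 3 \<Rightarrow> real" where
  "act_cubic Q S = slot1 Q (slot2 Q (slot3 Q S))"

lemma tact_sum: "act_cubic Q S a b c = (\<Sum>i\<in>UNIV. \<Sum>j\<in>UNIV. \<Sum>l\<in>UNIV. Q$a$i * Q$b$j * Q$c$l * S i j l)"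
  by (simp add: act_cubic_def slot1_def slot2_def slot3_def sum_distrib_left mult.assoc)

lemma slot_mult:
  "slot1 (P ** Q) S = slot1 P (slot1 Q S)" "slot2 (P ** Q) S = slot2 P (slot2 Q S)"
  "slot3 (P ** Q) S = slot3 P (slot3 Q S)"
  by (intro ext; simp add: slot1_def slot2_def slot3_def matrix_matrix_mult_def sum_3 algebra_simps)+

lemma slot_commute:
  "slot2 P (slot1 Q S) = slot1 Q (slot2 P S)" "slot3 P (slot1 Q S) = slot1 Q (slot3 P S)"
  "slot3 P (slot2 Q S) = slot2 Q (slot3 P S)"
  by (intro ext; simp add: slot1_def slot2_def slot3_def sum_3 algebra_simps)+

lemma tact_mult: "act_cubic (P ** Q) S = act_cubic P (act_cubic Q S)"
  by (simp add: act_cubic_def slot_mult slot_commute)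

lemma tact_one: "act_cubic (mat 1) S = S"
  by (intro ext) (simp add: act_cubic_def slot1_def slot2_def slot3_def mat_def if_distrib[of "\<lambda>x. x * _"] cong: if_cong)

definition symmetric_cubic :: "(3 \<Rightarrow> 3 \<Rightarrow> 3 \<Rightarrow> real) \<Rightarrow> bool" where
  "symmetric_cubic S \<longleftrightarrow> (\<forall>a b c. S a b c = S b a c \<and> S a b c = S a c b)"

definition traceless :: "(3 \<Rightarrow> 3 \<Rightarrow> 3 \<Rightarrow> real) \<Rightarrow> bool" where
  "traceless S \<longleftrightarrow> (\<forall>c. S 1 1 c + S 2 2 c + S 3 3 c = 0)"

lemma symmetric_cubic_sort:
  assumes "symmetric_cubic S"
  shows "S 1 2 1 = S 1 1 2" "S 2 1 1 = S 1 1 2" "S 1 3 1 = S 1 1 3" "S 3 1 1 = S 1 1 3"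
    "S 2 1 2 = S 1 2 2" "S 2 2 1 = S 1 2 2" "S 3 1 3 = S 1 3 3" "S 3 3 1 = S 1 3 3"
    "S 2 3 2 = S 2 2 3" "S 3 2 2 = S 2 2 3" "S 3 2 3 = S 2 3 3" "S 3 3 2 = S 2 3 3"
    "S 1 3 2 = S 1 2 3" "S 2 1 3 = S 1 2 3" "S 2 3 1 = S 1 2 3" "S 3 1 2 = S 1 2 3" "S 3 2 1 = S 1 2 3"
  using assms unfolding symmetric_cubic_def by metis+

lemma symmetric_cubic_tact:
  assumes "symmetric_cubic S" shows "symmetric_cubic (act_cubic Q S)"
  unfolding symmetric_cubic_def tact_sum
proof (intro allI conjI)
  fix a b c
  have s: "S i j l = S j i l" "S i j l = S i l j" for i j l
    using assms by (auto simp: symmetric_cubic_def)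
  show "(\<Sum>i\<in>UNIV. \<Sum>j\<in>UNIV. \<Sum>l\<in>UNIV. Q$a$i * Q$b$j * Q$c$l * S i j l)
      = (\<Sum>i\<in>UNIV. \<Sum>j\<in>UNIV. \<Sum>l\<in>UNIV. Q$b$i * Q$a$j * Q$c$l * S i j l)"
    by (subst sum.swap, intro sum.cong refl) (simp add: s(1)[symmetric] mult_ac; metis s(1))
  show "(\<Sum>i\<in>UNIV. \<Sum>j\<in>UNIV. \<Sum>l\<in>UNIV. Q$a$i * Q$b$j * Q$c$l * S i j l)
      = (\<Sum>i\<in>UNIV. \<Sum>j\<in>UNIV. \<Sum>l\<in>UNIV. Q$a$i * Q$c$j * Q$b$l * S i j l)"
    by (rule sum.cong[OF refl], subst sum.swap, intro sum.cong refl) (simp add: mult_ac; metis s(2))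
qed

lemma orthogonal_columns:
  assumes "orthogonal_matrix (Q :: real^3^3)"
  shows "(\<Sum>a\<in>UNIV. Q$a$i * Q$a$j) = (if i = j then 1 else 0)"
proof -
  have "(transpose Q ** Q) $ i $ j = (mat 1 :: real^3^3) $ i $ j"
    using assms by (simp add: orthogonal_matrix_def)
  then show ?thesis by (simp add: matrix_matrix_mult_def transpose_def mat_def)
qed

lemma orthogonal_columns_sum:
  assumes "orthogonal_matrix (Q :: real^3^3)"
  shows "(\<Sum>a\<in>UNIV. (\<Sum>i\<in>UNIV. Q$a$i * x i) * (\<Sum>j\<in>UNIV. Q$a$j * y j)) = (\<Sum>i\<in>UNIV. x i * y i)"
proof -
  have "(\<Sum>a\<in>UNIV. (\<Sum>i\<in>UNIV. Q$a$i * x i) * (\<Sum>j\<in>UNIV. Q$a$j * y j))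
      = (\<Sum>i\<in>UNIV. \<Sum>j\<in>UNIV. (x i * y j) * (\<Sum>a\<in>UNIV. Q$a$i * Q$a$j))"
    by (simp add: sum_3 algebra_simps)
  then show ?thesis by (simp add: orthogonal_columns[OF assms] if_distrib cong: if_cong)
qed

lemma traceless_tact:
  assumes "orthogonal_matrix Q" "traceless S" shows "traceless (act_cubic Q S)"
proof -
  have "(\<Sum>a\<in>UNIV. act_cubic Q S a a c) = 0" for c
  proof -
    let ?M = "\<lambda>i j. \<Sum>l\<in>UNIV. Q$c$l * S i j l"
    have "(\<Sum>a\<in>UNIV. act_cubic Q S a a c) = (\<Sum>i\<in>UNIV. \<Sum>j\<in>UNIV. ?M i j * (\<Sum>a\<in>UNIV. Q$a$i * Q$a$j))"
      by (simp add: tact_sum sum_3 algebra_simps)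
    also have "\<dots> = (\<Sum>i\<in>UNIV. ?M i i)"
      by (simp add: orthogonal_columns[OF assms(1)] if_distrib cong: if_cong)
    also have "\<dots> = (\<Sum>l\<in>UNIV. Q$c$l * (S 1 1 l + S 2 2 l + S 3 3 l))"
      by (simp add: sum_3 algebra_simps)
    also have "\<dots> = 0" using assms(2) by (simp add: traceless_def)
    finally show ?thesis .
  qed
  then show ?thesis by (simp add: traceless_def sum_3)
qed

text \<open>Indices 2 and 3 are contracted between the two copies of S, where the orthogonal matrix
  drops out; only the free index is rotated.\<close>

lemma cubic_gram_tact:
  assumes "orthogonal_matrix Q"
  shows "cubic_gram (act_cubic Q S) a b = (\<Sum>i\<in>UNIV. \<Sum>j\<in>UNIV. Q$a$i * Q$b$j * cubic_gram S i j)"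
proof -
  have g2: "cubic_gram (slot2 Q R) a b = cubic_gram R a b" for R a b
    unfolding cubic_gram_def slot2_def
    by (subst (1 2) sum.swap) (simp add: orthogonal_columns_sum[OF assms])
  have g3: "cubic_gram (slot3 Q R) a b = cubic_gram R a b" for R a b
    unfolding cubic_gram_def slot3_def by (simp add: orthogonal_columns_sum[OF assms])
  have "act_cubic Q S = slot2 Q (slot3 Q (slot1 Q S))"
    by (simp add: act_cubic_def slot_commute)
  then have "cubic_gram (act_cubic Q S) a b = cubic_gram (slot1 Q S) a b"
    by (simp add: g2 g3)
  also have "\<dots> = (\<Sum>i\<in>UNIV. \<Sum>j\<in>UNIV. Q$a$i * Q$b$j * cubic_gram S i j)"
    unfolding cubic_gram_def slot1_def by (simp add: sum_3 algebra_simps)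
  finally show ?thesis .
qed

lemma cubic_gram_scalar_tact:
  assumes "orthogonal_matrix Q" "\<And>a b. cubic_gram S a b = (if a = b then \<kappa> else 0)"
  shows "cubic_gram (act_cubic Q S) a b = (if a = b then \<kappa> else 0)"
proof -
  have "orthogonal_matrix (transpose Q)" using assms(1) by simp
  from orthogonal_columns[OF this, of a b]
  have "(\<Sum>i\<in>UNIV. Q$a$i * Q$b$i) = (if a = b then 1 else 0)" by (simp add: transpose_def)
  then show ?thesis
    by (simp add: cubic_gram_tact[OF assms(1)] assms(2) if_distrib sum_distrib_right[symmetric] cong: if_cong)
qed

section \<open>Critical frames and the standard form\<close>

definition trilin :: "(3 \<Rightarrow> 3 \<Rightarrow> 3 \<Rightarrow> real) \<Rightarrow> real^3 \<Rightarrow> real^3 \<Rightarrow> real^3 \<Rightarrow> real" where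
  "trilin S x y z = (\<Sum>a\<in>UNIV. \<Sum>b\<in>UNIV. \<Sum>c\<in>UNIV. x$a * y$b * z$c * S a b c)"

lemma trilin_simps:
  "trilin S (x + x') y z = trilin S x y z + trilin S x' y z"
  "trilin S x (y + y') z = trilin S x y z + trilin S x y' z"
  "trilin S x y (z + z') = trilin S x y z + trilin S x y z'"
  "trilin S (x - x') y z = trilin S x y z - trilin S x' y z"
  "trilin S x (y - y') z = trilin S x y z - trilin S x y' z"
  "trilin S x y (z - z') = trilin S x y z - trilin S x y z'"
  "trilin S (r *\<^sub>R x) y z = r * trilin S x y z"
  "trilin S x (r *\<^sub>R y) z = r * trilin S x y z"
  "trilin S x y (r *\<^sub>R z) = r * trilin S x y z"
  by (simp_all add: trilin_def sum.distrib sum_subtractf sum_distrib_left algebra_simps)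

lemma tact_trilin: "act_cubic R S i j l = trilin S (R$i) (R$j) (R$l)"
  by (simp add: tact_sum trilin_def)

text \<open>As a function of the angle, the left side has value A at 0, hence a maximum there, and
  its derivative at 0 is B.\<close>

lemma critical_angle:
  assumes "\<And>c s :: real. c\<^sup>2 + s\<^sup>2 = 1 \<Longrightarrow> (c\<^sup>2 - s\<^sup>2) * A + c * s * B \<le> A"
  shows "B = 0"
proof -
  let ?f = "\<lambda>t. ((cos t)\<^sup>2 - (sin t)\<^sup>2) * A + cos t * sin t * B"
  have "DERIV ?f 0 :> B"
    by (auto intro!: derivative_eq_intros)
  moreover have "\<forall>y. \<bar>0 - y\<bar> < 1 \<longrightarrow> ?f y \<le> ?f 0"
    using assms by simp
  ultimately show "B = 0" using DERIV_local_max[of ?f B 0 1] by simp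
qed

definition std_cubic :: "real \<Rightarrow> 3 \<Rightarrow> 3 \<Rightarrow> 3 \<Rightarrow> real" where
  "std_cubic t i j l = (if i \<noteq> j \<and> j \<noteq> l \<and> i \<noteq> l then - t else 0)"

lemma trilin_cyclic: "symmetric_cubic S \<Longrightarrow> trilin S x y z = trilin S y z x"
  unfolding trilin_def by (simp add: sum_3 symmetric_cubic_sort algebra_simps)

text \<open>A frame maximising \<open>S(v, w, v \<times> w)\<close> is critical for rotations in the three coordinate planes.\<close>

lemma exists_critical_frame:
  assumes S: "symmetric_cubic S"
  obtains R where "rotation_matrix R"
    "act_cubic R S 2 2 3 = act_cubic R S 1 1 3" "act_cubic R S 3 3 1 = act_cubic R S 2 2 1" "act_cubic R S 1 1 2 = act_cubic R S 3 3 2"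
proof -
  \<comment> \<open>Orthonormal pairs form a compact set and determine the oriented frames, the
    third vector being v cross w.\<close>
  define K where "K = {p :: (real^3) \<times> (real^3). fst p \<bullet> fst p = 1 \<and> snd p \<bullet> snd p = 1 \<and> fst p \<bullet> snd p = 0}"
  define f where "f p = trilin S (fst p) (snd p) (cross3 (fst p) (snd p))" for p
  have sub: "K \<subseteq> cball 0 1 \<times> cball 0 1"
    by (auto simp: K_def norm_eq_sqrt_inner)
  have col_of: "closed K"
    unfolding K_def by (intro closed_Collect_conj closed_Collect_eq continuous_intros)
  have "compact ((cball 0 1 \<times> cball 0 1) \<inter> K)"
    by (intro compact_Int_closed compact_Times compact_cball col_of)
  then have "compact K" using sub by (simp add: inf.absorb2)
  moreover have "(axis 1 1, axis 2 1) \<in> K" by (simp add: K_def inner_axis_axis)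
  then have "K \<noteq> {}" by blast
  moreover have "continuous_on K f"
    unfolding f_def[abs_def] trilin_def by (intro continuous_intros continuous_on_cross)
  ultimately obtain p where "p \<in> K" and max: "\<forall>q\<in>K. f q \<le> f p"
    using continuous_attains_sup by blast
  define v w where "v = fst p" and "w = snd p"
  have vw: "v \<bullet> v = 1" "w \<bullet> w = 1" "v \<bullet> w = 0"
    using \<open>p \<in> K\<close> by (auto simp: K_def v_def w_def)
  define z where "z = cross3 v w"
  have max': "trilin S x y (cross3 x y) \<le> trilin S v w z" if "x \<bullet> x = 1" "y \<bullet> y = 1" "x \<bullet> y = 0" for x y
    using bspec[OF max, of "(x, y)"] that by (simp add: K_def f_def z_def v_def w_def)
  \<comment> \<open>Turning (a, b) by an angle with cosine c and sine s fixes d = a cross b and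
    changes S(a, b, d) into (c^2 - s^2) S(a, b, d) + c s (S(b, b, d) - S(a, a, d)). At a maximum the
    coefficient of c s vanishes.\<close>
  have critical: "trilin S b b d = trilin S a a d"
    if ab: "a \<bullet> a = 1" "b \<bullet> b = 1" "a \<bullet> b = 0" "cross3 a b = d" and m: "trilin S a b d = trilin S v w z" for a b d
  proof -
    have "trilin S b b d - trilin S a a d = 0"
    proof (rule critical_angle[where A="trilin S v w z"])
      fix c s :: real assume cs: "c\<^sup>2 + s\<^sup>2 = 1"
      have ba: "cross3 b a = - d" using ab(4) cross_skew[of b a] by simp
      have "cross3 (c *\<^sub>R a + s *\<^sub>R b) (c *\<^sub>R b - s *\<^sub>R a) = (c\<^sup>2 + s\<^sup>2) *\<^sub>R d"
        by (simp add: cross_add_left Cross3.right_diff_distrib cross_mult_left cross_mult_right ba ab(4))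
          (simp add: power2_eq_square algebra_simps)
      then have cr: "cross3 (c *\<^sub>R a + s *\<^sub>R b) (c *\<^sub>R b - s *\<^sub>R a) = d" using cs by simp
      have "trilin S (c *\<^sub>R a + s *\<^sub>R b) (c *\<^sub>R b - s *\<^sub>R a) (cross3 (c *\<^sub>R a + s *\<^sub>R b) (c *\<^sub>R b - s *\<^sub>R a))
          \<le> trilin S v w z"
        using ab cs
        by (intro max') (simp_all add: inner_add_left inner_add_right inner_diff_left inner_diff_right
            inner_commute[of b a] power2_eq_square)
      moreover have "trilin S b a d = trilin S a b d"
        unfolding trilin_def by (simp add: sum_3 symmetric_cubic_sort[OF S] algebra_simps)
      ultimately show "(c\<^sup>2 - s\<^sup>2) * trilin S v w z + c * s * (trilin S b b d - trilin S a a d) \<le> trilin S v w z"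
        unfolding cr by (simp add: trilin_simps m power2_eq_square algebra_simps)
    qed
    then show ?thesis by simp
  qed
  have zv: "z \<bullet> v = 0" and zw: "w \<bullet> z = 0" by (simp_all add: z_def dot_cross_self)
  have zz: "z \<bullet> z = 1"
    using norm_cross_dot[of v w] vw by (simp add: z_def norm_eq_sqrt_inner)
  have wz: "cross3 w z = v" and zv': "cross3 z v = w"
    unfolding z_def using vw
    by (simp_all add: Lagrange cross_skew[of "cross3 v w" v] inner_commute)
  define R where "R = (vector [v, w, z] :: real^3^3)"
  have R: "R$1 = v" "R$2 = w" "R$3 = z" by (simp_all add: R_def)
  show ?thesis
  proof
    have "R ** transpose R = mat 1"
      using vw zv zw zz
      by (simp add: vec_eq_iff forall_3 matrix_matrix_mult_def transpose_def mat_def R inner_vec_def sum_3 mult.commute)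
    then have "orthogonal_matrix R"
      by (simp add: orthogonal_matrix_def matrix_left_right_inverse)
    moreover have "det R = 1"
      unfolding R_def using dot_cross_det[of v w z] wz vw by simp
    ultimately show "rotation_matrix R" by (simp add: rotation_matrix_def)
    show "act_cubic R S 2 2 3 = act_cubic R S 1 1 3"
      unfolding tact_trilin R by (rule critical) (use vw in \<open>simp_all add: z_def\<close>)
    show "act_cubic R S 3 3 1 = act_cubic R S 2 2 1"
      unfolding tact_trilin R
      by (rule critical) (use vw zw zz wz trilin_cyclic[OF S, of v w z] in \<open>simp_all\<close>)
    show "act_cubic R S 1 1 2 = act_cubic R S 3 3 2"
      unfolding tact_trilin R
      by (rule critical) (use vw zv zz zv' trilin_cyclic[OF S, of z v w] in \<open>simp_all\<close>)
  qed
qed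

lemma std_cubicI:
  assumes S: "symmetric_cubic S" and g: "\<And>a b. cubic_gram S a b = (if a = b then 2 * k else 0)"
    and z: "S 1 2 2 = 0" "S 1 3 3 = 0" "S 1 1 2 = 0" "S 2 3 3 = 0" "S 1 1 3 = 0" "S 2 2 3 = 0"
      "S 1 1 1 = 0" "S 2 2 2 = 0" "S 3 3 3 = 0"
  shows "S = std_cubic (- S 1 2 3)" "(- S 1 2 3)\<^sup>2 = k"
proof -
  have "S a b c = std_cubic (- S 1 2 3) a b c" for a b c
    using exhaust_3[of a] exhaust_3[of b] exhaust_3[of c]
    by (elim disjE; simp add: std_cubic_def symmetric_cubic_sort[OF S] z)
  then show "S = std_cubic (- S 1 2 3)" by blast
  show "(- S 1 2 3)\<^sup>2 = k"
    using g[of 1 1] by (simp add: cubic_gram_def sum_3 symmetric_cubic_sort[OF S] z power2_eq_square)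
qed

text \<open>The critical frame is either one in which \<open>S\<close> is a multiple of \<open>x y z\<close>, or it is turned into such a
  frame by a half turn about one of the lines spanned by \<open>(1, \<plusminus>1, \<plusminus>1)\<close>.\<close>

lemma exists_std_frame:
  assumes S: "symmetric_cubic S" and tr: "traceless S"
    and g: "\<And>a b. cubic_gram S a b = (if a = b then 2 * k else 0)"
  obtains Q t where "rotation_matrix Q" "S = act_cubic Q (std_cubic t)" "t\<^sup>2 = k"
proof -
  note result = that
  have conclude: thesis if Q: "rotation_matrix Q" and z: "act_cubic Q S 1 2 2 = 0" "act_cubic Q S 1 3 3 = 0" "act_cubic Q S 1 1 2 = 0"
     "act_cubic Q S 2 3 3 = 0" "act_cubic Q S 1 1 3 = 0" "act_cubic Q S 2 2 3 = 0"
     "act_cubic Q S 1 1 1 = 0" "act_cubic Q S 2 2 2 = 0" "act_cubic Q S 3 3 3 = 0" for Q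
  proof -
    define t where "t = - act_cubic Q S 1 2 3"
    have o: "orthogonal_matrix Q" using Q by (simp add: rotation_matrix_def)
    note s = std_cubicI[OF symmetric_cubic_tact[OF S, of Q] cubic_gram_scalar_tact[OF o g] z, folded t_def]
    have "S = act_cubic (transpose Q) (act_cubic Q S)"
      using o by (simp add: tact_one orthogonal_matrix_def flip: tact_mult)
    then have "S = act_cubic (transpose Q) (std_cubic t)" by (simp only: s(1))
    moreover have "rotation_matrix (transpose Q)"
      using Q by (simp add: rotation_matrix_def det_transpose)
    ultimately show thesis by (intro result[of "transpose Q" t] s(2))
  qed
  obtain R where R: "rotation_matrix R" and crit: "act_cubic R S 2 2 3 = act_cubic R S 1 1 3"
    "act_cubic R S 3 3 1 = act_cubic R S 2 2 1" "act_cubic R S 1 1 2 = act_cubic R S 3 3 2"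
    using exists_critical_frame[OF S] .
  have o: "orthogonal_matrix R" using R by (simp add: rotation_matrix_def)
  define T where "T = act_cubic R S"
  have T: "symmetric_cubic T" unfolding T_def by (rule symmetric_cubic_tact[OF S])
  have trT: "traceless T" unfolding T_def by (rule traceless_tact[OF o tr])
  have gT: "cubic_gram T a b = (if a = b then 2 * k else 0)" for a b
    unfolding T_def by (rule cubic_gram_scalar_tact[OF o g])
  note sort = symmetric_cubic_sort[OF T]
  \<comment> \<open>By criticality and tracelessness these four entries determine T.\<close>
  define \<alpha> \<beta> \<gamma> \<tau> where "\<alpha> = T 1 2 2" and "\<beta> = T 1 1 2" and "\<gamma> = T 1 1 3" and "\<tau> = T 1 2 3"
  have c: "T 1 3 3 = \<alpha>" "T 2 3 3 = \<beta>" "T 2 2 3 = \<gamma>"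
    using crit by (simp_all add: \<alpha>_def \<beta>_def \<gamma>_def sort flip: T_def)
  have d: "T 1 1 1 = - 2 * \<alpha>" "T 2 2 2 = - 2 * \<beta>" "T 3 3 3 = - 2 * \<gamma>"
    using trT[unfolded traceless_def, rule_format, of 1] trT[unfolded traceless_def, rule_format, of 2]
      trT[unfolded traceless_def, rule_format, of 3]
    by (simp_all add: sort c flip: \<alpha>_def \<beta>_def \<gamma>_def)
  note val = sort c d \<alpha>_def[symmetric] \<beta>_def[symmetric] \<gamma>_def[symmetric] \<tau>_def[symmetric]
  \<comment> \<open>Equality of the diagonal Gram entries forces equal squares; vanishing of the
    off-diagonal ones then fixes \<tau> in terms of \<alpha> and two signs.\<close>
  have sq: "\<beta>\<^sup>2 = \<alpha>\<^sup>2" "\<gamma>\<^sup>2 = \<alpha>\<^sup>2"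
    using gT[of 1 1] gT[of 2 2] gT[of 3 3]
    by (simp_all add: cubic_gram_def sum_3 val power2_eq_square)
  have prods: "\<alpha> * \<beta> = 4 * \<gamma> * \<tau>" "\<alpha> * \<gamma> = 4 * \<beta> * \<tau>" "\<beta> * \<gamma> = 4 * \<alpha> * \<tau>"
    using gT[of 1 2] gT[of 1 3] gT[of 2 3]
    by (simp_all add: cubic_gram_def sum_3 val algebra_simps)
  show thesis
  proof (cases "\<alpha> = 0")
    case True
    then have "\<beta> = 0" "\<gamma> = 0" using sq by simp_all
    then show thesis using conclude[OF R] True c d by (simp flip: T_def \<alpha>_def \<beta>_def \<gamma>_def)
  next
    case False
    define p q where "p = \<beta> / \<alpha>" and "q = \<gamma> / \<alpha>"
    have b: "\<beta> = \<alpha> * p" and c': "\<gamma> = \<alpha> * q" using False by (simp_all add: p_def q_def)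
    have p2: "p * p = 1" and q2: "q * q = 1"
      using sq False by (simp_all add: p_def q_def power2_eq_square)
    have "\<alpha> * (p * q * \<alpha>) = \<alpha> * (4 * \<tau>)" using prods(3) by (simp add: b c' algebra_simps)
    then have t: "\<tau> = p * q * \<alpha> / 4" using False by simp
    \<comment> \<open>This is 2 n n^T - 1 for the unit vector n = (1, p, q) / sqrt 3, since p and q
      are signs.\<close>
    define F where "F = (vector [vector [- 1/3, 2*p/3, 2*q/3], vector [2*p/3, - 1/3, 2*p*q/3],
      vector [2*q/3, 2*p*q/3, - 1/3]] :: real^3^3)"
    have F: "F$1$1 = - 1/3" "F$1$2 = 2*p/3" "F$1$3 = 2*q/3" "F$2$1 = 2*p/3" "F$2$2 = - 1/3" "F$2$3 = 2*p*q/3"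
      "F$3$1 = 2*q/3" "F$3$2 = 2*p*q/3" "F$3$3 = - 1/3" by (simp_all add: F_def)
    have oF: "orthogonal_matrix F"
      unfolding orthogonal_matrix
      using p2 q2 by (simp add: vec_eq_iff forall_3 matrix_matrix_mult_def transpose_def mat_def F sum_3) algebra
    have "det F = 1" using p2 q2 by (simp only: det_3 F) algebra
    then have rot: "rotation_matrix (F ** R)"
      using oF R by (simp add: rotation_matrix_def orthogonal_matrix_mul det_mul)
    have "act_cubic F T 1 2 2 = 0 \<and> act_cubic F T 1 3 3 = 0 \<and> act_cubic F T 1 1 2 = 0 \<and> act_cubic F T 2 3 3 = 0 \<and> act_cubic F T 1 1 3 = 0
      \<and> act_cubic F T 2 2 3 = 0 \<and> act_cubic F T 1 1 1 = 0 \<and> act_cubic F T 2 2 2 = 0 \<and> act_cubic F T 3 3 3 = 0"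
      using p2 q2 by (intro conjI; simp only: tact_sum sum_3 val F b c' t; algebra)
    then show thesis
      by (intro conclude[OF rot]) (simp_all add: tact_mult flip: T_def)
  qed
qed

section \<open>The nearly integrable model\<close>

lemma T_form_sum:
  assumes "\<And>a b c. S_tensor u a b c = S a b c" "symmetric_cubic S"
  shows "T_form u x y z = (\<Sum>a\<in>UNIV. \<Sum>b\<in>UNIV. \<Sum>c\<in>UNIV. S a b c * (sigma x $ a \<bullet> cross3 (sigma y $ b) (sigma z $ c)))"
  unfolding T_form_def wedge_3 assms(1) inner_3 cross_components
  by (simp only: sum_3 symmetric_cubic_sort[OF assms(2)]) algebra

text \<open>The torsion two-forms T^i, collected over i: row indices are contracted with S, column
  indices by the cross product.\<close>

definition Tvec :: "(3 \<Rightarrow> 3 \<Rightarrow> 3 \<Rightarrow> real) \<Rightarrow> real^9 \<Rightarrow> real^9 \<Rightarrow> real^9" where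
  "Tvec S y z = mat9 (\<chi> a. \<Sum>b\<in>UNIV. \<Sum>c\<in>UNIV. S a b c *\<^sub>R cross3 (sigma y $ b) (sigma z $ c))"

lemma symmetric_S_tensor: "symmetric_cubic (S_tensor u)"
  using S_tensor_commute by (simp add: symmetric_cubic_def)

lemma traceless_S_tensor: "traceless (S_tensor u)"
  unfolding traceless_def
proof
  fix c :: 3
  show "S_tensor u 1 1 c + S_tensor u 2 2 c + S_tensor u 3 3 c = 0"
    using exhaust_3[of c] by (elim disjE; simp add: S_tensor_values S_tensor_all)
qed

lemma T_form_Tvec: "T_form u x y z = x \<bullet> Tvec (S_tensor u) y z"
  unfolding T_form_sum[OF refl symmetric_S_tensor] inner_sigma Tvec_def
  by (simp add: inner_sum_right)

lemma T_form_axis: "(\<chi> i. T_form u (axis i 1) y z) = Tvec (S_tensor u) y z"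
  by (simp add: vec_eq_iff T_form_Tvec inner_axis' )

lemma Tvec_std:
  "sigma (Tvec (std_cubic t) X Y) $ 1 = - t *\<^sub>R (cross3 (sigma X $ 2) (sigma Y $ 3) + cross3 (sigma X $ 3) (sigma Y $ 2))"
  "sigma (Tvec (std_cubic t) X Y) $ 2 = - t *\<^sub>R (cross3 (sigma X $ 1) (sigma Y $ 3) + cross3 (sigma X $ 3) (sigma Y $ 1))"
  "sigma (Tvec (std_cubic t) X Y) $ 3 = - t *\<^sub>R (cross3 (sigma X $ 1) (sigma Y $ 2) + cross3 (sigma X $ 2) (sigma Y $ 1))"
  by (simp_all add: Tvec_def sum_3 std_cubic_def scaleR_add_right)

definition sum_rows :: "real^9 \<Rightarrow> real^3" where
  "sum_rows X = sigma X $ 1 + sigma X $ 2 + sigma X $ 3"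

lemma sum_rows_simps [simp]:
  "sum_rows (X + Y) = sum_rows X + sum_rows Y" "sum_rows (X - Y) = sum_rows X - sum_rows Y"
  "sum_rows (c *\<^sub>R X) = c *\<^sub>R sum_rows X" "sum_rows 0 = 0"
  by (simp_all add: sum_rows_def scaleR_add_right)

text \<open>The linear map sending the Maurer--Cartan forms \<open>\<mu>\<^sub>i\<close> of the three factors to the adapted coframe;
  its columns are the vertices \<open>(1, -1, -1)\<close>, \<open>(-1, 1, -1)\<close>, \<open>(-1, -1, 1)\<close> of a tetrahedron.\<close>

definition tetra :: "real^9 \<Rightarrow> real^9" where
  "tetra A = mat9 (\<chi> a. 2 *\<^sub>R (sigma A $ a) - sum_rows A)"

definition tetra_inv :: "real^9 \<Rightarrow> real^9" where
  "tetra_inv X = mat9 (\<chi> a. (1/2) *\<^sub>R (sigma X $ a - sum_rows X))"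

lemma linear_tetra: "linear tetra"
  by (auto simp: linear_iff sigma_eq_iff tetra_def algebra_simps)

lemma linear_tetra_inv: "linear tetra_inv"
  by (auto simp: linear_iff sigma_eq_iff tetra_inv_def algebra_simps)

lemma tetra_inverse [simp]: "tetra (tetra_inv X) = X" "tetra_inv (tetra X) = X"
  by (simp_all add: sigma_eq_iff forall_3 tetra_def tetra_inv_def sum_rows_def algebra_simps)

lemma sum_rows_tetra: "sum_rows (tetra A) = - sum_rows A"
  by (simp add: tetra_def sum_rows_def algebra_simps) (simp add: vec_eq_iff)

definition maprows :: "(3 \<Rightarrow> real^3 \<Rightarrow> real^3) \<Rightarrow> real^9 \<Rightarrow> real^9" where
  "maprows f X = mat9 (\<chi> i. f i (sigma X $ i))"

lemma sigma_maprows [simp]: "sigma (maprows f X) $ i = f i (sigma X $ i)"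
  by (simp add: maprows_def)

lemma linear_maprows: "(\<And>i. linear (f i)) \<Longrightarrow> linear (maprows f)"
  by (simp add: linear_iff sigma_eq_iff)

lemma has_derivative_maprows:
  assumes "\<And>i. ((\<lambda>x. f x i) has_derivative (\<lambda>v. f' v i)) F"
  shows "((\<lambda>x. mat9 (\<chi> i. f x i)) has_derivative (\<lambda>v. mat9 (\<chi> i. f' v i))) F"
proof -
  have l: "linear (\<lambda>b. axis i b :: real^3^3)" for i
    by (rule linearI) (auto simp: vec_eq_iff axis_def)
  have e: "(\<chi> i. g i) = (\<Sum>i\<in>UNIV. axis i (g i) :: real^3^3)" for g
    by (simp add: vec_eq_iff forall_3 sum_3 axis_def)
  show ?thesis
    unfolding e
    by (intro bounded_linear.has_derivative[OF linear_conv_bounded_linear[THEN iffD1, OF linear_mat9]]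
        has_derivative_sum bounded_linear.has_derivative[OF linear_conv_bounded_linear[THEN iffD1, OF l]] assms)
qed

lemma linear_sigma_row: "linear (\<lambda>x. sigma x $ i)"
  by (rule linearI) simp_all

lemma has_derivative_sigma_row:
  "(f has_derivative f') F \<Longrightarrow> ((\<lambda>x. sigma (f x) $ i) has_derivative (\<lambda>v. sigma (f' v) $ i)) F"
  by (rule bounded_linear.has_derivative[OF linear_conv_bounded_linear[THEN iffD1, OF linear_sigma_row]])

text \<open>The parameter 2 t makes the constant in the Maurer-Cartan equation of each factor 4 t.
  With \<gamma> = - t (sum of the rows of \<theta>), the components \<gamma> + t (\<theta>_a -
  \<theta>_b - \<theta>_c) are then 4 t times the forms of the three factors.\<close>

definition model_theta :: "real \<Rightarrow> real^9 \<Rightarrow> real^9 \<Rightarrow> real^9" where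
  "model_theta t x v = tetra (maprows (\<lambda>i. cay_form (2 * t) (sigma x $ i)) v)"

definition model_frame :: "real \<Rightarrow> real^9 \<Rightarrow> real^9 \<Rightarrow> real^9" where
  "model_frame t x X = maprows (\<lambda>i. cay_frame (2 * t) (sigma x $ i)) (tetra_inv X)"

definition model_theta' :: "real \<Rightarrow> real^9 \<Rightarrow> real^9 \<Rightarrow> real^9 \<Rightarrow> real^9" where
  "model_theta' t x u v = tetra (mat9 (\<chi> i. cay_form_deriv (2 * t) (sigma x $ i) (sigma u $ i) (sigma v $ i)))"

definition model_theta'' :: "real \<Rightarrow> real^9 \<Rightarrow> real^9 \<Rightarrow> real^9 \<Rightarrow> real^9 \<Rightarrow> real^9" where
  "model_theta'' t x z u v =
     tetra (mat9 (\<chi> i. cay_form_deriv2 (2 * t) (sigma x $ i) (sigma z $ i) (sigma u $ i) (sigma v $ i)))"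

text \<open>Determined by \<gamma> + t (sum of the rows of \<theta>) = 0: in the group, M is the
  slice with trivial rotation part, where the fourth so(3)-component vanishes.\<close>

definition model_gamma :: "real \<Rightarrow> real^9 \<Rightarrow> real^9 \<Rightarrow> real^3" where
  "model_gamma t x v = hat3 (- t *\<^sub>R sum_rows (model_theta t x v))"

text \<open>The characteristic connection minus half of its torsion; a totally skew torsion can be
  removed in this way without losing metricity.\<close>

definition lc_model :: "real \<Rightarrow> real^9 \<Rightarrow> real^9 \<Rightarrow> real^9" where
  "lc_model t X Y = maprows (\<lambda>i y. - t *\<^sub>R cross3 (sum_rows X) y) Y - (1/2) *\<^sub>R Tvec (std_cubic t) X Y"

definition model_metric :: "real \<Rightarrow> tensor2" where
  "model_metric t x a b = model_theta t x a \<bullet> model_theta t x b"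

lemma linear_cay_form: "linear (cay_form s x)"
  by (rule linearI) (simp_all add: cay_form_def cross_add_right cross_mult_right algebra_simps)

lemma linear_model_theta: "linear (model_theta t x)"
  unfolding model_theta_def[abs_def]
  by (rule linear_compose[OF linear_maprows linear_tetra, unfolded o_def]) (rule linear_cay_form)

lemma model_frame_theta: "model_frame t x (model_theta t x v) = v"
  by (simp add: model_frame_def model_theta_def sigma_eq_iff cay_frame_form)

lemma model_theta_frame: "model_theta t x (model_frame t x X) = X"
proof -
  have "maprows (\<lambda>i. cay_form (2 * t) (sigma x $ i)) (model_frame t x X) = tetra_inv X"
    by (simp add: model_frame_def sigma_eq_iff cay_form_frame)
  then show ?thesis by (simp add: model_theta_def)
qed

lemma bounded_linear_tetra: "bounded_linear tetra"
  using linear_tetra by (simp add: linear_conv_bounded_linear)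

lemma has_derivative_model_theta:
  "((\<lambda>y. model_theta t y w) has_derivative (\<lambda>u. model_theta' t x u w)) (at x)"
  unfolding model_theta_def model_theta'_def maprows_def
  by (intro bounded_linear.has_derivative[OF bounded_linear_tetra] has_derivative_maprows
      has_derivative_compose[OF has_derivative_sigma_row[OF has_derivative_ident] has_derivative_cay_form])

lemma has_derivative_model_theta':
  "((\<lambda>y. model_theta' t y u w) has_derivative (\<lambda>z. model_theta'' t x z u w)) (at x)"
  unfolding model_theta'_def model_theta''_def
  by (intro bounded_linear.has_derivative[OF bounded_linear_tetra] has_derivative_maprows
      has_derivative_compose[OF has_derivative_sigma_row[OF has_derivative_ident] has_derivative_cay_form_deriv])

lemma model_theta''_sym: "model_theta'' t x z u w = model_theta'' t x u z w"
  by (simp add: model_theta''_def cay_form_deriv2_sym[of _ _ "sigma z $ _"])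

lemma smooth_on_cay_frame:
  "open S \<Longrightarrow> smooth_on S f \<Longrightarrow> smooth_on S g \<Longrightarrow> smooth_on S (\<lambda>x. cay_frame s (f x) (g x))"
  unfolding cay_frame_def
  by (intro smooth_on_add smooth_on_scaleR smooth_on_mult smooth_on_inner smooth_on_cross3 smooth_on_const)

lemma smooth_on_cay_form:
  assumes "open S" "smooth_on S f" "smooth_on S g"
  shows "smooth_on S (\<lambda>x. cay_form s (f x) (g x))"
proof -
  have "1 + s\<^sup>2 * (f x \<bullet> f x) \<noteq> 0" for x using denom_pos[of s "f x"] by simp
  then show ?thesis
    unfolding cay_form_def using assms
    by (intro smooth_on_add smooth_on_diff smooth_on_divide smooth_on_scaleR smooth_on_mult smooth_on_inner
        smooth_on_cross3 smooth_on_const) auto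
qed

lemma smooth_on_sigma_row: "open S \<Longrightarrow> smooth_on S f \<Longrightarrow> smooth_on S (\<lambda>x. sigma (f x) $ i)"
  by (rule smooth_on_linear[OF _ linear_sigma_row])

lemma smooth_on_mat9:
  "open S \<Longrightarrow> (\<And>i. smooth_on S (\<lambda>x. f x i)) \<Longrightarrow> smooth_on S (\<lambda>x. mat9 (\<chi> i. f x i))"
  by (intro smooth_on_linear[OF _ linear_mat9] smooth_on_vec_lambda)

lemma smooth_on_model_theta:
  "open S \<Longrightarrow> smooth_on S f \<Longrightarrow> smooth_on S g \<Longrightarrow> smooth_on S (\<lambda>x. model_theta t (f x) (g x))"
  unfolding model_theta_def maprows_def
  by (intro smooth_on_linear[OF _ linear_tetra] smooth_on_mat9 smooth_on_cay_form smooth_on_sigma_row)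

lemma smooth_on_model_frame:
  "open S \<Longrightarrow> smooth_on S f \<Longrightarrow> smooth_on S g \<Longrightarrow> smooth_on S (\<lambda>x. model_frame t (f x) (g x))"
  unfolding model_frame_def maprows_def
  by (intro smooth_on_mat9 smooth_on_cay_frame smooth_on_sigma_row smooth_on_linear[OF _ linear_tetra_inv])

text \<open>After inserting the Maurer-Cartan equations, both sides are bilinear in the forms
  \<open>V i\<close> and \<open>W i\<close> of the three factors, and the structure equation becomes
  one identity between cross products.\<close>

lemma model_torsion_free:
  "model_theta' t x v w - model_theta' t x w v
    = lc_model t (model_theta t x w) (model_theta t x v) - lc_model t (model_theta t x v) (model_theta t x w)"
proof -
  define V W where "V i = cay_form (2 * t) (sigma x $ i) (sigma v $ i)"
    and "W i = cay_form (2 * t) (sigma x $ i) (sigma w $ i)" for i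
  have L: "model_theta' t x v w - model_theta' t x w v = tetra (mat9 (\<chi> i. - (4 * t) *\<^sub>R cross3 (V i) (W i)))"
  proof -
    have "model_theta' t x v w - model_theta' t x w v = tetra (mat9 (\<chi> i.
        cay_form_deriv (2 * t) (sigma x $ i) (sigma v $ i) (sigma w $ i)
      - cay_form_deriv (2 * t) (sigma x $ i) (sigma w $ i) (sigma v $ i)))"
      unfolding model_theta'_def linear_diff[OF linear_tetra, symmetric]
      by (rule arg_cong[where f=tetra]) (simp add: sigma_eq_iff)
    then show ?thesis by (simp add: cay_form_deriv_antisym V_def W_def)
  qed
  have v: "sigma (model_theta t x v) $ a = 2 *\<^sub>R V a - (V 1 + V 2 + V 3)"
    and w: "sigma (model_theta t x w) $ a = 2 *\<^sub>R W a - (W 1 + W 2 + W 3)" for a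
    by (simp_all add: model_theta_def tetra_def V_def W_def sum_rows_def)
  show ?thesis
    unfolding L sigma_eq_iff forall_3
    by (intro conjI; rule vec3_eqI;
        simp only: tetra_def sum_rows_def lc_model_def sigma_simps sigma_mat9 sigma_maprows Tvec_std v w
          vec_lambda_beta vec3_simps; algebra)
qed

lemma bilinear_lc_model: "bilinear (lc_model t)"
  unfolding bilinear_def linear_iff
  by (auto simp: sigma_eq_iff forall_3 lc_model_def Tvec_std cross_add_left cross_add_right
      cross_mult_left cross_mult_right algebra_simps)

lemma lc_model_skew: "lc_model t X Y \<bullet> Z = - (Y \<bullet> lc_model t X Z)"
  unfolding inner_sigma sum_3
  by (simp only: lc_model_def sigma_simps sigma_maprows Tvec_std sum_rows_def vec3_simps; algebra)

lemma parallel_frame_model: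
  "parallel_frame (model_theta t) (model_frame t) (model_theta' t) (model_theta'' t) (lc_model t) (model_metric t)"
proof
  show "(\<lambda>y. model_frame t y w) differentiable at x" for x w
    using smooth_on_has_derivative[OF smooth_on_model_frame[OF open_UNIV smooth_on_ident[OF open_UNIV] smooth_on_const[OF open_UNIV]]]
    by (auto simp: differentiable_def)
  show "((\<lambda>y. model_theta' t y u w) has_derivative (\<lambda>z. model_theta'' t x z u w)) (at x)" for x u w
    by (rule has_derivative_model_theta')
  show "model_theta'' t x z u w = model_theta'' t x u z w" for x z u w
    by (rule model_theta''_sym)
qed (simp_all add: linear_add[OF linear_model_theta] linear_scale[OF linear_model_theta] model_frame_theta
    model_theta_frame has_derivative_model_theta bilinear_lc_model lc_model_skew[symmetric]
    model_torsion_free model_metric_def[abs_def])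

section \<open>Curvature of the model\<close>

interpretation model: parallel_frame "model_theta t" "model_frame t" "model_theta' t" "model_theta'' t"
    "lc_model t" "model_metric t" for t
  by (rule parallel_frame_model)

lemma nth_sigma:
  "a$1 = sigma a $ 1 $ 1" "a$2 = sigma a $ 1 $ 2" "a$3 = sigma a $ 1 $ 3"
  "a$4 = sigma a $ 2 $ 1" "a$5 = sigma a $ 2 $ 2" "a$6 = sigma a $ 2 $ 3"
  "a$7 = sigma a $ 3 $ 1" "a$8 = sigma a $ 3 $ 2" "a$9 = sigma a $ 3 $ 3" for a :: "real^9"
  by (simp_all add: sigma_nth)

lemma sigma_axis_rows:
  "sigma (axis 1 1) $ 1 = axis 1 1" "sigma (axis 2 1) $ 1 = axis 2 1" "sigma (axis 3 1) $ 1 = axis 3 1"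
  "sigma (axis 4 1) $ 2 = axis 1 1" "sigma (axis 5 1) $ 2 = axis 2 1" "sigma (axis 6 1) $ 2 = axis 3 1"
  "sigma (axis 7 1) $ 3 = axis 1 1" "sigma (axis 8 1) $ 3 = axis 2 1" "sigma (axis 9 1) $ 3 = axis 3 1"
  "sigma (axis 1 1) $ 2 = 0" "sigma (axis 2 1) $ 2 = 0" "sigma (axis 3 1) $ 2 = 0"
  "sigma (axis 1 1) $ 3 = 0" "sigma (axis 2 1) $ 3 = 0" "sigma (axis 3 1) $ 3 = 0"
  "sigma (axis 4 1) $ 1 = 0" "sigma (axis 5 1) $ 1 = 0" "sigma (axis 6 1) $ 1 = 0"
  "sigma (axis 4 1) $ 3 = 0" "sigma (axis 5 1) $ 3 = 0" "sigma (axis 6 1) $ 3 = 0"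
  "sigma (axis 7 1) $ 1 = 0" "sigma (axis 8 1) $ 1 = 0" "sigma (axis 9 1) $ 1 = 0"
  "sigma (axis 7 1) $ 2 = 0" "sigma (axis 8 1) $ 2 = 0" "sigma (axis 9 1) $ 2 = 0"
  by (simp_all add: vec_eq_iff forall_3 sigma_nth axis_def)

lemma lc_model_rows:
  "sigma (lc_model t X Y) $ 1 = t *\<^sub>R ((1/2) *\<^sub>R (cross3 (sigma X $ 2) (sigma Y $ 3) + cross3 (sigma X $ 3) (sigma Y $ 2))
     - cross3 (sigma X $ 1 + sigma X $ 2 + sigma X $ 3) (sigma Y $ 1))"
  "sigma (lc_model t X Y) $ 2 = t *\<^sub>R ((1/2) *\<^sub>R (cross3 (sigma X $ 1) (sigma Y $ 3) + cross3 (sigma X $ 3) (sigma Y $ 1))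
     - cross3 (sigma X $ 1 + sigma X $ 2 + sigma X $ 3) (sigma Y $ 2))"
  "sigma (lc_model t X Y) $ 3 = t *\<^sub>R ((1/2) *\<^sub>R (cross3 (sigma X $ 1) (sigma Y $ 2) + cross3 (sigma X $ 2) (sigma Y $ 1))
     - cross3 (sigma X $ 1 + sigma X $ 2 + sigma X $ 3) (sigma Y $ 3))"
  by (simp_all add: lc_model_def Tvec_std sum_rows_def scaleR_diff_right scaleR_add_right)

lemma axis3_nth:
  "axis 1 (1::real) $ (1::3) = 1" "axis 1 (1::real) $ (2::3) = 0" "axis 1 (1::real) $ (3::3) = 0"
  "axis 2 (1::real) $ (1::3) = 0" "axis 2 (1::real) $ (2::3) = 1" "axis 2 (1::real) $ (3::3) = 0"
  "axis 3 (1::real) $ (1::3) = 0" "axis 3 (1::real) $ (2::3) = 0" "axis 3 (1::real) $ (3::3) = 1"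
  by (simp_all add: axis_def)

lemmas component_simps = sigma_simps sigma_axis_rows lc_model_rows vec3_simps axis3_nth zero_index mult_zero_left
  mult_zero_right add_0 add_0_right diff_zero mult_1 mult_1_right diff_0

lemma ricci_lc_model:
  "(\<Sum>i\<in>UNIV. model.Rc t (axis i 1) X Y $ i) = 3 * t\<^sup>2 * (X \<bullet> Y)"
proof -
  define x where "x r c = sigma X $ r $ c" for r c
  define y where "y r c = sigma Y $ r $ c" for r c
  show ?thesis
    unfolding sum_9 inner_sigma sum_3
    by (simp only: nth_sigma model.Rc_def component_simps flip: x_def y_def) algebra
qed

text \<open>The four frame vectors are mutually orthogonal, so a nonzero value obstructs conformal
  flatness.\<close>

lemma weyl_component: "model.Rc t (axis 1 1) (axis 2 1) (axis 4 1) \<bullet> axis 5 1 = - 3/4 * t\<^sup>2"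
  unfolding inner_sigma sum_3 by (simp only: model.Rc_def component_simps) (simp add: power2_eq_square)

text \<open>For nonzero t this single component of the derivative of the curvature refutes local
  symmetry.\<close>

lemma nabla_riemann_component:
  "(lc_model t (axis 1 1) (model.Rc t (axis 1 1) (axis 2 1) (axis 4 1))
    - model.Rc t (lc_model t (axis 1 1) (axis 1 1)) (axis 2 1) (axis 4 1)
    - model.Rc t (axis 1 1) (lc_model t (axis 1 1) (axis 2 1)) (axis 4 1)
    - model.Rc t (axis 1 1) (axis 2 1) (lc_model t (axis 1 1) (axis 4 1))) $ 9 = - 3/8 * t ^ 3"
  by (simp only: nth_sigma model.Rc_def component_simps) (simp add: power3_eq_cube)

lemma lc_model_zero: "lc_model 0 X Y = 0"
  by (simp add: sigma_eq_iff forall_3 lc_model_rows)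

lemma ricci_model: "ricci (model_metric t) x v w = 3 * t\<^sup>2 * model_metric t x v w"
  by (simp add: model.ricci ricci_lc_model) (simp add: model_metric_def)

lemma locally_symmetric_model: "locally_symmetric UNIV (model_metric t) \<longleftrightarrow> t = 0"
proof
  assume ls: "locally_symmetric UNIV (model_metric t)"
  let ?E = "model_frame t 0"
  define W where "W = lc_model t (axis 1 1) (model.Rc t (axis 1 1) (axis 2 1) (axis 4 1))
    - model.Rc t (lc_model t (axis 1 1) (axis 1 1)) (axis 2 1) (axis 4 1)
    - model.Rc t (axis 1 1) (lc_model t (axis 1 1) (axis 2 1)) (axis 4 1)
    - model.Rc t (axis 1 1) (axis 2 1) (lc_model t (axis 1 1) (axis 4 1))"
  have "nabla_riemann (model_metric t) 0 (?E (axis 1 1)) (?E (axis 1 1)) (?E (axis 2 1)) (?E (axis 4 1)) = 0"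
    using ls by (simp add: locally_symmetric_def)
  then have "?E W = 0"
    unfolding model.nabla_riemann model_theta_frame W_def .
  then have "W = 0"
    using model_theta_frame[of t 0 W] by (simp add: linear_0[OF linear_model_theta])
  then have "W $ 9 = 0" by simp
  then show "t = 0" unfolding W_def nabla_riemann_component by simp
next
  assume "t = 0"
  then show "locally_symmetric UNIV (model_metric t)"
    by (simp add: locally_symmetric_def model.nabla_riemann model.Rc_def lc_model_zero linear_0[OF model.linE])
qed

lemma not_conformally_flat_model:
  assumes "t \<noteq> 0" shows "\<not> conformally_flat UNIV (model_metric t)"
proof
  assume "conformally_flat UNIV (model_metric t)"
  from model.conformally_flat_curvature[OF this UNIV_I, of "axis 1 1" "axis 2 1" "axis 4 1" "axis 5 1"]
  have "model.Rc t (axis 1 1) (axis 2 1) (axis 4 1) \<bullet> axis 5 1 = 0"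
    by (simp add: inner_axis_axis)
  then show False unfolding weyl_component using assms by simp
qed

section \<open>Uniqueness of the characteristic connection\<close>

text \<open>The entries of l cross e_a off the axis give the components of l other than the a-th;
  one entry of l cross e_b gives that one.\<close>

lemma vec3_zeroI:
  fixes l :: "real^3"
  assumes "\<And>m. m \<noteq> a \<Longrightarrow> cross3 l (axis a 1) $ m = 0"
    and "\<And>b e. a \<noteq> b \<Longrightarrow> e \<noteq> a \<Longrightarrow> e \<noteq> b \<Longrightarrow> cross3 l (axis b 1) $ e = 0"
  shows "l = 0"
proof -
  have "a = 1 \<or> a = 2 \<or> a = 3" by (rule exhaust_3)
  then show ?thesis
  proof (elim disjE)
    assume "a = 1"
    then show ?thesis
      using assms(1)[of 2] assms(1)[of 3] assms(2)[of 2 3]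
      by (simp add: vec_eq_iff forall_3 cross_components axis_def)
  next
    assume "a = 2"
    then show ?thesis
      using assms(1)[of 1] assms(1)[of 3] assms(2)[of 3 1]
      by (simp add: vec_eq_iff forall_3 cross_components axis_def)
  next
    assume "a = 3"
    then show ?thesis
      using assms(1)[of 1] assms(1)[of 2] assms(2)[of 1 2]
      by (simp add: vec_eq_iff forall_3 cross_components axis_def)
  qed
qed

text \<open>No nonzero linear map from R^9 to so(3)_L + so(3)_R is a three-form, which is the reason
  for uniqueness of the characteristic connection. Polarisation and elementary matrices isolate
  single entries of \<xi> and \<eta>.\<close>

lemma skew_action_zero:
  fixes \<xi> \<eta> :: "real^9 \<Rightarrow> real^3"
  assumes "linear \<xi>" "linear \<eta>"
    and zero: "\<And>X r s. cross3 (\<xi> X) (column s (sigma X)) $ r + cross3 (\<eta> X) (sigma X $ r) $ s = 0"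
  shows "\<xi> X = 0 \<and> \<eta> X = 0"
proof -
  define E where "E a c = mat9 (elem a c)" for a c
  have pol: "cross3 (\<xi> X) (column s (sigma Y)) $ r + cross3 (\<eta> X) (sigma Y $ r) $ s
      + cross3 (\<xi> Y) (column s (sigma X)) $ r + cross3 (\<eta> Y) (sigma X $ r) $ s = 0" for X Y r s
  proof -
    have col: "column s (sigma X + sigma Y) = column s (sigma X) + column s (sigma Y)" for X Y
      by (simp add: column_def vec_eq_iff)
    show ?thesis
      using zero[of "X + Y" s r] zero[of X s r] zero[of Y s r]
      by (simp add: linear_add[OF assms(1)] linear_add[OF assms(2)] col cross_add_left cross_add_right)
  qed
  have cE: "column s (sigma (E a c)) = (if s = c then axis a 1 else 0)" for s a c
    by (simp add: E_def column_def elem_def vec_eq_iff axis_def)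
  have rE: "sigma (E a c) $ r = (if r = a then axis c 1 else 0)" for r a c
    by (simp add: E_def elem_def vec_eq_iff axis_def)
  have other: "\<exists>d::3. c \<noteq> d" for c
    using exhaust_3[of c] by (metis zero_neq_one num1_eq_iff one_neq_zero exhaust_3 zero_neq_numeral)
  have l0: "\<xi> (E a c) = 0" for a c
  proof (rule vec3_zeroI[of a])
    fix m assume "m \<noteq> a"
    then show "cross3 (\<xi> (E a c)) (axis a 1) $ m = 0"
      using zero[of "E a c" c m] by (simp add: cE rE)
  next
    fix b e assume *: "a \<noteq> b" "e \<noteq> a" "e \<noteq> b"
    \<comment> \<open>Column d differs from c, and row e from a and b, so only one of the four terms
      of \<open>pol\<close> survives.\<close>
    obtain d where "c \<noteq> d" using other by blast
    then show "cross3 (\<xi> (E a c)) (axis b 1) $ e = 0"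
      using pol[of "E a c" d "E b d" e] * by (simp add: cE rE)
  qed
  have r0: "\<eta> (E a c) = 0" for a c
  proof (rule vec3_zeroI[of c])
    fix m assume "m \<noteq> c"
    then show "cross3 (\<eta> (E a c)) (axis c 1) $ m = 0"
      using zero[of "E a c" m a] by (simp add: cE rE)
  next
    fix d e assume *: "c \<noteq> d" "e \<noteq> c" "e \<noteq> d"
    obtain b where "a \<noteq> b" using other by blast
    then show "cross3 (\<eta> (E a c)) (axis d 1) $ e = 0"
      using pol[of "E a c" e "E b d" b] * by (simp add: cE rE)
  qed
  have X: "X = (\<Sum>a\<in>UNIV. \<Sum>c\<in>UNIV. (sigma X $ a $ c) *\<^sub>R E a c)" for X
    by (simp add: sigma_eq_iff sigma_sum rE) (simp add: vec_eq_iff forall_3 sum_3 axis_def)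
  have "\<xi> X = 0"
    by (subst X) (simp add: linear_sum[OF assms(1)] linear_scale[OF assms(1)] l0)
  moreover have "\<eta> X = 0"
    by (subst X) (simp add: linear_sum[OF assms(2)] linear_scale[OF assms(2)] r0)
  ultimately show ?thesis by simp
qed

text \<open>If the torsions of two metric connections are both totally skew, then their difference
  \<open>D\<close> satisfies \<open>D X X = 0\<close>.\<close>

lemma skew_torsion_difference:
  fixes D :: "real^'n \<Rightarrow> real^'n \<Rightarrow> real^'n"
  assumes skew: "\<And>X Y Z. D X Y \<bullet> Z = - (Y \<bullet> D X Z)"
    and tor: "\<And>X Y. (D X Y - D Y X) \<bullet> Y = 0"
  shows "D X X = 0"
proof -
  have "D Y X \<bullet> Y = 0" for X Y
    using tor[of X Y] skew[of X Y Y] by (simp add: inner_diff_left inner_diff_right inner_commute)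
  then have "D Y Y \<bullet> X = 0" for X Y
    using skew[of Y Y X] by (simp add: inner_commute)
  then show ?thesis by (metis inner_eq_zero_iff)
qed

section \<open>The module \<open>V\<^bsub>[0,6]\<^esub>\<close>\<close>

definition row_of :: "9 \<Rightarrow> 3" where
  "row_of i = (if i = 1 \<or> i = 2 \<or> i = 3 then 1 else if i = 4 \<or> i = 5 \<or> i = 6 then 2 else 3)"

definition col_of :: "9 \<Rightarrow> 3" where
  "col_of i = (if i = 1 \<or> i = 4 \<or> i = 7 then 1 else if i = 2 \<or> i = 5 \<or> i = 8 then 2 else 3)"

lemma row_col_of:
  "row_of 1 = 1" "row_of 2 = 1" "row_of 3 = 1" "row_of 4 = 2" "row_of 5 = 2" "row_of 6 = 2" "row_of 7 = 3" "row_of 8 = 3" "row_of 9 = 3"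
  "col_of 1 = 1" "col_of 2 = 2" "col_of 3 = 3" "col_of 4 = 1" "col_of 5 = 2" "col_of 6 = 3" "col_of 7 = 1" "col_of 8 = 2" "col_of 9 = 3"
  by (simp_all add: row_of_def col_of_def)

lemma sum_row_col: "(\<Sum>a\<in>UNIV. f (row_of a) (col_of a)) = (\<Sum>r\<in>UNIV. \<Sum>c\<in>UNIV. f r c)"
  unfolding sum_9 sum_3 row_col_of by (simp add: add_ac)

lemma row_col_surj: "\<exists>i. row_of i = r \<and> col_of i = c"
  using exhaust_3[of r] exhaust_3[of c] by (metis row_col_of)

lemma mat9_row_col: "mat9 A $ i = A $ row_of i $ col_of i"
  using exhaust_9[of i] by (elim disjE; simp add: mat9_nth row_col_of)

lemma sigma_axis: "sigma (axis i 1) $ r = (if r = row_of i then axis (col_of i) 1 else 0)"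
proof -
  have "sigma (axis i 1) = (\<chi> r. if r = row_of i then axis (col_of i) 1 else 0)"
    using exhaust_9[of i] by (elim disjE; simp add: vec_eq_iff forall_3 sigma_nth row_col_of axis_def)
  then show ?thesis by simp
qed

definition eps :: "3 \<Rightarrow> 3 \<Rightarrow> 3 \<Rightarrow> real" where
  "eps a b c = axis a 1 \<bullet> cross3 (axis b 1) (axis c 1)"

text \<open>Rows and columns split R^9 as a tensor product of two copies of R^3. Symmetric S and
  skew e give the summand Sym^3 tensor Lambda^3 of the three-forms; SO(3)_R fixes it because
  Lambda^3 of R^3 is trivial.\<close>

definition tensor33 :: "(3 \<Rightarrow> 3 \<Rightarrow> 3 \<Rightarrow> real) \<Rightarrow> (3 \<Rightarrow> 3 \<Rightarrow> 3 \<Rightarrow> real) \<Rightarrow> real^9^9^9" where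
  "tensor33 S e = (\<chi> i j k. S (row_of i) (row_of j) (row_of k) * e (col_of i) (col_of j) (col_of k))"

lemma tensor33_Tvec: "tensor33 S eps $ i $ j $ k = axis i 1 \<bullet> Tvec S (axis j 1) (axis k 1)"
proof -
  have "axis i 1 \<bullet> Tvec S (axis j 1) (axis k 1) = sigma (Tvec S (axis j 1) (axis k 1)) $ row_of i \<bullet> axis (col_of i) 1"
    unfolding inner_sigma sigma_axis
    by (simp add: if_distrib[of "\<lambda>x. x \<bullet> _"] inner_commute[of _ "axis (col_of i) 1"] cong: if_cong)
  also have "sigma (Tvec S (axis j 1) (axis k 1)) $ row_of i
      = (\<Sum>b\<in>UNIV. \<Sum>c\<in>UNIV. S (row_of i) b c *\<^sub>R cross3 (if b = row_of j then axis (col_of j) 1 else 0) (if c = row_of k then axis (col_of k) 1 else 0))"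
    by (simp add: Tvec_def sigma_axis)
  also have "\<dots> = (\<Sum>b\<in>UNIV. \<Sum>c\<in>UNIV. if c = row_of k then (if b = row_of j then S (row_of i) b c *\<^sub>R cross3 (axis (col_of j) 1) (axis (col_of k) 1) else 0) else 0)"
    by (intro sum.cong refl) simp
  also have "\<dots> = S (row_of i) (row_of j) (row_of k) *\<^sub>R cross3 (axis (col_of j) 1) (axis (col_of k) 1)"
    by simp
  finally show ?thesis by (simp add: tensor33_def eps_def inner_commute)
qed

lemma rho_nth:
  assumes "hR \<in> SO3"
  shows "rho hL hR $ i $ a = hL $ row_of i $ row_of a * hR $ col_of i $ col_of a"
proof -
  have o: "orthogonal_matrix hR" using assms by (simp add: SO3_def rotation_matrix_def)
  have sc: "sigma (axis a 1) $ l $ k = (if l = row_of a then if k = col_of a then 1 else 0 else 0)" for l k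
    by (simp only: sigma_axis) (auto simp: axis_def)
  have "matrix_inv hR = transpose hR ** (hR ** matrix_inv hR)"
    using o by (simp add: matrix_mul_assoc orthogonal_matrix_def)
  also have "hR ** matrix_inv hR = mat 1"
    unfolding matrix_inv_def by (rule someI2[of _ "transpose hR"]) (use o in \<open>auto simp: orthogonal_matrix_def\<close>)
  finally have "matrix_inv hR = transpose hR" by simp
  then have "rho hL hR $ i $ a = (hL ** sigma (axis a 1) ** transpose hR) $ row_of i $ col_of i"
    by (simp add: rho_def matrix_def inv_sigma mat9_row_col)
  also have "\<dots> = (\<Sum>k\<in>UNIV. (\<Sum>l\<in>UNIV. hL $ row_of i $ l * sigma (axis a 1) $ l $ k) * hR $ col_of i $ k)"
    by (simp add: matrix_matrix_mult_def transpose_def)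
  also have "\<dots> = (\<Sum>k\<in>UNIV. (\<Sum>l\<in>UNIV. if l = row_of a then (if k = col_of a then hL $ row_of i $ l else 0) else 0) * hR $ col_of i $ k)"
    by (intro sum.cong refl arg_cong2[where f="(*)"]) (simp add: sc)
  also have "\<dots> = hL $ row_of i $ row_of a * hR $ col_of i $ col_of a"
    by (simp add: if_distrib[of "\<lambda>x. x * _"] cong: if_cong)
  finally show ?thesis .
qed

lemma act3_tensor33:
  assumes "hR \<in> SO3"
  shows "act3 (rho hL hR) (tensor33 S e) = tensor33 (act_cubic hL S) (act_cubic hR e)"
proof -
  \<comment> \<open>A sum over the nine indices splits into a sum over rows times a sum over
    columns; this is applied once for each of the three indices.\<close>
  have s: "(\<Sum>a\<in>UNIV. (L (row_of a) * R (col_of a)) * (S (row_of a) * e (col_of a))) = (\<Sum>a\<in>UNIV. L a * S a) * (\<Sum>a\<in>UNIV. R a * e a)"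
    for L R S e :: "3 \<Rightarrow> real"
    unfolding sum_row_col[of "\<lambda>r c. (L r * R c) * (S r * e c)"] sum_product
    by (intro sum.cong refl) (simp add: mult_ac)
  have "act3 (rho hL hR) (tensor33 S e) $ i $ j $ k = tensor33 (act_cubic hL S) (act_cubic hR e) $ i $ j $ k" for i j k
  proof -
    let ?h = "\<lambda>i a. hL $ row_of i $ row_of a * hR $ col_of i $ col_of a"
    have 3: "(\<Sum>c\<in>UNIV. ?h k c * (S (row_of a) (row_of b) (row_of c) * e (col_of a) (col_of b) (col_of c)))
        = slot3 hL S (row_of a) (row_of b) (row_of k) * slot3 hR e (col_of a) (col_of b) (col_of k)" for a b
      unfolding slot3_def by (rule s)
    have 2: "(\<Sum>b\<in>UNIV. ?h j b * (slot3 hL S (row_of a) (row_of b) (row_of k) * slot3 hR e (col_of a) (col_of b) (col_of k)))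
        = slot2 hL (slot3 hL S) (row_of a) (row_of j) (row_of k) * slot2 hR (slot3 hR e) (col_of a) (col_of j) (col_of k)" for a
      unfolding slot2_def by (rule s)
    have 1: "(\<Sum>a\<in>UNIV. ?h i a * (slot2 hL (slot3 hL S) (row_of a) (row_of j) (row_of k) * slot2 hR (slot3 hR e) (col_of a) (col_of j) (col_of k)))
        = act_cubic hL S (row_of i) (row_of j) (row_of k) * act_cubic hR e (col_of i) (col_of j) (col_of k)"
      unfolding act_cubic_def slot1_def by (rule s)
    have "act3 (rho hL hR) (tensor33 S e) $ i $ j $ k = (\<Sum>a\<in>UNIV. ?h i a * (\<Sum>b\<in>UNIV. ?h j b *
        (\<Sum>c\<in>UNIV. ?h k c * (S (row_of a) (row_of b) (row_of c) * e (col_of a) (col_of b) (col_of c)))))"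
      by (simp only: act3_def tensor33_def vec_lambda_beta rho_nth[OF assms] sum_distrib_left mult.assoc)
    also have "\<dots> = act_cubic hL S (row_of i) (row_of j) (row_of k) * act_cubic hR e (col_of i) (col_of j) (col_of k)"
      unfolding 3 2 1 ..
    finally show ?thesis by (simp add: tensor33_def)
  qed
  then show ?thesis by (simp add: vec_eq_iff)
qed

text \<open>The triple product of vectors is invariant under rotations.\<close>

lemma tact_eps:
  assumes "hR \<in> SO3" shows "act_cubic hR eps = eps"
proof (intro ext)
  fix a b c
  have rt: "rotation_matrix (transpose hR)"
    using assms by (simp add: SO3_def rotation_matrix_def det_transpose)
  have "trilin eps x y z = x \<bullet> cross3 y z" for x y z
  proof -
    have "eps 1 2 3 = 1" "eps 2 3 1 = 1" "eps 3 1 2 = 1" "eps 1 3 2 = -1" "eps 3 2 1 = -1" "eps 2 1 3 = -1"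
      "eps 1 1 a = 0" "eps 2 2 a = 0" "eps 3 3 a = 0" "eps 1 a 1 = 0" "eps 2 a 2 = 0" "eps 3 a 3 = 0"
      "eps a 1 1 = 0" "eps a 2 2 = 0" "eps a 3 3 = 0" for a
      by (simp_all add: eps_def inner_3 cross_components axis_def)
    then show ?thesis by (simp add: trilin_def sum_3 inner_3 cross_components algebra_simps)
  qed
  then have "act_cubic hR eps a b c = hR$a \<bullet> cross3 (hR$b) (hR$c)" by (simp add: tact_trilin)
  also have "\<dots> = (transpose hR *v axis a 1) \<bullet> cross3 (transpose hR *v axis b 1) (transpose hR *v axis c 1)"
    by (simp only: matrix_vector_mult_basis column_transpose row_def vec_lambda_eta)
  also have "\<dots> = (transpose hR *v axis a 1) \<bullet> (transpose hR *v (cross3 (axis b 1) (axis c 1)))"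
    by (simp only: cross_rotation_matrix[OF rt])
  also have "\<dots> = eps a b c"
  proof -
    have "orthogonal_transformation ((*v) (transpose hR))"
      using rt by (auto simp: rotation_matrix_def orthogonal_transformation_matrix)
    then show ?thesis by (simp add: orthogonal_transformation_def eps_def)
  qed
  finally show "act_cubic hR eps a b c = eps a b c" .
qed

lemma eps_antisym: "eps a b c = - eps b a c" "eps a b c = - eps a c b"
  by (simp_all add: eps_def inner_3 cross_components algebra_simps)

lemma tensor33_Lambda3: "symmetric_cubic S \<Longrightarrow> tensor33 S eps \<in> Lambda3"
proof -
  assume S: "symmetric_cubic S"
  have "S (row_of i) (row_of j) (row_of k) * eps (col_of i) (col_of j) (col_of k) = - (S (row_of j) (row_of i) (row_of k) * eps (col_of j) (col_of i) (col_of k))"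
    "S (row_of i) (row_of j) (row_of k) * eps (col_of i) (col_of j) (col_of k) = - (S (row_of i) (row_of k) (row_of j) * eps (col_of i) (col_of k) (col_of j))" for i j k
  proof -
    have a: "S x y z = S y x z" "S x y z = S x z y" for x y z
      using S by (auto simp: symmetric_cubic_def)
    show "S (row_of i) (row_of j) (row_of k) * eps (col_of i) (col_of j) (col_of k) = - (S (row_of j) (row_of i) (row_of k) * eps (col_of j) (col_of i) (col_of k))"
      by (simp only: a(1)[of "row_of i" "row_of j" "row_of k"] eps_antisym(1)[of "col_of i" "col_of j" "col_of k"] mult_minus_right)
    show "S (row_of i) (row_of j) (row_of k) * eps (col_of i) (col_of j) (col_of k) = - (S (row_of i) (row_of k) (row_of j) * eps (col_of i) (col_of k) (col_of j))"
      by (simp only: a(2)[of "row_of i" "row_of j" "row_of k"] eps_antisym(2)[of "col_of i" "col_of j" "col_of k"] mult_minus_right)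
  qed
  then show ?thesis unfolding Lambda3_def tensor33_def mem_Collect_eq vec_lambda_beta by blast
qed

lemma tensor33_inj:
  assumes "tensor33 S eps = tensor33 S' eps" shows "S a b c = S' a b c"
proof -
  obtain i j k where ijk: "row_of i = a" "col_of i = 1" "row_of j = b" "col_of j = 2" "row_of k = c" "col_of k = 3"
    using row_col_surj by meson
  have "tensor33 S eps $ i $ j $ k = tensor33 S' eps $ i $ j $ k" by (simp add: assms)
  moreover have "eps 1 2 3 = 1" by (simp add: eps_def inner_3 cross_components axis_def)
  ultimately show ?thesis by (simp add: tensor33_def ijk)
qed

section \<open>Coordinates on the traceless cubic forms\<close>

definition coords :: "(3 \<Rightarrow> 3 \<Rightarrow> 3 \<Rightarrow> real) \<Rightarrow> real^7" where
  "coords S = (\<chi> i. if i = 1 then S 1 2 2 else if i = 2 then - S 1 2 3 else if i = 3 then S 1 3 3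
     else if i = 4 then S 2 2 2 else if i = 5 then S 2 2 3 else if i = 6 then S 2 3 3 else S 3 3 3)"

lemma coords_nth: "coords S $ 1 = S 1 2 2" "coords S $ 2 = - S 1 2 3" "coords S $ 3 = S 1 3 3"
  "coords S $ 4 = S 2 2 2" "coords S $ 5 = S 2 2 3" "coords S $ 6 = S 2 3 3" "coords S $ 7 = S 3 3 3"
  by (simp_all add: coords_def)

lemma exhaust_7: "x = 1 \<or> x = 2 \<or> x = 3 \<or> x = 4 \<or> x = 5 \<or> x = 6 \<or> x = 7" for x :: 7
proof (induct x)
  case (of_int z)
  then have "0 \<le> z" "z < 7" by simp_all
  then have "z = 0 \<or> z = 1 \<or> z = 2 \<or> z = 3 \<or> z = 4 \<or> z = 5 \<or> z = 6" by arith
  then show ?case by auto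
qed

lemma forall_7: "(\<forall>i::7. P i) \<longleftrightarrow> P 1 \<and> P 2 \<and> P 3 \<and> P 4 \<and> P 5 \<and> P 6 \<and> P 7"
  by (metis exhaust_7)

lemma S_tensor_coords:
  assumes S: "symmetric_cubic S" "traceless S"
  shows "S_tensor (coords S) = S"
proof (intro ext)
  fix a b c
  have t: "S 1 1 1 = - (S 1 2 2 + S 1 3 3)" "S 1 1 2 = - (S 2 2 2 + S 2 3 3)" "S 1 1 3 = - (S 2 2 3 + S 3 3 3)"
    using S(2)[unfolded traceless_def, rule_format, of 1] S(2)[unfolded traceless_def, rule_format, of 2]
      S(2)[unfolded traceless_def, rule_format, of 3]
    by (simp_all add: symmetric_cubic_sort[OF S(1)])
  show "S_tensor (coords S) a b c = S a b c"
    using exhaust_3[of a] exhaust_3[of b] exhaust_3[of c]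
    by (elim disjE; simp add: S_tensor_values S_tensor_all coords_nth symmetric_cubic_sort[OF S(1)] t)
qed

lemma coords_S_tensor: "coords (S_tensor u) = u"
  unfolding vec_eq_iff forall_7 coords_nth by (simp add: S_tensor_values)

lemma S_tensor_linear:
  "S_tensor (u + v) a b c = S_tensor u a b c + S_tensor v a b c"
  "S_tensor (r *\<^sub>R u) a b c = r * S_tensor u a b c"
  using exhaust_3[of a] exhaust_3[of b] exhaust_3[of c]
  by (elim disjE; simp add: S_tensor_values S_tensor_all algebra_simps)+

text \<open>Tracelessness is built into \<open>S_tensor\<close>, so R^7 parametrises exactly the
  traceless part of Sym^3 of R^3.\<close>

definition cubic_forms :: "real^7 \<Rightarrow> real^9^9^9" where
  "cubic_forms u = tensor33 (S_tensor u) eps"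

lemma linear_cubic_forms: "linear cubic_forms"
  by (auto simp: linear_iff cubic_forms_def tensor33_def vec_eq_iff S_tensor_linear algebra_simps)

lemma inj_cubic_forms: "inj cubic_forms"
proof (rule injI)
  fix u v assume "cubic_forms u = cubic_forms v"
  then have "S_tensor u = S_tensor v"
    unfolding cubic_forms_def by (intro ext) (rule tensor33_inj)
  then show "u = v" by (metis coords_S_tensor)
qed

definition turn :: "real^3^3 \<Rightarrow> real^7 \<Rightarrow> real^7" where
  "turn h u = coords (act_cubic h (S_tensor u))"

lemma S_tensor_turn:
  assumes "h \<in> SO3" shows "S_tensor (turn h u) = act_cubic h (S_tensor u)"
  unfolding turn_def using assms
  by (intro S_tensor_coords symmetric_cubic_tact symmetric_S_tensor traceless_tact traceless_S_tensor)
    (simp add: SO3_def rotation_matrix_def)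

lemma act3_cubic_forms:
  assumes "hL \<in> SO3" "hR \<in> SO3"
  shows "act3 (rho hL hR) (cubic_forms u) = cubic_forms (turn hL u)"
  by (simp add: cubic_forms_def act3_tensor33[OF assms(2)] tact_eps[OF assms(2)] S_tensor_turn[OF assms(1)])

section \<open>Irreducibility of the traceless cubic forms\<close>

definition rot_quarter :: "real^3^3" where
  "rot_quarter = vector [vector [0, - 1, 0], vector [1, 0, 0], vector [0, 0, 1]]"

definition rot_cyclic :: "real^3^3" where
  "rot_cyclic = vector [vector [0, 0, 1], vector [1, 0, 0], vector [0, 1, 0]]"

text \<open>The triple 3, 4, 5 keeps all coordinates rational.\<close>

definition rot_xy :: "real \<Rightarrow> real^3^3" where
  "rot_xy s = vector [vector [3/5, - s, 0], vector [s, 3/5, 0], vector [0, 0, 1]]"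

definition rot_xz :: "real^3^3" where
  "rot_xz = vector [vector [3/5, 0, - (4/5)], vector [0, 1, 0], vector [4/5, 0, 3/5]]"

lemma SO3I:
  assumes "R ** transpose R = mat 1" "det R = 1" shows "R \<in> SO3"
  using assms by (simp add: SO3_def rotation_matrix_def orthogonal_matrix_def matrix_left_right_inverse)

lemma rotations_SO3: "rot_quarter \<in> SO3" "rot_cyclic \<in> SO3" "rot_xy (4/5) \<in> SO3" "rot_xy (- (4/5)) \<in> SO3"
  "rot_xz \<in> SO3"
  by (rule SO3I; simp add: rot_quarter_def rot_cyclic_def rot_xy_def rot_xz_def vec_eq_iff forall_3
      matrix_matrix_mult_def transpose_def mat_def sum_3 det_3)+

lemmas turn_nth = turn_def coords_nth tact_sum sum_3 S_tensor_values S_tensor_all vector_3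
  rot_quarter_def rot_cyclic_def rot_xy_def rot_xz_def

lemma turn_quarter:
  "turn rot_quarter u $ 1 = u$4 + u$6" "turn rot_quarter u $ 2 = - u$2" "turn rot_quarter u $ 3 = - u$6"
  "turn rot_quarter u $ 4 = - (u$1 + u$3)" "turn rot_quarter u $ 5 = - (u$5 + u$7)"
  "turn rot_quarter u $ 6 = u$3" "turn rot_quarter u $ 7 = u$7"
  by (simp_all add: turn_nth)

lemma turn_cyclic:
  "turn rot_cyclic u $ 1 = - (u$5 + u$7)" "turn rot_cyclic u $ 2 = u$2" "turn rot_cyclic u $ 3 = u$5"
  "turn rot_cyclic u $ 4 = - (u$1 + u$3)" "turn rot_cyclic u $ 5 = - (u$4 + u$6)"
  "turn rot_cyclic u $ 6 = u$1" "turn rot_cyclic u $ 7 = u$4"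
  by (simp_all add: turn_nth)

definition vec7 :: "real \<Rightarrow> real \<Rightarrow> real \<Rightarrow> real \<Rightarrow> real \<Rightarrow> real \<Rightarrow> real \<Rightarrow> real^7" where
  "vec7 a b c d e f g = (\<chi> i. if i = 1 then a else if i = 2 then b else if i = 3 then c else if i = 4 then d
     else if i = 5 then e else if i = 6 then f else g)"

lemma vec7_nth: "vec7 a b c d e f g $ 1 = a" "vec7 a b c d e f g $ 2 = b" "vec7 a b c d e f g $ 3 = c"
  "vec7 a b c d e f g $ 4 = d" "vec7 a b c d e f g $ 5 = e" "vec7 a b c d e f g $ 6 = f" "vec7 a b c d e f g $ 7 = g"
  by (simp_all add: vec7_def)

lemma turn_zonal:
  "turn rot_cyclic (vec7 0 0 0 0 (- (1/2)) 0 1) = vec7 (- (1/2)) 0 (- (1/2)) 0 0 0 0"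
  "turn rot_cyclic (vec7 (- (1/2)) 0 (- (1/2)) 0 0 0 0) = vec7 0 0 0 1 0 (- (1/2)) 0"
  "turn (rot_xy (4/5)) (vec7 (- (1/2)) 0 (- (1/2)) 0 0 0 0) = vec7 (33/50) 0 (- (3/10)) (2/25) 0 (- (2/5)) 0"
  "turn (rot_xy (- (4/5))) (vec7 (- (1/2)) 0 (- (1/2)) 0 0 0 0) = vec7 (33/50) 0 (- (3/10)) (- (2/25)) 0 (2/5) 0"
  "turn rot_xz (vec7 (- (1/2)) 0 (- (1/2)) 0 0 0 0) = vec7 (- (3/10)) 0 (33/50) 0 (- (2/5)) 0 (2/25)"
  "turn (rot_xy (4/5)) (vec7 0 0 0 0 1 0 0) = vec7 0 (24/25) 0 0 (- (7/25)) 0 0"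
  unfolding vec_eq_iff forall_7 turn_cyclic by (simp_all add: turn_nth vec7_nth)

text \<open>A symmetric trilinear form is determined by its values S(n, n, n), and the seventh
  coordinate after turning by h is this value at the third row of h.\<close>

lemma cubic_nonzero_direction:
  assumes "u \<noteq> 0"
  obtains h where "h \<in> SO3" "turn h u $ 7 \<noteq> 0"
proof -
  let ?f = "\<lambda>n. trilin (S_tensor u) n n n"
  have "\<exists>n. ?f n \<noteq> 0"
  proof (rule ccontr)
    assume "\<not> ?thesis"
    then have "?f (vector [x, y, z]) = 0" for x y z by blast
    then have p: "- (u$1 + u$3) * x^3 + u$4 * y^3 + u$7 * z^3 - 3 * (u$4 + u$6) * x\<^sup>2 * y - 3 * (u$5 + u$7) * x\<^sup>2 * z
       + 3 * u$1 * x * y\<^sup>2 + 3 * u$3 * x * z\<^sup>2 + 3 * u$5 * y\<^sup>2 * z + 3 * u$6 * y * z\<^sup>2 - 6 * u$2 * x * y * z = 0" for x y z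
      by (simp add: trilin_def sum_3 S_tensor_values S_tensor_all power2_eq_square power3_eq_cube algebra_simps)
    have "u$7 = 0" "u$4 = 0" using p[of 0 0 1] p[of 0 1 0] by simp_all
    moreover have "u$5 = 0" "u$6 = 0" "u$1 = 0" "u$3 = 0"
      using p[of 0 1 1] p[of 0 1 "-1"] p[of 1 1 0] p[of 1 "-1" 0] p[of 1 0 1] p[of 1 0 "-1"] calculation by simp_all
    moreover have "u$2 = 0" using p[of 1 1 1] calculation by simp
    ultimately have "u = 0" by (simp add: vec_eq_iff forall_7)
    then show False using assms by simp
  qed
  then obtain n where n: "?f n \<noteq> 0" by blast
  then have "n \<noteq> 0" by (auto simp: trilin_def)
  define m where "m = (1 / norm n) *\<^sub>R n"
  have m: "norm m = 1" "?f m \<noteq> 0" using n \<open>n \<noteq> 0\<close> by (simp_all add: m_def trilin_simps)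
  obtain A :: "real^3^3" where A: "rotation_matrix A" "A *v axis 3 1 = m"
    using rotation_matrix_exists_basis[OF _ m(1)] by auto
  have "transpose A $ 3 = m"
    using A(2) by (simp add: matrix_vector_mult_basis column_def transpose_def)
  then have "turn (transpose A) u $ 7 \<noteq> 0" using m(2) by (simp add: turn_def coords_nth tact_trilin)
  moreover have "transpose A \<in> SO3" using A(1) by (simp add: SO3_def rotation_matrix_def det_transpose)
  ultimately show thesis using that by blast
qed

text \<open>Averaging over the quarter turns about the third axis produces a zonal form, whose rotations span.\<close>

lemma turn_irreducible:
  assumes U: "subspace U" and inv: "\<And>h u. h \<in> SO3 \<Longrightarrow> u \<in> U \<Longrightarrow> turn h u \<in> U" and nz: "u \<in> U" "u \<noteq> 0"
  shows "U = UNIV"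
proof -
  obtain h where h: "h \<in> SO3" "turn h u $ 7 \<noteq> 0" using cubic_nonzero_direction[OF nz(2)] .
  define v where "v = turn h u"
  have v: "v \<in> U" "v $ 7 \<noteq> 0" using inv[OF h(1) nz(1)] h(2) by (simp_all add: v_def)
  let ?q = "turn rot_quarter"
  note add = subspace_add[OF U] and scale = subspace_scale[OF U]
  have q: "?q w \<in> U" if "w \<in> U" for w using inv[OF rotations_SO3(1) that] .
  \<comment> \<open>Under rotations about the third axis cubic forms have weights of absolute value
    at most 3, so the average over quarter turns retains only weight 0, which for traceless forms is
    the zonal line.\<close>
  have "(1 / (4 * v $ 7)) *\<^sub>R (v + ?q v + ?q (?q v) + ?q (?q (?q v))) \<in> U"
    by (intro add scale q v)
  also have "(1 / (4 * v $ 7)) *\<^sub>R (v + ?q v + ?q (?q v) + ?q (?q (?q v))) = vec7 0 0 0 0 (- (1/2)) 0 1"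
    using v(2) unfolding vec_eq_iff forall_7 by (simp add: turn_quarter vec7_nth field_simps)
  finally have zz: "vec7 0 0 0 0 (- (1/2)) 0 1 \<in> U" .
  have zx: "vec7 (- (1/2)) 0 (- (1/2)) 0 0 0 0 \<in> U"
    using inv[OF rotations_SO3(2) zz] by (simp add: turn_zonal)
  have zy: "vec7 0 0 0 1 0 (- (1/2)) 0 \<in> U"
    using inv[OF rotations_SO3(2) zx] by (simp add: turn_zonal)
  have a: "vec7 (33/50) 0 (- (3/10)) (2/25) 0 (- (2/5)) 0 \<in> U"
    using inv[OF rotations_SO3(3) zx] by (simp add: turn_zonal)
  have b: "vec7 (33/50) 0 (- (3/10)) (- (2/25)) 0 (2/5) 0 \<in> U"
    using inv[OF rotations_SO3(4) zx] by (simp add: turn_zonal)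
  have c: "vec7 (- (3/10)) 0 (33/50) 0 (- (2/5)) 0 (2/25) \<in> U"
    using inv[OF rotations_SO3(5) zx] by (simp add: turn_zonal)
  have comb: "w \<in> U" if "w = r *\<^sub>R x + s *\<^sub>R y" "x \<in> U" "y \<in> U" for w x y r s
    using that by (auto intro: add scale)
  \<comment> \<open>Half the sum and half the difference of rotations by opposite angles are the
    parts even and odd in the second coordinate.\<close>
  have ev: "vec7 (33/50) 0 (- (3/10)) 0 0 0 0 \<in> U"
    by (rule comb[of _ "1/2" _ "1/2", OF _ a b]) (simp add: vec_eq_iff forall_7 vec7_nth)
  have od: "vec7 0 0 0 (2/25) 0 (- (2/5)) 0 \<in> U"
    by (rule comb[of _ "1/2" _ "- (1/2)", OF _ a b]) (simp add: vec_eq_iff forall_7 vec7_nth)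
  have e1: "vec7 1 0 0 0 0 0 0 \<in> U"
    by (rule comb[of _ "25/24" _ "- (5/8)", OF _ ev zx]) (simp add: vec_eq_iff forall_7 vec7_nth)
  have e3: "vec7 0 0 1 0 0 0 0 \<in> U"
    by (rule comb[of _ "- 2" _ "- 1", OF _ zx e1]) (simp add: vec_eq_iff forall_7 vec7_nth)
  have e4: "vec7 0 0 0 1 0 0 0 \<in> U"
    by (rule comb[of _ "- (25/18)" _ "10/9", OF _ od zy]) (simp add: vec_eq_iff forall_7 vec7_nth)
  have e6: "vec7 0 0 0 0 0 1 0 \<in> U"
    by (rule comb[of _ "- 2" _ "2", OF _ zy e4]) (simp add: vec_eq_iff forall_7 vec7_nth)
  have c1: "vec7 0 0 (33/50) 0 (- (2/5)) 0 (2/25) \<in> U"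
    by (rule comb[of _ "1" _ "3/10", OF _ c e1]) (simp add: vec_eq_iff forall_7 vec7_nth)
  have c2: "vec7 0 0 0 0 (- (2/5)) 0 (2/25) \<in> U"
    by (rule comb[of _ "1" _ "- (33/50)", OF _ c1 e3]) (simp add: vec_eq_iff forall_7 vec7_nth)
  have e5: "vec7 0 0 0 0 1 0 0 \<in> U"
    by (rule comb[of _ "- (25/9)" _ "2/9", OF _ c2 zz]) (simp add: vec_eq_iff forall_7 vec7_nth)
  have e7: "vec7 0 0 0 0 0 0 1 \<in> U"
    by (rule comb[of _ "1" _ "1/2", OF _ zz e5]) (simp add: vec_eq_iff forall_7 vec7_nth)
  \<comment> \<open>Only the multiples of x y z are still missing. Turning 3 z (y^2 - x^2) about the
    third axis produces them; 24/25 and - 7/25 are sine and cosine of the double angle.\<close>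
  have d: "vec7 0 (24/25) 0 0 (- (7/25)) 0 0 \<in> U"
    using inv[OF rotations_SO3(3) e5] by (simp add: turn_zonal)
  have e2: "vec7 0 1 0 0 0 0 0 \<in> U"
    by (rule comb[of _ "25/24" _ "7/24", OF _ d e5]) (simp add: vec_eq_iff forall_7 vec7_nth)
  have "w \<in> U" for w
  proof -
    have "(w$1) *\<^sub>R vec7 1 0 0 0 0 0 0 + (w$2) *\<^sub>R vec7 0 1 0 0 0 0 0 + (w$3) *\<^sub>R vec7 0 0 1 0 0 0 0
      + (w$4) *\<^sub>R vec7 0 0 0 1 0 0 0 + (w$5) *\<^sub>R vec7 0 0 0 0 1 0 0 + (w$6) *\<^sub>R vec7 0 0 0 0 0 1 0
      + (w$7) *\<^sub>R vec7 0 0 0 0 0 0 1 \<in> U"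
      by (intro add scale e1 e2 e3 e4 e5 e6 e7)
    also have "(w$1) *\<^sub>R vec7 1 0 0 0 0 0 0 + (w$2) *\<^sub>R vec7 0 1 0 0 0 0 0 + (w$3) *\<^sub>R vec7 0 0 1 0 0 0 0
      + (w$4) *\<^sub>R vec7 0 0 0 1 0 0 0 + (w$5) *\<^sub>R vec7 0 0 0 0 1 0 0 + (w$6) *\<^sub>R vec7 0 0 0 0 0 1 0
      + (w$7) *\<^sub>R vec7 0 0 0 0 0 0 1 = w"
      by (simp add: vec_eq_iff forall_7 vec7_nth)
    finally show ?thesis .
  qed
  then show ?thesis by blast
qed

lemma one_SO3: "mat 1 \<in> SO3"
  by (simp add: SO3_def rotation_matrix_def orthogonal_matrix_id)

lemma is_V06_cubic_forms: "is_V06 (range cubic_forms)"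
  unfolding is_V06_def
proof (intro conjI ballI allI impI)
  show "subspace (range cubic_forms)"
    by (rule linear_subspace_image[OF linear_cubic_forms subspace_UNIV])
  show "range cubic_forms \<subseteq> Lambda3"
    by (auto simp: cubic_forms_def intro: tensor33_Lambda3 symmetric_S_tensor)
  show "act3 (rho hL hR) ` range cubic_forms \<subseteq> range cubic_forms" if "hL \<in> SO3" "hR \<in> SO3" for hL hR
    by (auto simp: act3_cubic_forms[OF that])
  show "act3 (rho (mat 1) hR) T = T" if h: "hR \<in> SO3" and T: "T \<in> range cubic_forms" for hR T
  proof -
    obtain u where u: "T = cubic_forms u" using T by blast
    have "turn (mat 1) u = u" by (simp add: turn_def tact_one coords_S_tensor)
    then show ?thesis unfolding u by (simp add: act3_cubic_forms[OF one_SO3 h])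
  qed
  have "dim (cubic_forms ` UNIV) = dim (UNIV :: (real^7) set)"
    by (rule dim_image_eq[OF linear_cubic_forms]) (simp add: inj_cubic_forms)
  then show "dim (range cubic_forms) = 7" by simp
  fix W
  assume W: "subspace W \<and> W \<subseteq> range cubic_forms \<and> (\<forall>hL\<in>SO3. act3 (rho hL (mat 1)) ` W \<subseteq> W)"
  show "W = {0} \<or> W = range cubic_forms"
  proof (cases "W = {0}")
    case False
    define U where "U = {u. cubic_forms u \<in> W}"
    have "subspace U"
      using W linear_cubic_forms unfolding U_def
      by (simp add: subspace_def linear_add linear_scale linear_0)
    moreover have "turn h u \<in> U" if "h \<in> SO3" "u \<in> U" for h u
      using W that act3_cubic_forms[OF that(1) one_SO3, of u] by (fastforce simp: U_def)
    moreover have "0 \<in> W" using W subspace_0 by blast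
    then obtain T where T: "T \<in> W" "T \<noteq> 0" using False by blast
    then obtain u where u: "T = cubic_forms u" using W by blast
    have "u \<in> U" "u \<noteq> 0" using T u by (auto simp: U_def linear_0[OF linear_cubic_forms])
    ultimately have "U = UNIV" by (rule turn_irreducible)
    then show ?thesis using W by (auto simp: U_def)
  qed simp
qed

section \<open>The local Lie group\<close>

lemma exhaust_12:
  "x = 1 \<or> x = 2 \<or> x = 3 \<or> x = 4 \<or> x = 5 \<or> x = 6 \<or> x = 7 \<or> x = 8 \<or> x = 9 \<or> x = 10 \<or> x = 11 \<or> x = 12" for x :: 12
proof (induct x)
  case (of_int z)
  then have "0 \<le> z" "z < 12" by simp_all
  then have "z = 0 \<or> z = 1 \<or> z = 2 \<or> z = 3 \<or> z = 4 \<or> z = 5 \<or> z = 6 \<or> z = 7 \<or> z = 8 \<or> z = 9 \<or> z = 10 \<or> z = 11"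
    by arith
  then show ?case by auto
qed

lemma UNIV_12: "(UNIV :: 12 set) = {1, 2, 3, 4, 5, 6, 7, 8, 9, 10, 11, 12}"
  using exhaust_12 by auto

lemma sum_12: "sum f (UNIV :: 12 set)
    = f 1 + f 2 + f 3 + f 4 + f 5 + f 6 + f 7 + f 8 + f 9 + f 10 + f 11 + f 12"
  unfolding UNIV_12 by (simp add: add.assoc)

lemma forall_12: "(\<forall>i::12. P i) \<longleftrightarrow>
    P 1 \<and> P 2 \<and> P 3 \<and> P 4 \<and> P 5 \<and> P 6 \<and> P 7 \<and> P 8 \<and> P 9 \<and> P 10 \<and> P 11 \<and> P 12"
  by (metis exhaust_12)

definition p12 :: "real^12 \<Rightarrow> real^9" where
  "p12 a = (\<chi> i. if i = 1 then a$1 else if i = 2 then a$2 else if i = 3 then a$3 else if i = 4 then a$4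
    else if i = 5 then a$5 else if i = 6 then a$6 else if i = 7 then a$7 else if i = 8 then a$8 else a$9)"

definition q12 :: "real^12 \<Rightarrow> real^3" where
  "q12 a = vector [a$10, a$11, a$12]"

definition j12 :: "real^9 \<Rightarrow> real^3 \<Rightarrow> real^12" where
  "j12 m h = (\<chi> i. if i = 1 then m$1 else if i = 2 then m$2 else if i = 3 then m$3 else if i = 4 then m$4
    else if i = 5 then m$5 else if i = 6 then m$6 else if i = 7 then m$7 else if i = 8 then m$8
    else if i = 9 then m$9 else if i = 10 then h$1 else if i = 11 then h$2 else h$3)"

lemma p12_nth: "p12 a $ 1 = a$1" "p12 a $ 2 = a$2" "p12 a $ 3 = a$3" "p12 a $ 4 = a$4" "p12 a $ 5 = a$5"
  "p12 a $ 6 = a$6" "p12 a $ 7 = a$7" "p12 a $ 8 = a$8" "p12 a $ 9 = a$9"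
  by (simp_all add: p12_def)

lemma q12_nth: "q12 a $ 1 = a$10" "q12 a $ 2 = a$11" "q12 a $ 3 = a$12"
  by (simp_all add: q12_def)

lemma j12_nth: "j12 m h $ 1 = m$1" "j12 m h $ 2 = m$2" "j12 m h $ 3 = m$3" "j12 m h $ 4 = m$4" "j12 m h $ 5 = m$5"
  "j12 m h $ 6 = m$6" "j12 m h $ 7 = m$7" "j12 m h $ 8 = m$8" "j12 m h $ 9 = m$9"
  "j12 m h $ 10 = h$1" "j12 m h $ 11 = h$2" "j12 m h $ 12 = h$3"
  by (simp_all add: j12_def)

lemma p12_j12 [simp]: "p12 (j12 m h) = m"
  by (simp add: vec_eq_iff forall_9 p12_nth j12_nth)

lemma q12_j12 [simp]: "q12 (j12 m h) = h"
  by (simp add: vec_eq_iff forall_3 q12_nth j12_nth)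

lemma j12_eta [simp]: "j12 (p12 a) (q12 a) = a"
  by (simp add: vec_eq_iff forall_12 p12_nth q12_nth j12_nth)

lemma eq12_iff: "a = b \<longleftrightarrow> p12 a = p12 b \<and> q12 a = q12 b"
  by (metis j12_eta)

lemma linear_p12: "linear p12"
  by (auto simp: linear_iff vec_eq_iff forall_9 p12_nth)

lemma linear_q12: "linear q12"
  by (auto simp: linear_iff vec_eq_iff forall_3 q12_nth)

lemma linear_j12_left: "linear (\<lambda>m. j12 m 0)" and linear_j12_right: "linear (j12 0)"
  by (auto simp: linear_iff vec_eq_iff forall_12 j12_nth)

lemma j12_split: "j12 m h = j12 m 0 + j12 0 h"
  by (simp add: vec_eq_iff forall_12 j12_nth)

lemma pq12_simps [simp]:
  "p12 (a + b) = p12 a + p12 b" "p12 (c *\<^sub>R a) = c *\<^sub>R p12 a" "p12 0 = 0" "p12 (a - b) = p12 a - p12 b" "p12 (- a) = - p12 a"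
  "q12 (a + b) = q12 a + q12 b" "q12 (c *\<^sub>R a) = c *\<^sub>R q12 a" "q12 0 = 0" "q12 (a - b) = q12 a - q12 b" "q12 (- a) = - q12 a"
  "j12 0 0 = 0"
  by (simp_all add: vec_eq_iff forall_9 forall_3 forall_12 p12_nth q12_nth j12_nth)

lemma has_derivative_j12:
  assumes "(f has_derivative f') F" "(g has_derivative g') F"
  shows "((\<lambda>x. j12 (f x) (g x)) has_derivative (\<lambda>v. j12 (f' v) (g' v))) F"
proof -
  have "((\<lambda>x. j12 (f x) 0 + j12 0 (g x)) has_derivative (\<lambda>v. j12 (f' v) 0 + j12 0 (g' v))) F"
    by (intro has_derivative_add
        bounded_linear.has_derivative[OF linear_conv_bounded_linear[THEN iffD1, OF linear_j12_left] assms(1)]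
        bounded_linear.has_derivative[OF linear_conv_bounded_linear[THEN iffD1, OF linear_j12_right] assms(2)])
  then show ?thesis by (simp only: j12_split[symmetric])
qed

lemma smooth_on_j12:
  assumes "open S" "smooth_on S f" "smooth_on S g"
  shows "smooth_on S (\<lambda>x. j12 (f x) (g x))"
proof -
  have "smooth_on S (\<lambda>x. j12 (f x) 0 + j12 0 (g x))"
    using assms
    by (intro smooth_on_add smooth_on_linear[OF _ linear_j12_left] smooth_on_linear[OF _ linear_j12_right])
  then show ?thesis by (simp only: j12_split[symmetric])
qed

lemma smooth_on_p12: "open S \<Longrightarrow> smooth_on S f \<Longrightarrow> smooth_on S (\<lambda>x. p12 (f x))"
  by (rule smooth_on_linear[OF _ linear_p12])

lemma smooth_on_q12: "open S \<Longrightarrow> smooth_on S f \<Longrightarrow> smooth_on S (\<lambda>x. q12 (f x))"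
  by (rule smooth_on_linear[OF _ linear_q12])

lemma smooth_on_minus: "open S \<Longrightarrow> smooth_on S f \<Longrightarrow> smooth_on S (\<lambda>x. - f x)"
  using smooth_on_scaleR[OF _ smooth_on_const[of S "- 1"], of f] by simp

lemma smooth_on_rot:
  assumes "open S" "smooth_on S f" "smooth_on S g"
  shows "smooth_on S (\<lambda>x. rot (f x) (g x))"
proof -
  have "1 + f x \<bullet> f x \<noteq> 0" for x using denom_pos'[of "f x"] by simp
  then show ?thesis
    unfolding rot_def rot_num_def using assms
    by (intro smooth_on_add smooth_on_diff smooth_on_divide smooth_on_scaleR smooth_on_mult smooth_on_inner
        smooth_on_cross3 smooth_on_const) auto
qed

lemma smooth_on_cay_mult:
  assumes "open S" "smooth_on S f" "smooth_on S g" "\<And>x. x \<in> S \<Longrightarrow> 1 - s\<^sup>2 * (f x \<bullet> g x) \<noteq> 0"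
  shows "smooth_on S (\<lambda>x. cay_mult s (f x) (g x))"
  unfolding cay_mult_def using assms
  by (intro smooth_on_add smooth_on_diff smooth_on_divide smooth_on_scaleR smooth_on_mult smooth_on_inner
      smooth_on_cross3 smooth_on_const) auto

text \<open>The group is a semidirect product of \<open>SO(3)\<close>, acting diagonally by rotations, with the third power of the
  group with product \<open>cay_mult (2 * t)\<close>; the latter acts on itself by translations.\<close>

definition act_defined :: "real \<Rightarrow> real^12 \<Rightarrow> real^9 \<Rightarrow> bool" where
  "act_defined t a x \<longleftrightarrow> (\<forall>i. 1 - (2 * t)\<^sup>2 * (sigma (p12 a) $ i \<bullet> rot (q12 a) (sigma x $ i)) \<noteq> 0)"

definition act :: "real \<Rightarrow> real^12 \<Rightarrow> real^9 \<Rightarrow> real^9" where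
  "act t a x = mat9 (\<chi> i. cay_mult (2 * t) (sigma (p12 a) $ i) (rot (q12 a) (sigma x $ i)))"

text \<open>The coordinates reach only quaternions with nonzero real part, so products need
  nonvanishing denominators, while inversion is defined everywhere: (m, h) has the inverse (- h^(-1)
  m, h^(-1)), as in any semidirect product.\<close>

definition model_group :: "real \<Rightarrow> (real^12) local_group" where
  "model_group t = \<lparr> lcarrier = UNIV,
     mult_dom = {(a, b). act_defined t a (p12 b) \<and> 1 - q12 a \<bullet> q12 b \<noteq> 0},
     lmult = (\<lambda>a b. j12 (act t a (p12 b)) (cay_mult 1 (q12 a) (q12 b))),
     inv_dom = UNIV,
     linv = (\<lambda>a. j12 (maprows (\<lambda>i x. - rot (- q12 a) x) (p12 a)) (- q12 a)),
     lone = 0 \<rparr>"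

lemma model_group_simps [simp]:
  "lcarrier (model_group t) = UNIV" "inv_dom (model_group t) = UNIV" "lone (model_group t) = 0"
  "(a, b) \<in> mult_dom (model_group t) \<longleftrightarrow> act_defined t a (p12 b) \<and> 1 - q12 a \<bullet> q12 b \<noteq> 0"
  "lmult (model_group t) a b = j12 (act t a (p12 b)) (cay_mult 1 (q12 a) (q12 b))"
  "linv (model_group t) a = j12 (maprows (\<lambda>i x. - rot (- q12 a) x) (p12 a)) (- q12 a)"
  by (simp_all add: model_group_def)

lemma sigma_act [simp]: "sigma (act t a x) $ i = cay_mult (2 * t) (sigma (p12 a) $ i) (rot (q12 a) (sigma x $ i))"
  by (simp add: act_def)

text \<open>Rotations are automorphisms of \<open>cay_mult s\<close>, so this is associativity in
  each of the three factors.\<close>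

lemma act_mult:
  assumes "act_defined t a (p12 b)" "1 - q12 a \<bullet> q12 b \<noteq> 0" "act_defined t b x"
  shows "act t a (act t b x) = act t (lmult (model_group t) a b) x"
  unfolding sigma_eq_iff
proof
  fix i
  let ?m = "sigma (p12 a) $ i" and ?n = "sigma (p12 b) $ i" and ?x = "sigma x $ i"
  have r: "rot (cay_mult 1 (q12 a) (q12 b)) ?x = rot (q12 a) (rot (q12 b) ?x)"
    by (rule rot_mult) (use assms in simp)
  show "sigma (act t a (act t b x)) $ i = sigma (act t (lmult (model_group t) a b) x) $ i"
    using assms cay_mult_assoc(1)[of "2 * t" ?m "rot (q12 a) ?n" "rot (q12 a) (rot (q12 b) ?x)"]
    by (simp add: r rot_cay_mult act_defined_def)
qed

lemma act_defined_inverse: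
  assumes "act_defined t a x"
  shows "act_defined t (linv (model_group t) a) (act t a x)"
    and "act t (linv (model_group t) a) (act t a x) = x"
proof -
  have *: "1 - (2 * t)\<^sup>2 * (- rot (- q12 a) (sigma (p12 a) $ i) \<bullet> rot (- q12 a) (sigma (act t a x) $ i)) \<noteq> 0 \<and>
     cay_mult (2 * t) (- rot (- q12 a) (sigma (p12 a) $ i)) (rot (- q12 a) (sigma (act t a x) $ i)) = sigma x $ i" for i
  proof -
    let ?m = "sigma (p12 a) $ i" and ?y = "rot (q12 a) (sigma x $ i)"
    have d: "1 - (2 * t)\<^sup>2 * (- ?m \<bullet> ?m) \<noteq> 0" using denom_pos[of "2 * t" ?m] by simp
    have e: "1 - (2 * t)\<^sup>2 * (?m \<bullet> ?y) \<noteq> 0" using assms by (simp add: act_defined_def)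
    \<comment> \<open>The product of - m and m is 0, so in the identity between denominators one
      factor is 1 and the right-hand side is positive.\<close>
    have "(1 - (2 * t)\<^sup>2 * (- ?m \<bullet> cay_mult (2 * t) ?m ?y)) * (1 - (2 * t)\<^sup>2 * (?m \<bullet> ?y)) = 1 - (2 * t)\<^sup>2 * (- ?m \<bullet> ?m)"
      using cay_mult_assoc(2)[OF d e] by simp
    then have "1 - (2 * t)\<^sup>2 * (- ?m \<bullet> cay_mult (2 * t) ?m ?y) \<noteq> 0" using d by (metis mult_zero_left)
    moreover have "cay_mult (2 * t) (- ?m) (cay_mult (2 * t) ?m ?y) = ?y"
      using cay_mult_assoc(1)[OF d e] by simp
    then have "rot (- q12 a) (cay_mult (2 * t) (- ?m) (cay_mult (2 * t) ?m ?y)) = sigma x $ i" by simp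
    then have "cay_mult (2 * t) (- rot (- q12 a) ?m) (rot (- q12 a) (cay_mult (2 * t) ?m ?y)) = sigma x $ i"
      by (simp add: rot_cay_mult)
    ultimately show ?thesis by simp
  qed
  show "act_defined t (linv (model_group t) a) (act t a x)"
    unfolding act_defined_def using * by simp
  show "act t (linv (model_group t) a) (act t a x) = x"
    unfolding sigma_eq_iff using * by simp
qed

lemma linv_linv: "linv (model_group t) (linv (model_group t) a) = a"
  by (simp add: eq12_iff sigma_eq_iff)

lemma open_Collect_neq_zero:
  fixes f g :: "'a::topological_space \<Rightarrow> real"
  assumes "continuous_on UNIV f" shows "open {x. f x \<noteq> 0}"
  using open_Collect_neq[OF assms continuous_on_const[of UNIV 0]] by simp

lemma smooth_imp_continuous: "smooth_on S f \<Longrightarrow> continuous_on S f"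
  unfolding smooth_on_def by (metis Ck_on.simps(1))

lemma open_act_defined:
  fixes f :: "'a::real_normed_vector \<Rightarrow> real^12" and g :: "'a \<Rightarrow> real^9"
  assumes "smooth_on UNIV f" "smooth_on UNIV g"
  shows "open {z. act_defined t (f z) (g z)}"
proof -
  have "open {z. 1 - (2 * t)\<^sup>2 * (sigma (p12 (f z)) $ i \<bullet> rot (q12 (f z)) (sigma (g z) $ i)) \<noteq> 0}" for i
    by (intro open_Collect_neq_zero smooth_imp_continuous smooth_on_diff smooth_on_const smooth_on_mult smooth_on_inner
        smooth_on_rot smooth_on_sigma_row smooth_on_p12 smooth_on_q12 assms open_UNIV)
  then show ?thesis unfolding act_defined_def by (simp add: forall_3 open_Collect_conj)
qed

lemma smooth_on_act:
  assumes "open S" "smooth_on S f" "smooth_on S g" "\<And>z. z \<in> S \<Longrightarrow> act_defined t (f z) (g z)"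
  shows "smooth_on S (\<lambda>z. act t (f z) (g z))"
  unfolding act_def using assms
  by (intro smooth_on_mat9 smooth_on_cay_mult smooth_on_rot smooth_on_sigma_row smooth_on_p12 smooth_on_q12)
    (auto simp: act_defined_def)

lemma smooth_on_fst_snd:
  fixes S :: "('a::euclidean_space \<times> 'b::euclidean_space) set"
  assumes "open S"
  shows "smooth_on S fst" "smooth_on S snd"
  using smooth_on_linear[OF assms linear_fst smooth_on_ident[OF assms]]
    smooth_on_linear[OF assms linear_snd smooth_on_ident[OF assms]] by simp_all

lemma open_mult_dom: "open (mult_dom (model_group t))"
proof -
  note f = smooth_on_fst_snd(1)[OF open_UNIV] and s = smooth_on_fst_snd(2)[OF open_UNIV]
  have "mult_dom (model_group t) = {z. act_defined t (fst z) (p12 (snd z)) \<and> 1 - q12 (fst z) \<bullet> q12 (snd z) \<noteq> 0}"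
    by (auto simp del: model_group_simps simp: model_group_def)
  moreover have "open {z. act_defined t (fst z) (p12 (snd z)) \<and> 1 - q12 (fst z) \<bullet> q12 (snd z) \<noteq> 0}"
    by (intro open_Collect_conj open_act_defined open_Collect_neq_zero smooth_imp_continuous smooth_on_diff
        smooth_on_const smooth_on_inner smooth_on_p12 smooth_on_q12 f s open_UNIV)
  ultimately show ?thesis by simp
qed

lemma act_zero_left [simp]: "act t 0 x = x"
  by (simp add: sigma_eq_iff)

lemma act_zero_right [simp]: "act t a 0 = p12 a"
  by (simp add: sigma_eq_iff)

lemma local_lie_group_model: "local_lie_group (model_group t)"
  unfolding local_lie_group_def
proof (intro conjI)
  let ?G = "model_group t"
  show "open (mult_dom ?G)" by (rule open_mult_dom)
  show "smooth_on (mult_dom ?G) (\<lambda>(a, b). lmult ?G a b)"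
    unfolding case_prod_beta model_group_simps
    by (intro smooth_on_j12 smooth_on_act smooth_on_cay_mult smooth_on_p12 smooth_on_q12 smooth_on_fst_snd open_mult_dom)
      (auto)
  show "smooth_on (inv_dom ?G) (linv ?G)"
    unfolding model_group_simps(2) model_group_simps(6)[abs_def] maprows_def
    by (intro smooth_on_j12 smooth_on_mat9 smooth_on_minus smooth_on_rot smooth_on_sigma_row smooth_on_p12 smooth_on_q12
        smooth_on_ident open_UNIV)
  show "\<forall>a b c. (a, b) \<in> mult_dom ?G \<and> (b, c) \<in> mult_dom ?G \<and> (lmult ?G a b, c) \<in> mult_dom ?G \<and>
      (a, lmult ?G b c) \<in> mult_dom ?G \<longrightarrow> lmult ?G (lmult ?G a b) c = lmult ?G a (lmult ?G b c)"
  proof (intro allI impI)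
    fix a b c
    assume "(a, b) \<in> mult_dom ?G \<and> (b, c) \<in> mult_dom ?G \<and> (lmult ?G a b, c) \<in> mult_dom ?G \<and> (a, lmult ?G b c) \<in> mult_dom ?G"
    then have "act t a (act t b (p12 c)) = act t (lmult ?G a b) (p12 c)"
      "cay_mult 1 (cay_mult 1 (q12 a) (q12 b)) (q12 c) = cay_mult 1 (q12 a) (cay_mult 1 (q12 b) (q12 c))"
      by (intro act_mult cay_mult_assoc; simp)+
    then show "lmult ?G (lmult ?G a b) c = lmult ?G a (lmult ?G b c)"
      by (simp add: eq12_iff)
  qed
  show "\<forall>a\<in>inv_dom ?G. (a, linv ?G a) \<in> mult_dom ?G \<and> (linv ?G a, a) \<in> mult_dom ?G \<and>
      lmult ?G a (linv ?G a) = lone ?G \<and> lmult ?G (linv ?G a) a = lone ?G"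
  proof
    fix a
    have 1: "1 + (2 * t)\<^sup>2 * (x \<bullet> x) \<noteq> 0" for x :: "real^3" using denom_pos[of "2 * t" x] by simp
    have 2: "1 + x \<bullet> x \<noteq> 0" for x :: "real^3" using denom_pos'[of x] by simp
    show "(a, linv ?G a) \<in> mult_dom ?G \<and> (linv ?G a, a) \<in> mult_dom ?G \<and>
      lmult ?G a (linv ?G a) = lone ?G \<and> lmult ?G (linv ?G a) a = lone ?G"
      using 1 2 by (simp add: act_defined_def eq12_iff sigma_eq_iff)
  qed
qed (auto simp: act_defined_def eq12_iff)

section \<open>Invariance of the structure tensors\<close>

text \<open>The action of SO(3)_L: it moves only the cubic S and leaves the other structure tensors
  in place.\<close>

definition rotl :: "real^3^3 \<Rightarrow> real^9 \<Rightarrow> real^9" where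
  "rotl Q X = mat9 (Q ** sigma X)"

lemma sigma_rotl: "sigma (rotl Q X) $ a = (\<Sum>i\<in>UNIV. Q$a$i *\<^sub>R sigma X $ i)"
  by (simp add: rotl_def matrix_matrix_mult_def vec_eq_iff)

lemma linear_rotl: "linear (rotl Q)"
  by (rule linearI; simp add: sigma_eq_iff sigma_rotl sum_3 algebra_simps)

lemma rotl_rotl: "rotl P (rotl Q X) = rotl (P ** Q) X"
  by (simp add: rotl_def matrix_mul_assoc)

lemma rotl_one: "rotl (mat 1) X = X"
  by (simp add: rotl_def)

lemma tact_contract:
  assumes Q: "orthogonal_matrix Q"
  shows "(\<Sum>b\<in>UNIV. \<Sum>c\<in>UNIV. act_cubic Q S a b c * ((\<Sum>j\<in>UNIV. Q$b$j * y j) * (\<Sum>l\<in>UNIV. Q$c$l * z l)))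
    = (\<Sum>i\<in>UNIV. Q$a$i * (\<Sum>j\<in>UNIV. \<Sum>l\<in>UNIV. S i j l * (y j * z l)))"
proof -
  let ?R = "slot1 Q S"
  have "(\<Sum>b\<in>UNIV. \<Sum>c\<in>UNIV. act_cubic Q S a b c * ((\<Sum>j\<in>UNIV. Q$b$j * y j) * (\<Sum>l\<in>UNIV. Q$c$l * z l)))
      = (\<Sum>b\<in>UNIV. (\<Sum>j\<in>UNIV. Q$b$j * y j) * (\<Sum>c\<in>UNIV. slot3 Q (slot2 Q ?R) a b c * (\<Sum>l\<in>UNIV. Q$c$l * z l)))"
    by (simp add: act_cubic_def slot_commute sum_distrib_left mult_ac)
  also have "\<dots> = (\<Sum>b\<in>UNIV. (\<Sum>j\<in>UNIV. Q$b$j * y j) * (\<Sum>l\<in>UNIV. slot2 Q ?R a b l * z l))"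
    unfolding slot3_def orthogonal_columns_sum[OF Q] ..
  also have "\<dots> = (\<Sum>l\<in>UNIV. z l * (\<Sum>b\<in>UNIV. slot2 Q ?R a b l * (\<Sum>j\<in>UNIV. Q$b$j * y j)))"
    by (simp add: sum_3 algebra_simps)
  also have "\<dots> = (\<Sum>l\<in>UNIV. z l * (\<Sum>j\<in>UNIV. ?R a j l * y j))"
    unfolding slot2_def orthogonal_columns_sum[OF Q] ..
  also have "\<dots> = (\<Sum>i\<in>UNIV. Q$a$i * (\<Sum>j\<in>UNIV. \<Sum>l\<in>UNIV. S i j l * (y j * z l)))"
    unfolding slot1_def by (simp add: sum_3 algebra_simps)
  finally show ?thesis .
qed

text \<open>In both arguments the orthogonal matrix is contracted away, which leaves one copy for
  the free row index. Each component of a cross product is a difference of two such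
  contractions.\<close>

lemma Tvec_tact:
  assumes Q: "orthogonal_matrix Q"
  shows "Tvec (act_cubic Q S) (rotl Q X) (rotl Q Y) = rotl Q (Tvec S X Y)"
proof -
  have "sigma (Tvec (act_cubic Q S) (rotl Q X) (rotl Q Y)) $ a $ m = sigma (rotl Q (Tvec S X Y)) $ a $ m" for a m
  proof -
    let ?y = "\<lambda>p j. sigma X $ j $ p" and ?z = "\<lambda>p j. sigma Y $ j $ p"
    define D where "D p q = (\<Sum>b\<in>UNIV. \<Sum>c\<in>UNIV. act_cubic Q S a b c *
      ((\<Sum>j\<in>UNIV. Q$b$j * ?y p j) * (\<Sum>l\<in>UNIV. Q$c$l * ?z q l)))" for p q
    have D: "D p q = (\<Sum>i\<in>UNIV. Q$a$i * (\<Sum>j\<in>UNIV. \<Sum>l\<in>UNIV. S i j l * (?y p j * ?z q l)))" for p q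
      unfolding D_def by (rule tact_contract[OF Q])
    have l: "sigma (Tvec (act_cubic Q S) (rotl Q X) (rotl Q Y)) $ a $ 1 = D 2 3 - D 3 2"
      "sigma (Tvec (act_cubic Q S) (rotl Q X) (rotl Q Y)) $ a $ 2 = D 3 1 - D 1 3"
      "sigma (Tvec (act_cubic Q S) (rotl Q X) (rotl Q Y)) $ a $ 3 = D 1 2 - D 2 1"
      by (simp_all add: Tvec_def D_def sigma_rotl cross_components right_diff_distrib sum_subtractf mult_ac)
    have r: "sigma (rotl Q (Tvec S X Y)) $ a $ 1 = D 2 3 - D 3 2"
      "sigma (rotl Q (Tvec S X Y)) $ a $ 2 = D 3 1 - D 1 3"
      "sigma (rotl Q (Tvec S X Y)) $ a $ 3 = D 1 2 - D 2 1"
      by (simp_all add: D Tvec_def sigma_rotl cross_components right_diff_distrib sum_subtractf mult_ac)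
    show ?thesis using exhaust_3[of m] l r by auto
  qed
  then show ?thesis by (simp add: sigma_eq_iff vec_eq_iff)
qed

definition cross_rows :: "real^9 \<Rightarrow> real^9 \<Rightarrow> real^3" where
  "cross_rows X Y = (\<Sum>r\<in>UNIV. cross3 (sigma X $ r) (sigma Y $ r))"

lemma cross_rows_rotl:
  assumes Q: "orthogonal_matrix Q"
  shows "cross_rows (rotl Q X) (rotl Q Y) = cross_rows X Y"
proof -
  have "(\<Sum>a\<in>UNIV. sigma (rotl Q X) $ a $ p * sigma (rotl Q Y) $ a $ q) = (\<Sum>i\<in>UNIV. sigma X $ i $ p * sigma Y $ i $ q)" for X Y p q
    using orthogonal_columns_sum[OF Q, of "\<lambda>i. sigma X $ i $ p" "\<lambda>i. sigma Y $ i $ q"] by (simp add: sigma_rotl)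
  then show ?thesis
    by (simp add: cross_rows_def vec_eq_iff forall_3 cross_components sum_subtractf)
qed

lemma inner_rotl:
  assumes Q: "orthogonal_matrix Q"
  shows "rotl Q X \<bullet> rotl Q Y = X \<bullet> Y"
proof -
  have "(\<Sum>a\<in>UNIV. sigma (rotl Q X) $ a $ p * sigma (rotl Q Y) $ a $ q) = (\<Sum>i\<in>UNIV. sigma X $ i $ p * sigma Y $ i $ q)" for p q
    using orthogonal_columns_sum[OF Q, of "\<lambda>i. sigma X $ i $ p" "\<lambda>i. sigma Y $ i $ q"] by (simp add: sigma_rotl)
  then show ?thesis
    unfolding inner_sigma inner_3 sum.distrib by simp
qed

lemma kappa0_cross_rows: "kappa0 A a b = - hat3 (cross_rows a b) $ A"
  unfolding kappa0_cross cross_rows_def ..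

lemma det_rows: "det (vector [x, y, z] :: real^3^3) = x \<bullet> cross3 y z"
  by (rule dot_cross_det[symmetric])

lemma det_cross3: "det A = A $ 1 \<bullet> cross3 (A $ 2) (A $ 3)" for A :: "real^3^3"
  by (simp add: det_3 inner_3 cross_components algebra_simps)

text \<open>Reduces invariance of the trilinear form to invariance of the determinant.\<close>

lemma Upsilon0_polarised:
  "6 * Upsilon0 a b c = det (sigma (a + b + c)) - det (sigma (a + b)) - det (sigma (b + c)) - det (sigma (a + c))
    + det (sigma a) + det (sigma b) + det (sigma c)"
  unfolding Upsilon0_def Let_def det_rows det_cross3 sigma_simps vector_add_component
  by (simp add: cross_add_left cross_add_right inner_add_left inner_add_right)

lemma Upsilon0_rotl:
  assumes "det Q = 1" shows "Upsilon0 (rotl Q a) (rotl Q b) (rotl Q c) = Upsilon0 a b c"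
proof -
  have d: "det (sigma (rotl Q x)) = det (sigma x)" for x by (simp add: rotl_def det_mul assms)
  have "6 * Upsilon0 (rotl Q a) (rotl Q b) (rotl Q c) = 6 * Upsilon0 a b c"
    unfolding Upsilon0_polarised linear_add[OF linear_rotl, symmetric] d ..
  then show ?thesis by simp
qed

lemma Upsilon0_rot:
  "Upsilon0 (maprows (\<lambda>i. rot h) a) (maprows (\<lambda>i. rot h) b) (maprows (\<lambda>i. rot h) c) = Upsilon0 a b c"
  unfolding Upsilon0_def Let_def det_rows by (simp add: rot_cross)

lemma inner_rot: "maprows (\<lambda>i. rot h) a \<bullet> maprows (\<lambda>i. rot h) b = a \<bullet> b"
  by (simp add: inner_sigma)

lemma cross_rows_rot: "cross_rows (maprows (\<lambda>i. rot h) a) (maprows (\<lambda>i. rot h) b) = rot h (cross_rows a b)"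
  by (simp add: cross_rows_def rot_cross linear_sum[OF linear_rot])

lemma wedge_4: "wedge [\<alpha>, \<beta>, \<gamma>, \<delta>] [x, y, z, w] =
    (\<alpha> x * \<beta> y - \<alpha> y * \<beta> x) * (\<gamma> z * \<delta> w - \<gamma> w * \<delta> z) - (\<alpha> x * \<beta> z - \<alpha> z * \<beta> x) * (\<gamma> y * \<delta> w - \<gamma> w * \<delta> y)
  + (\<alpha> x * \<beta> w - \<alpha> w * \<beta> x) * (\<gamma> y * \<delta> z - \<gamma> z * \<delta> y) + (\<alpha> y * \<beta> z - \<alpha> z * \<beta> y) * (\<gamma> x * \<delta> w - \<gamma> w * \<delta> x)
  - (\<alpha> y * \<beta> w - \<alpha> w * \<beta> y) * (\<gamma> x * \<delta> z - \<gamma> z * \<delta> x) + (\<alpha> z * \<beta> w - \<alpha> w * \<beta> z) * (\<gamma> x * \<delta> y - \<gamma> y * \<delta> x)"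
proof -
  have f1: "finite {1::nat, 2, 3}" "0 \<notin> {1::nat, 2, 3}" by auto
  have f2: "finite {2::nat, 3}" "1 \<notin> {2::nat, 3}" by auto
  have f3: "finite {3::nat}" "2 \<notin> {3::nat}" by auto
  have U: "{..<length [\<alpha>, \<beta>, \<gamma>, \<delta>]} = {0, 1, 2, 3::nat}" by auto
  show ?thesis
    unfolding wedge_def U sum_over_permutations_insert[OF f1] sum_over_permutations_insert[OF f2]
      sum_over_permutations_insert[OF f3]
    by (simp add: permutes_sing sign_swap_id permutation_swap_id sign_compose sign_id permutation_compose
        transpose_def algebra_simps)
qed

text \<open>The four-form is half the sum of the squares of the three \<open>kappa0\<close> forms,
  so its invariance under both rotation groups follows from the behaviour of
  \<open>cross_rows\<close>.\<close>

lemma omega0_cross_rows: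
  "omega0 a b c d = cross_rows a b \<bullet> cross_rows c d - cross_rows a c \<bullet> cross_rows b d + cross_rows a d \<bullet> cross_rows b c"
  unfolding omega0_def th_def list.map wedge_4 sum_list.Cons sum_list.Nil cross_rows_def sum_3 inner_3
    vector_add_component cross_components sigma_nth
  by algebra

lemma omega0_rotl:
  "orthogonal_matrix Q \<Longrightarrow> omega0 (rotl Q a) (rotl Q b) (rotl Q c) (rotl Q d) = omega0 a b c d"
  by (simp add: omega0_cross_rows cross_rows_rotl)

lemma omega0_rot:
  "omega0 (maprows (\<lambda>i. rot h) a) (maprows (\<lambda>i. rot h) b) (maprows (\<lambda>i. rot h) c) (maprows (\<lambda>i. rot h) d) = omega0 a b c d"
  by (simp add: omega0_cross_rows cross_rows_rot)

lemma sum_rows_rot: "sum_rows (maprows (\<lambda>i. rot h) X) = rot h (sum_rows X)"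
  by (simp add: sum_rows_def)

lemma tetra_rot: "tetra (maprows (\<lambda>i. rot h) X) = maprows (\<lambda>i. rot h) (tetra X)"
  by (simp add: sigma_eq_iff tetra_def sum_rows_rot)

lemma Tvec_std_rot:
  "Tvec (std_cubic t) (maprows (\<lambda>i. rot h) X) (maprows (\<lambda>i. rot h) Y) = maprows (\<lambda>i. rot h) (Tvec (std_cubic t) X Y)"
  unfolding sigma_eq_iff forall_3 by (simp add: Tvec_std rot_cross)

lemma Tvec_swap: "Tvec (std_cubic t) Y X = - Tvec (std_cubic t) X Y"
  unfolding sigma_eq_iff forall_3
  by (simp add: Tvec_std cross_skew[of "sigma Y $ _" "sigma X $ _"] scaleR_add_right scaleR_diff_right)

section \<open>The geometry on the model\<close>

lemma frechet_model_theta: "frechet_derivative (\<lambda>y. model_theta t y w) (at x) u = model_theta' t x u w"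
  using frechet_derivative_at[OF has_derivative_model_theta, symmetric] by simp

lemma model_structure:
  "model_theta' t x v w - model_theta' t x w v =
     maprows (\<lambda>i y. t *\<^sub>R cross3 (sum_rows (model_theta t x v)) y) (model_theta t x w)
   - maprows (\<lambda>i y. t *\<^sub>R cross3 (sum_rows (model_theta t x w)) y) (model_theta t x v)
   + Tvec (std_cubic t) (model_theta t x v) (model_theta t x w)"
proof -
  define T where "T = Tvec (std_cubic t) (model_theta t x v) (model_theta t x w)"
  show ?thesis
    unfolding model_torsion_free lc_model_def Tvec_swap[of t "model_theta t x w"] T_def[symmetric]
    by (simp only: sigma_eq_iff vec_eq_iff sigma_simps) (simp add: algebra_simps)
qed

lemma ext_d_model_theta:
  "ext_d (model_theta t) x v w = - conn_wedge (conn_R (model_gamma t)) (model_theta t) x v w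
     + Tvec (std_cubic t) (model_theta t x v) (model_theta t x w)"
  unfolding ext_d_def frechet_model_theta model_structure
  by (simp add: sigma_eq_iff conn_wedge_def conn_R_vec model_gamma_def cross_mult_left)

lemma ext_d_linear:
  fixes L :: "'b::euclidean_space \<Rightarrow> 'c::real_normed_vector"
  assumes L: "linear L" and d: "\<And>w. (\<lambda>y. \<alpha> y w) differentiable (at x)"
  shows "ext_d (\<lambda>y v. L (\<alpha> y v)) x v w = L (ext_d \<alpha> x v w)"
proof -
  have "frechet_derivative (\<lambda>y. L (\<alpha> y w)) (at x) = (\<lambda>u. L (frechet_derivative (\<lambda>y. \<alpha> y w) (at x) u))" for w
    using bounded_linear.has_derivative[OF linear_conv_bounded_linear[THEN iffD1, OF L]
        d[of w, unfolded frechet_derivative_works]]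
    by (rule frechet_derivative_at[symmetric])
  then show ?thesis unfolding ext_d_def by (simp add: linear_diff[OF L])
qed

lemma differentiable_model_theta: "(\<lambda>y. model_theta t y w) differentiable (at x)"
  using has_derivative_model_theta by (auto simp: differentiable_def)

lemma linear_sum_rows: "linear sum_rows"
  by (rule linearI) simp_all

text \<open>\<gamma> is a constant multiple of the row sum of \<theta>, so its derivative comes from
  adding up the rows of the structure equation.\<close>

lemma ext_d_model_gamma:
  "hat3 (ext_d (model_gamma t) x v w) = - cross3 (hat3 (model_gamma t x v)) (hat3 (model_gamma t x w))
     - t\<^sup>2 *\<^sub>R cross_rows (model_theta t x v) (model_theta t x w)"
proof -
  have l: "linear (\<lambda>X. hat3 (- t *\<^sub>R sum_rows X))"
    by (rule linearI) (simp_all add: scaleR_add_right)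
  have "ext_d (model_gamma t) x v w = hat3 (- t *\<^sub>R sum_rows (ext_d (model_theta t) x v w))"
    unfolding model_gamma_def[abs_def] by (rule ext_d_linear[OF l differentiable_model_theta])
  then have "hat3 (ext_d (model_gamma t) x v w) = - t *\<^sub>R sum_rows (model_theta' t x v w - model_theta' t x w v)"
    by (simp add: ext_d_def frechet_model_theta)
  also have "\<dots> = - cross3 (hat3 (model_gamma t x v)) (hat3 (model_gamma t x w))
     - t\<^sup>2 *\<^sub>R cross_rows (model_theta t x v) (model_theta t x w)"
    unfolding model_structure model_gamma_def cross_rows_def sum_3 hat3_hat3 sum_rows_def
    by (rule vec3_eqI; simp only: sigma_simps sigma_maprows Tvec_std vec3_simps; algebra)
  finally show ?thesis .
qed

section \<open>The characteristic connection of the model\<close>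

definition model_Upsilon :: "real \<Rightarrow> tensor3" where
  "model_Upsilon t x a b c = Upsilon0 (model_theta t x a) (model_theta t x b) (model_theta t x c)"

definition model_omega :: "real \<Rightarrow> tensor4" where
  "model_omega t x a b c d = omega0 (model_theta t x a) (model_theta t x b) (model_theta t x c) (model_theta t x d)"

lemma bij_model_theta: "bij (model_theta t x)"
  by (rule o_bij[of "model_frame t x"]) (simp_all add: fun_eq_iff model_frame_theta model_theta_frame)

lemma inv_model_theta: "inv (model_theta t x) = model_frame t x"
  by (rule inv_equality) (simp_all add: model_frame_theta model_theta_frame)

lemma frame_model_theta: "frame (model_theta t) x i = model_frame t x (axis i 1)"
  by (simp add: frame_def inv_model_theta)

lemma one_form_model_theta: "one_form_on UNIV (model_theta t)"
  by (simp add: one_form_on_def linear_model_theta smooth_on_model_theta smooth_on_ident smooth_on_const)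

lemma linear_gamma_map: "linear (\<lambda>X. hat3 (- t *\<^sub>R sum_rows X))"
  by (rule linearI) (simp_all add: scaleR_add_right)

lemma one_form_model_gamma: "one_form_on UNIV (model_gamma t)"
  unfolding one_form_on_def model_gamma_def[abs_def]
proof (intro conjI ballI allI)
  show "linear (\<lambda>v. hat3 (- t *\<^sub>R sum_rows (model_theta t x v)))" for x
    using linear_compose[OF linear_model_theta linear_gamma_map] by (simp add: o_def)
  show "smooth_on UNIV (\<lambda>x. hat3 (- t *\<^sub>R sum_rows (model_theta t x v)))" for v
    by (intro smooth_on_linear[OF _ linear_gamma_map] smooth_on_model_theta smooth_on_ident smooth_on_const open_UNIV)
qed

lemma adapted_model: "adapted_coframe (model_metric t) (model_Upsilon t) (model_omega t) UNIV (model_theta t)"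
  by (simp add: adapted_coframe_def one_form_model_theta bij_model_theta model_metric_def model_Upsilon_def
      model_omega_def inner_vec_def)

lemma irreducible_model: "irreducible_geometry UNIV (model_metric t) (model_Upsilon t) (model_omega t)"
  unfolding irreducible_geometry_def using adapted_model by blast

lemma Upsilon0_simps:
  "Upsilon0 (a + a') b c = Upsilon0 a b c + Upsilon0 a' b c" "Upsilon0 (r *\<^sub>R a) b c = r * Upsilon0 a b c"
  "Upsilon0 a (b + b') c = Upsilon0 a b c + Upsilon0 a b' c" "Upsilon0 a (r *\<^sub>R b) c = r * Upsilon0 a b c"
  "Upsilon0 a b (c + c') = Upsilon0 a b c + Upsilon0 a b c'" "Upsilon0 a b (r *\<^sub>R c) = r * Upsilon0 a b c"
  unfolding Upsilon0_def Let_def det_rows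
  by (simp_all add: cross_add_left cross_add_right inner_add_left inner_add_right cross_mult_left cross_mult_right
      add_divide_distrib algebra_simps)

lemma nearly_integrable_model: "nearly_integrable UNIV (model_metric t) (model_Upsilon t)"
  unfolding nearly_integrable_def
proof (intro ballI allI)
  fix x X :: "real^9"
  let ?F = "\<lambda>y. model_theta t y X"
  let ?D = "\<lambda>u. model_theta' t x u X"
  have lin: "bounded_linear (\<lambda>a. Upsilon0 a b c)" "bounded_linear (Upsilon0 b c)" "bounded_linear (\<lambda>a. Upsilon0 b a c)" for b c
    by (simp_all flip: linear_conv_bounded_linear add: linear_iff Upsilon0_simps)
  have d: "((\<lambda>y. Upsilon0 (?F y) (?F y) (?F y)) has_derivative
     (\<lambda>u. Upsilon0 (?D u) (?F x) (?F x) + Upsilon0 (?F x) (?D u) (?F x) + Upsilon0 (?F x) (?F x) (?D u))) (at x)"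
  proof -
    have c: "Upsilon0 a b c = 1/6 * ((sigma a$1 \<bullet> cross3 (sigma b$2) (sigma c$3)) + (sigma b$1 \<bullet> cross3 (sigma c$2) (sigma a$3))
      + (sigma c$1 \<bullet> cross3 (sigma a$2) (sigma b$3)) + (sigma a$1 \<bullet> cross3 (sigma c$2) (sigma b$3))
      + (sigma b$1 \<bullet> cross3 (sigma a$2) (sigma c$3)) + (sigma c$1 \<bullet> cross3 (sigma b$2) (sigma a$3)))" for a b c
      by (simp add: Upsilon0_def det_rows)
    have s: "((\<lambda>y. sigma (?F y) $ i) has_derivative (\<lambda>u. sigma (?D u) $ i)) (at x)" for i
      by (rule has_derivative_sigma_row[OF has_derivative_model_theta])
    show ?thesis
      unfolding c
      by (rule has_derivative_eq_rhs, (rule has_derivative_mult_right has_derivative_add has_derivative_inner has_derivative_cross3 s)+)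
        (simp add: fun_eq_iff inner_add_right algebra_simps)
  qed
  have f: "frechet_derivative (\<lambda>y. model_Upsilon t y X X X) (at x) X
      = Upsilon0 (?D X) (?F x) (?F x) + Upsilon0 (?F x) (?D X) (?F x) + Upsilon0 (?F x) (?F x) (?D X)"
    unfolding model_Upsilon_def using frechet_derivative_at[OF d, symmetric] by simp
  \<comment> \<open>The torsion term is skew, so \<open>lc_model t Y Y\<close> applies one cross
    product to all rows of Y. This is an infinitesimal rotation in SO(3)_R, which preserves the
    determinant.\<close>
  have z: "Upsilon0 (lc_model t Y Y) Y Y = 0" "Upsilon0 Y (lc_model t Y Y) Y = 0" "Upsilon0 Y Y (lc_model t Y Y) = 0" for Y
    unfolding Upsilon0_def Let_def det_rows lc_model_rows
    by (simp only: vec3_simps; algebra)+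
  show "nabla_Upsilon (model_metric t) (model_Upsilon t) x X X X X = 0"
    unfolding nabla_Upsilon_def f model.levi_civita
    by (simp add: model_Upsilon_def model_theta_frame Upsilon0_simps z)
qed

lemma conn_zero_L: "conn (\<lambda>x v. 0) \<gamma> = conn_R \<gamma>"
  by (simp add: fun_eq_iff conn_def conn_L_def)

lemma torsion_model:
  "torsion (model_theta t) (conn_R (model_gamma t)) x = tensor33 (std_cubic t) eps"
  unfolding vec_eq_iff tensor33_Tvec torsion_def
  by (simp add: ext_d_model_theta frame_model_theta model_theta_frame inner_axis')

lemma symmetric_std_cubic: "symmetric_cubic (std_cubic t)"
  by (auto simp: symmetric_cubic_def std_cubic_def)

lemma traceless_std_cubic: "traceless (std_cubic t)"
  by (simp add: traceless_def std_cubic_def)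

lemma std_cubic_forms: "tensor33 (std_cubic t) eps \<in> range cubic_forms"
proof -
  have "tensor33 (std_cubic t) eps = cubic_forms (coords (std_cubic t))"
    by (simp add: cubic_forms_def S_tensor_coords symmetric_std_cubic traceless_std_cubic)
  then show ?thesis by simp
qed

text \<open>The sum factors over rows and columns: 6 t^2 from the six entries - t of
  \<open>std_cubic\<close>, and 6 from the six signs of \<open>eps\<close>.\<close>

lemma norm_sq3_std_cubic: "norm_sq3 (tensor33 (std_cubic t) eps) = 36 * t\<^sup>2"
proof -
  have sp: "(\<Sum>a\<in>UNIV. f (row_of a) * g (col_of a)) = (\<Sum>r\<in>UNIV. f r) * (\<Sum>s\<in>UNIV. g s)" for f g :: "3 \<Rightarrow> real"
    unfolding sum_row_col[of "\<lambda>r s. f r * g s"] sum_product ..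
  let ?S = "\<lambda>a b c. (std_cubic t a b c)\<^sup>2" and ?e = "\<lambda>a b c. (eps a b c)\<^sup>2"
  have 1: "(\<Sum>k\<in>UNIV. ?S (row_of i) (row_of j) (row_of k) * ?e (col_of i) (col_of j) (col_of k))
      = (\<Sum>c\<in>UNIV. ?S (row_of i) (row_of j) c) * (\<Sum>d\<in>UNIV. ?e (col_of i) (col_of j) d)" for i j
    by (rule sp)
  have 2: "(\<Sum>j\<in>UNIV. (\<Sum>c\<in>UNIV. ?S (row_of i) (row_of j) c) * (\<Sum>d\<in>UNIV. ?e (col_of i) (col_of j) d))
      = (\<Sum>b\<in>UNIV. \<Sum>c\<in>UNIV. ?S (row_of i) b c) * (\<Sum>b\<in>UNIV. \<Sum>d\<in>UNIV. ?e (col_of i) b d)" for i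
    by (rule sp)
  have 3: "(\<Sum>i\<in>UNIV. (\<Sum>b\<in>UNIV. \<Sum>c\<in>UNIV. ?S (row_of i) b c) * (\<Sum>b\<in>UNIV. \<Sum>d\<in>UNIV. ?e (col_of i) b d))
      = (\<Sum>a\<in>UNIV. \<Sum>b\<in>UNIV. \<Sum>c\<in>UNIV. ?S a b c) * (\<Sum>a\<in>UNIV. \<Sum>b\<in>UNIV. \<Sum>d\<in>UNIV. ?e a b d)"
    by (rule sp)
  have "norm_sq3 (tensor33 (std_cubic t) eps)
      = (\<Sum>i\<in>UNIV. \<Sum>j\<in>UNIV. \<Sum>k\<in>UNIV. ?S (row_of i) (row_of j) (row_of k) * ?e (col_of i) (col_of j) (col_of k))"
    by (simp add: norm_sq3_def tensor33_def power2_eq_square mult_ac)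
  also have "\<dots> = (\<Sum>a\<in>UNIV. \<Sum>b\<in>UNIV. \<Sum>c\<in>UNIV. ?S a b c) * (\<Sum>a\<in>UNIV. \<Sum>b\<in>UNIV. \<Sum>d\<in>UNIV. ?e a b d)"
    unfolding 1 2 3 ..
  also have "(\<Sum>a\<in>UNIV. \<Sum>b\<in>UNIV. \<Sum>c\<in>UNIV. ?S a b c) = 6 * t\<^sup>2"
    by (simp add: sum_3 std_cubic_def)
  also have "(\<Sum>a\<in>UNIV. \<Sum>b\<in>UNIV. \<Sum>d\<in>UNIV. ?e a b d) = 6"
    by (simp add: sum_3 eps_def inner_3 cross_components axis_def)
  finally show ?thesis by simp
qed

lemma characteristic_model: "characteristic_connection UNIV (model_theta t) (\<lambda>x v. 0) (model_gamma t)"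
proof -
  have "one_form_on UNIV (\<lambda>x v. 0 :: real^3)"
    by (auto simp: one_form_on_def linear_zero)
  moreover have "tensor33 (std_cubic t) eps \<in> Lambda3"
    by (rule tensor33_Lambda3[OF symmetric_std_cubic])
  ultimately show ?thesis
    by (simp add: characteristic_connection_def one_form_model_gamma conn_zero_L torsion_model)
qed

lemma conn_vec:
  "sigma (conn \<gamma>L \<gamma>R x v *v Y) $ r $ s
    = cross3 (hat3 (\<gamma>L x v)) (column s (sigma Y)) $ r + cross3 (hat3 (\<gamma>R x v)) (sigma Y $ r) $ s"
proof -
  have "sigma (conn_L \<gamma>L x v *v Y) $ r $ s = column s (sigma (conn_L \<gamma>L x v *v Y)) $ r" by (simp add: column_def)
  then show ?thesis
    by (simp add: conn_def matrix_vector_mult_add_rdistrib conn_R_vec conn_L_vec)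
qed

lemma conn_skew: "(conn \<gamma>L \<gamma>R x v *v Y) \<bullet> Z = - (Y \<bullet> (conn \<gamma>L \<gamma>R x v *v Z))"
  unfolding inner_sigma inner_vec_def[of "sigma _ $ _"] conn_vec sum_3
  by (simp only: cross_components column_def vec_lambda_beta inner_real_def; algebra)

lemma Lambda3D:
  assumes "T \<in> Lambda3"
  shows "T $ i $ j $ k = - T $ j $ i $ k" "T $ i $ j $ k = - T $ i $ k $ j"
  using assms unfolding Lambda3_def by blast+

text \<open>The difference \<open>D\<close> to the explicit connection takes values in so(3)_L +
  so(3)_R, with parts \<xi> and \<eta>, and satisfies D X X = 0 because both torsions are totally
  skew.\<close>

lemma characteristic_unique:
  assumes "characteristic_connection UNIV (model_theta t) \<gamma>L \<gamma>R"
  shows "\<gamma>L = (\<lambda>x v. 0)" "\<gamma>R = model_gamma t"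
proof -
  let ?\<theta> = "model_theta t" and ?E = "model_frame t"
  have lL: "linear (\<gamma>L x)" and lR: "linear (\<gamma>R x)" and T: "torsion ?\<theta> (conn \<gamma>L \<gamma>R) x \<in> Lambda3" for x
    using assms unfolding characteristic_connection_def one_form_on_def by blast+
  have lM: "linear (model_gamma t x)" for x
    using one_form_model_gamma by (auto simp: one_form_on_def)
  have zero: "\<gamma>L x v = 0 \<and> \<gamma>R x v = model_gamma t x v" for x v
  proof -
    define D where "D X Y = conn \<gamma>L \<gamma>R x (?E x X) *v Y - conn (\<lambda>x v. 0) (model_gamma t) x (?E x X) *v Y" for X Y
    have linE: "linear (?E x)" by (rule model.linE)
    define \<xi> \<eta> where "\<xi> X = hat3 (\<gamma>L x (?E x X))" and "\<eta> X = hat3 (\<gamma>R x (?E x X) - model_gamma t x (?E x X))" for X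
    have l\<xi>: "linear \<xi>" unfolding \<xi>_def[abs_def]
      by (rule linearI) (simp_all add: linear_add[OF linE] linear_scale[OF linE] linear_add[OF lL] linear_scale[OF lL])
    have l\<eta>: "linear \<eta>" unfolding \<eta>_def[abs_def]
      by (rule linearI) (simp_all add: linear_add[OF linE] linear_scale[OF linE] linear_add[OF lR] linear_scale[OF lR]
          linear_add[OF lM] linear_scale[OF lM] algebra_simps)
    have Dvec: "sigma (D X Y) $ r $ s = cross3 (\<xi> X) (column s (sigma Y)) $ r + cross3 (\<eta> X) (sigma Y $ r) $ s" for X Y r s
      by (simp add: D_def conn_vec \<xi>_def \<eta>_def Cross3.left_diff_distrib)
    have Dl: "D (X + X') Y = D X Y + D X' Y" "D X (Y + Y') = D X Y + D X Y'"
        "D (c *\<^sub>R X) Y = c *\<^sub>R D X Y" "D X (c *\<^sub>R Y) = c *\<^sub>R D X Y" for X X' Y Y' c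
    proof -
      have col: "column s (A + B) = column s A + column s B" "column s (c *\<^sub>R A) = c *\<^sub>R column s A"
        for s c and A B :: "real^3^3" by (simp_all add: column_def vec_eq_iff)
      show "D (X + X') Y = D X Y + D X' Y" "D X (Y + Y') = D X Y + D X Y'"
        "D (c *\<^sub>R X) Y = c *\<^sub>R D X Y" "D X (c *\<^sub>R Y) = c *\<^sub>R D X Y"
        by (simp_all only: sigma_eq_iff vec_eq_iff[of "sigma _ $ _"] Dvec linear_add[OF l\<xi>] linear_add[OF l\<eta>]
            linear_scale[OF l\<xi>] linear_scale[OF l\<eta>] sigma_simps vector_add_component vector_scaleR_component
            real_scaleR_def col cross_add_left cross_add_right cross_mult_left cross_mult_right)
          (simp_all add: algebra_simps)
    qed
    have Dskew: "D X Y \<bullet> Z = - (Y \<bullet> D X Z)" for X Y Z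
      unfolding D_def inner_diff_left inner_diff_right conn_skew[of _ _ x _ Y Z] by simp
    have tor: "(D X Y - D Y X) \<bullet> Y = 0" for X Y
    proof -
      \<comment> \<open>The difference of the torsions is totally skew, and in the frame it is the
        antisymmetrisation of \<open>D\<close>.\<close>
      define \<tau> where "\<tau> = torsion ?\<theta> (conn \<gamma>L \<gamma>R) x - torsion ?\<theta> (conn (\<lambda>x v. 0) (model_gamma t)) x"
      have T': "torsion ?\<theta> (conn (\<lambda>x v. 0) (model_gamma t)) x \<in> Lambda3"
        using characteristic_model unfolding characteristic_connection_def by blast
      have a: "\<tau> $ i $ j $ k = - \<tau> $ j $ i $ k" for i j k
        using Lambda3D(1)[OF T, of x i j k] Lambda3D(1)[OF T', of i j k] by (simp add: \<tau>_def)
      have b: "\<tau> $ i $ j $ k = - \<tau> $ i $ k $ j" for i j k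
        using Lambda3D(2)[OF T, of x i j k] Lambda3D(2)[OF T', of i j k] by (simp add: \<tau>_def)
      have \<tau>: "\<tau> $ i $ j $ k = (D (axis j 1) (axis k 1) - D (axis k 1) (axis j 1)) $ i" for i j k
        by (simp add: \<tau>_def torsion_def conn_wedge_def frame_model_theta model_theta_frame D_def)
      have ax: "Y = (\<Sum>j\<in>UNIV. (Y $ j) *\<^sub>R axis j 1)" for Y :: "real^9"
        by (simp add: vec_eq_iff axis_def if_distrib cong: if_cong)
      have linD1: "linear (\<lambda>X. D X Y)" and linD2: "linear (D X)" for X Y
        by (simp_all add: linear_iff Dl)
      have DD: "D X Y = (\<Sum>j\<in>UNIV. \<Sum>k\<in>UNIV. (X $ j * Y $ k) *\<^sub>R D (axis j 1) (axis k 1))" for X Y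
      proof -
        have "D X Y = D (\<Sum>j\<in>UNIV. (X $ j) *\<^sub>R axis j 1) (\<Sum>k\<in>UNIV. (Y $ k) *\<^sub>R axis k 1)"
          by (simp flip: ax)
        also have "\<dots> = (\<Sum>j\<in>UNIV. \<Sum>k\<in>UNIV. (X $ j * Y $ k) *\<^sub>R D (axis j 1) (axis k 1))"
          by (simp add: linear_sum[OF linD1] linear_scale[OF linD1] linear_sum[OF linD2] linear_scale[OF linD2]
              scaleR_sum_right, subst sum.swap, simp add: mult.commute)
        finally show ?thesis .
      qed
      \<comment> \<open>\<tau> is skew in its outer indices, so inserting Y into both of them gives
        0.\<close>
      have inn: "(\<Sum>i\<in>UNIV. \<Sum>k\<in>UNIV. Y $ i * Y $ k * \<tau> $ i $ j $ k) = 0" for j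
      proof -
        have sw: "\<tau> $ i $ j $ k = - \<tau> $ k $ j $ i" for i k
          using a[of i j k] b[of j i k] a[of j k i] by simp
        have "(\<Sum>i\<in>UNIV. \<Sum>k\<in>UNIV. Y $ i * Y $ k * \<tau> $ i $ j $ k) = (\<Sum>k\<in>UNIV. \<Sum>i\<in>UNIV. Y $ i * Y $ k * \<tau> $ i $ j $ k)"
          by (rule sum.swap)
        also have "\<dots> = - (\<Sum>i\<in>UNIV. \<Sum>k\<in>UNIV. Y $ i * Y $ k * \<tau> $ i $ j $ k)"
          unfolding sum_negf[symmetric] by (intro sum.cong refl) (subst sw, simp)
        finally show ?thesis by simp
      qed
      have "(D X Y - D Y X) $ i = (\<Sum>j\<in>UNIV. \<Sum>k\<in>UNIV. X $ j * Y $ k * \<tau> $ i $ j $ k)" for i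
      proof -
        have "D Y X = (\<Sum>j\<in>UNIV. \<Sum>k\<in>UNIV. (X $ j * Y $ k) *\<^sub>R D (axis k 1) (axis j 1))"
          unfolding DD[of Y X] by (subst sum.swap) (simp add: mult.commute)
        then show ?thesis
          unfolding \<tau> DD[of X Y] by (simp add: right_diff_distrib sum_subtractf sum_component)
      qed
      then have "(D X Y - D Y X) \<bullet> Y = (\<Sum>i\<in>UNIV. (\<Sum>j\<in>UNIV. \<Sum>k\<in>UNIV. X $ j * Y $ k * \<tau> $ i $ j $ k) * Y $ i)"
        unfolding inner_vec_def by simp
      also have "\<dots> = (\<Sum>j\<in>UNIV. X $ j * (\<Sum>i\<in>UNIV. \<Sum>k\<in>UNIV. Y $ i * Y $ k * \<tau> $ i $ j $ k))"
        by (simp add: sum_distrib_left sum_distrib_right mult_ac, subst sum.swap) simp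
      also have "\<dots> = 0" by (simp add: inn)
      finally show ?thesis .
    qed
    have "D X X = 0" for X by (rule skew_torsion_difference[OF Dskew tor])
    then have "cross3 (\<xi> X) (column s (sigma X)) $ r + cross3 (\<eta> X) (sigma X $ r) $ s = 0" for X r s
      using Dvec[of X X r s] by simp
    from skew_action_zero[OF l\<xi> l\<eta> this, of "?\<theta> x v"]
    have 0: "hat3 (\<gamma>L x v) = 0" "hat3 (\<gamma>R x v - model_gamma t x v) = 0"
      by (simp_all add: \<xi>_def \<eta>_def model_frame_theta)
    then have "hat3 (hat3 (\<gamma>L x v)) = 0" "hat3 (hat3 (\<gamma>R x v - model_gamma t x v)) = 0" by (simp_all only: hat3_simps)
    then show ?thesis by simp
  qed
  show "\<gamma>L = (\<lambda>x v. 0)" "\<gamma>R = model_gamma t" using zero by (simp_all add: fun_eq_iff)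
qed

section \<open>Curvature of the characteristic connection\<close>

definition so3R :: "real^3 \<Rightarrow> real^9^9" where
  "so3R c = (\<Sum>A\<in>UNIV. (c $ A) *\<^sub>R eR A)"

lemma conn_R_so3R: "conn_R \<gamma> x v = so3R (\<gamma> x v)"
  by (simp add: conn_R_def so3R_def)

lemma linear_so3R: "linear so3R"
  by (rule linearI) (simp_all add: so3R_def algebra_simps sum.distrib scaleR_sum_right)

lemma so3R_vec: "sigma (so3R c *v y) $ r = cross3 (hat3 c) (sigma y $ r)"
  using conn_R_vec[of "\<lambda>_ _. c" undefined undefined y r] by (simp add: conn_R_so3R)

lemma cross3_jacobi: "cross3 a (cross3 b y) - cross3 b (cross3 a y) = cross3 (cross3 a b) y"
  by (rule vec3_eqI; simp only: vec3_simps; algebra)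

text \<open>By the Jacobi identity \<open>so3R\<close> turns cross products into commutators, so the
  commutators in the curvature cancel the quadratic term of d\<gamma> and only \<kappa>
  survives.\<close>

lemma curvature_so3R:
  assumes d: "\<And>w. (\<lambda>y. \<gamma> y w) differentiable (at x)"
    and K: "hat3 (ext_d \<gamma> x v w) = - cross3 (hat3 (\<gamma> x v)) (hat3 (\<gamma> x w)) - \<kappa>"
  shows "curvature_form (conn_R \<gamma>) x v w = so3R (- hat3 \<kappa>)"
proof -
  have e: "ext_d (conn_R \<gamma>) x v w = so3R (ext_d \<gamma> x v w)"
    using ext_d_linear[OF linear_so3R d] by (simp add: conn_R_so3R[abs_def])
  have "curvature_form (conn_R \<gamma>) x v w *v y = so3R (- hat3 \<kappa>) *v y" for y
  proof -
    have "sigma (curvature_form (conn_R \<gamma>) x v w *v y) $ r = sigma (so3R (- hat3 \<kappa>) *v y) $ r" for r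
      using cross3_jacobi[of "hat3 (\<gamma> x v)" "hat3 (\<gamma> x w)" "sigma y $ r"]
      by (simp add: curvature_form_def e conn_R_so3R matrix_vector_mult_add_rdistrib matrix_vector_mult_diff_rdistrib
          so3R_vec K Cross3.left_diff_distrib flip: matrix_vector_mul_assoc)
    then show ?thesis by (simp add: sigma_eq_iff)
  qed
  then show ?thesis by (simp add: matrix_eq)
qed

lemma differentiable_model_gamma: "(\<lambda>y. model_gamma t y w) differentiable (at x)"
  using smooth_on_has_derivative[of UNIV "\<lambda>y. model_gamma t y w" x] one_form_model_gamma
  unfolding one_form_on_def differentiable_def by blast

lemma curvature_model:
  "curvature_form (conn_R (model_gamma t)) x v w
    = so3R (- hat3 (t\<^sup>2 *\<^sub>R cross_rows (model_theta t x v) (model_theta t x w)))"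
  by (rule curvature_so3R[OF differentiable_model_gamma ext_d_model_gamma])

lemma so3R_cross_rows:
  "so3R (- hat3 (r *\<^sub>R cross_rows X Y)) = r *\<^sub>R (\<Sum>A\<in>UNIV. kappa0 A X Y *\<^sub>R eR A)"
  by (simp add: so3R_def kappa0_cross_rows scaleR_sum_right)

lemma ricci_cross_rows:
  "(\<Sum>k\<in>UNIV. maprows (\<lambda>_. cross3 (- cross_rows (axis k 1) X)) Y $ k) = 2 * (X \<bullet> Y)"
proof -
  define x where "x r c = sigma X $ r $ c" for r c
  define y where "y r c = sigma Y $ r $ c" for r c
  show ?thesis
    unfolding sum_9 inner_sigma cross_rows_def sum_3
    by (simp only: nth_sigma sigma_maprows component_simps flip: x_def y_def) algebra
qed

lemma ricci_form_model:
  "ricci_form (model_theta t) (conn_R (model_gamma t)) x i j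
    = 2 * t\<^sup>2 * model_metric t x (frame (model_theta t) x i) (frame (model_theta t) x j)"
proof -
  have e: "so3R (- hat3 (t\<^sup>2 *\<^sub>R cross_rows X Y)) $ k $ i
      = t\<^sup>2 * maprows (\<lambda>_. cross3 (- cross_rows X Y)) (axis i 1) $ k" for X Y k i
  proof -
    have "so3R (- hat3 (t\<^sup>2 *\<^sub>R cross_rows X Y)) *v axis i 1 = t\<^sup>2 *\<^sub>R maprows (\<lambda>_. cross3 (- cross_rows X Y)) (axis i 1)"
      by (simp add: sigma_eq_iff so3R_vec cross_mult_left)
    then have "(so3R (- hat3 (t\<^sup>2 *\<^sub>R cross_rows X Y)) *v axis i 1) $ k = t\<^sup>2 * maprows (\<lambda>_. cross3 (- cross_rows X Y)) (axis i 1) $ k"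
      by simp
    then show ?thesis by (simp add: matrix_vector_mult_basis column_def)
  qed
  have "ricci_form (model_theta t) (conn_R (model_gamma t)) x i j
      = t\<^sup>2 * (\<Sum>k\<in>UNIV. maprows (\<lambda>_. cross3 (- cross_rows (axis k 1) (axis j 1))) (axis i 1) $ k)"
    by (simp only: ricci_form_def curvature_model e frame_model_theta model_theta_frame sum_distrib_left)
  also have "\<dots> = 2 * t\<^sup>2 * (axis j 1 \<bullet> (axis i 1 :: real^9))"
    unfolding ricci_cross_rows by simp
  finally show ?thesis
    by (simp add: model_metric_def frame_model_theta model_theta_frame inner_commute)
qed

lemma curvature_form_zero: "curvature_form (conn_L (\<lambda>x v. 0)) x v w = 0"
  by (simp add: curvature_form_def ext_d_def conn_L_def)

text \<open>The Ricci trace 2 t^2 g already detects nonzero curvature.\<close>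

lemma flat_model_iff:
  "(\<forall>x\<in>UNIV. \<forall>v w. curvature_form (conn_R (model_gamma t)) x v w = 0) \<longleftrightarrow> t\<^sup>2 = 0"
proof
  assume "\<forall>x\<in>UNIV. \<forall>v w. curvature_form (conn_R (model_gamma t)) x v w = 0"
  then have "ricci_form (model_theta t) (conn_R (model_gamma t)) 0 1 1 = 0"
    by (simp add: ricci_form_def)
  then show "t\<^sup>2 = 0"
    unfolding ricci_form_model by (simp add: model_metric_def frame_model_theta model_theta_frame inner_axis_axis)
qed (simp add: curvature_model so3R_def)

lemma model_characteristic_properties:
  assumes "characteristic_connection UNIV (model_theta t) \<gamma>L \<gamma>R" and k: "k = t\<^sup>2"
  shows "(\<forall>x\<in>UNIV. torsion (model_theta t) (conn \<gamma>L \<gamma>R) x \<in> range cubic_forms) \<and>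
    (\<forall>x\<in>UNIV. \<forall>v w. curvature_form (conn_L \<gamma>L) x v w = 0) \<and>
    (\<forall>x\<in>UNIV. norm_sq3 (torsion (model_theta t) (conn \<gamma>L \<gamma>R) x) = 36 * k \<and>
       (\<forall>v w. curvature_form (conn \<gamma>L \<gamma>R) x v w = curvature_form (conn_R \<gamma>R) x v w \<and>
         curvature_form (conn_R \<gamma>R) x v w =
           (1/36 * norm_sq3 (torsion (model_theta t) (conn \<gamma>L \<gamma>R) x)) *\<^sub>R
             (\<Sum>A\<in>UNIV. kappa0 A (model_theta t x v) (model_theta t x w) *\<^sub>R eR A))) \<and>
    (k = 0 \<longrightarrow> (\<forall>x\<in>UNIV. \<forall>v w. curvature_form (conn \<gamma>L \<gamma>R) x v w = 0)) \<and>
    (\<forall>x\<in>UNIV. \<forall>i j. ricci_form (model_theta t) (conn_R \<gamma>R) x i j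
       = 2 * k * model_metric t x (frame (model_theta t) x i) (frame (model_theta t) x j)) \<and>
    ((\<forall>x\<in>UNIV. \<forall>v w. curvature_form (conn_R \<gamma>R) x v w = 0) \<longleftrightarrow> k = 0)"
proof -
  note u = characteristic_unique[OF assms(1)]
  have c: "conn \<gamma>L \<gamma>R = conn_R (model_gamma t)" unfolding u by (rule conn_zero_L)
  show ?thesis
    unfolding c unfolding u k torsion_model norm_sq3_std_cubic flat_model_iff
  proof (intro conjI ballI allI impI)
    show "curvature_form (conn_R (model_gamma t)) x v w =
      (1/36 * (36 * t\<^sup>2)) *\<^sub>R (\<Sum>A\<in>UNIV. kappa0 A (model_theta t x v) (model_theta t x w) *\<^sub>R eR A)" for x v w
      unfolding curvature_model so3R_cross_rows by simp
  qed (simp_all add: std_cubic_forms curvature_form_zero ricci_form_model)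
qed

section \<open>Left-invariant forms\<close>

definition act_deriv :: "real \<Rightarrow> real^12 \<Rightarrow> real^9 \<Rightarrow> real^9 \<Rightarrow> real^9" where
  "act_deriv t a x v = mat9 (\<chi> i. cay_mult_deriv (2 * t) (sigma (p12 a) $ i) (rot (q12 a) (sigma x $ i))
     (rot (q12 a) (sigma v $ i)))"

lemma has_derivative_act:
  assumes "act_defined t a x"
  shows "(act t a has_derivative act_deriv t a x) (at x)"
  unfolding act_def[abs_def] act_deriv_def[abs_def]
proof (rule has_derivative_maprows)
  fix i
  have r: "((\<lambda>x. rot (q12 a) (sigma x $ i)) has_derivative (\<lambda>v. rot (q12 a) (sigma v $ i))) (at x)"
    by (rule bounded_linear.has_derivative[OF linear_conv_bounded_linear[THEN iffD1, OF linear_rot]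
          has_derivative_sigma_row[OF has_derivative_ident]])
  have "(cay_mult (2 * t) (sigma (p12 a) $ i) has_derivative
      cay_mult_deriv (2 * t) (sigma (p12 a) $ i) (rot (q12 a) (sigma x $ i))) (at (rot (q12 a) (sigma x $ i)))"
    using assms by (intro has_derivative_cay_mult) (auto simp: act_defined_def)
  from has_derivative_compose[OF r this]
  show "((\<lambda>x. cay_mult (2 * t) (sigma (p12 a) $ i) (rot (q12 a) (sigma x $ i))) has_derivative
      (\<lambda>v. cay_mult_deriv (2 * t) (sigma (p12 a) $ i) (rot (q12 a) (sigma x $ i)) (rot (q12 a) (sigma v $ i)))) (at x)" .
qed

text \<open>Translations preserve the Maurer-Cartan form of each factor, and rotations rotate it.
  Hence the action changes the coframe only by a common rotation of its rows, under which the
  structure tensors are invariant.\<close>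

lemma model_theta_act:
  assumes "act_defined t a x"
  shows "model_theta t (act t a x) (act_deriv t a x v) = maprows (\<lambda>i. rot (q12 a)) (model_theta t x v)"
proof -
  have "maprows (\<lambda>i. cay_form (2 * t) (sigma (act t a x) $ i)) (act_deriv t a x v)
      = maprows (\<lambda>i. rot (q12 a)) (maprows (\<lambda>i. cay_form (2 * t) (sigma x $ i)) v)"
    using assms by (simp add: sigma_eq_iff act_deriv_def act_defined_def cay_form_mult rot_cay_form)
  then show ?thesis unfolding model_theta_def by (simp add: tetra_rot)
qed

lemma has_derivative_p12: "(f has_derivative f') F \<Longrightarrow> ((\<lambda>x. p12 (f x)) has_derivative (\<lambda>v. p12 (f' v))) F"
  by (rule bounded_linear.has_derivative[OF linear_conv_bounded_linear[THEN iffD1, OF linear_p12]])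

lemma has_derivative_q12: "(f has_derivative f') F \<Longrightarrow> ((\<lambda>x. q12 (f x)) has_derivative (\<lambda>v. q12 (f' v))) F"
  by (rule bounded_linear.has_derivative[OF linear_conv_bounded_linear[THEN iffD1, OF linear_q12]])

lemma dleft_model:
  assumes "(a, b) \<in> mult_dom (model_group t)"
  shows "dleft (model_group t) a b v = j12 (act_deriv t a (p12 b) (p12 v)) (cay_mult_deriv 1 (q12 a) (q12 b) (q12 v))"
proof -
  have ok: "act_defined t a (p12 b)" "1 - 1\<^sup>2 * (q12 a \<bullet> q12 b) \<noteq> 0" using assms by simp_all
  have "((\<lambda>b. j12 (act t a (p12 b)) (cay_mult 1 (q12 a) (q12 b))) has_derivative
      (\<lambda>v. j12 (act_deriv t a (p12 b) (p12 v)) (cay_mult_deriv 1 (q12 a) (q12 b) (q12 v)))) (at b)"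
    by (intro has_derivative_j12 has_derivative_compose[OF has_derivative_p12[OF has_derivative_ident] has_derivative_act[OF ok(1)]]
        has_derivative_compose[OF has_derivative_q12[OF has_derivative_ident] has_derivative_cay_mult[OF ok(2)]])
  then have "(lmult (model_group t) a has_derivative
      (\<lambda>v. j12 (act_deriv t a (p12 b) (p12 v)) (cay_mult_deriv 1 (q12 a) (q12 b) (q12 v)))) (at b)"
    by (simp add: model_group_simps(5)[abs_def])
  from frechet_derivative_at[OF this, symmetric] show ?thesis by (simp add: dleft_def)
qed

text \<open>The coframe of M turns by h under the action of (m, h); rotating back by h^(-1) makes
  its pullback left-invariant.\<close>

definition group_rows :: "real \<Rightarrow> real^12 \<Rightarrow> real^12 \<Rightarrow> real^9" where
  "group_rows t a v = maprows (\<lambda>i. rot (- q12 a)) (model_theta t (p12 a) (p12 v))"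

definition group_theta :: "real^3^3 \<Rightarrow> real \<Rightarrow> real^12 \<Rightarrow> real^12 \<Rightarrow> real^9" where
  "group_theta Q t a v = rotl Q (group_rows t a v)"

text \<open>The component \<gamma> + t (sum of the rows of \<theta>) has to be the Maurer-Cartan
  form of the rotation factor, which acts by the cross product with twice
  \<open>cay_form 1\<close>.\<close>

definition group_gamma :: "real \<Rightarrow> real^12 \<Rightarrow> real^12 \<Rightarrow> real^3" where
  "group_gamma t a v = hat3 (2 *\<^sub>R cay_form 1 (q12 a) (q12 v) - t *\<^sub>R sum_rows (group_rows t a v))"

lemma group_rows_left:
  assumes "(a, b) \<in> mult_dom (model_group t)"
  shows "group_rows t (lmult (model_group t) a b) (dleft (model_group t) a b v) = group_rows t b v"
proof -
  have ok: "act_defined t a (p12 b)" "1 - q12 a \<bullet> q12 b \<noteq> 0" using assms by simp_all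
  have r: "rot (- cay_mult 1 (q12 a) (q12 b)) (rot (q12 a) y) = rot (- q12 b) y" for y
  proof -
    have "rot (cay_mult 1 (q12 a) (q12 b)) (rot (- q12 b) y) = rot (q12 a) y"
      unfolding rot_mult[OF ok(2)] by simp
    then show ?thesis by (metis rot_inverse(1))
  qed
  show ?thesis
    unfolding dleft_model[OF assms] group_rows_def
    by (simp add: model_theta_act[OF ok(1)] sigma_eq_iff r)
qed

lemma group_gamma_left:
  assumes "(a, b) \<in> mult_dom (model_group t)"
  shows "group_gamma t (lmult (model_group t) a b) (dleft (model_group t) a b v) = group_gamma t b v"
proof -
  have "1 - 1\<^sup>2 * (q12 a \<bullet> q12 b) \<noteq> 0" using assms by simp
  from cay_form_mult[OF this]
  show ?thesis unfolding group_gamma_def group_rows_left[OF assms] by (simp add: dleft_model[OF assms])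
qed

lemma linear_group_rows: "linear (group_rows t a)"
  unfolding group_rows_def[abs_def]
  using linear_compose[OF linear_compose[OF linear_p12 linear_model_theta] linear_maprows[OF linear_rot]]
  by (simp add: o_def)

lemma linear_group_gamma: "linear (group_gamma t a)"
  by (rule linearI) (simp_all add: group_gamma_def linear_add[OF linear_group_rows] linear_scale[OF linear_group_rows]
      linear_add[OF linear_cay_form] linear_scale[OF linear_cay_form] algebra_simps)

lemma smooth_group_rows: "smooth_on UNIV (\<lambda>a. group_rows t a v)"
  unfolding group_rows_def maprows_def
  by (intro smooth_on_mat9 smooth_on_rot smooth_on_minus smooth_on_q12 smooth_on_sigma_row smooth_on_model_theta
      smooth_on_p12 smooth_on_ident smooth_on_const open_UNIV)

lemma smooth_group_gamma: "smooth_on UNIV (\<lambda>a. group_gamma t a v)"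
  unfolding group_gamma_def
  by (intro smooth_on_linear[OF _ linear_hat3] smooth_on_diff smooth_on_scaleR smooth_on_const smooth_on_cay_form
      smooth_on_q12 smooth_on_ident smooth_on_linear[OF _ linear_sum_rows] smooth_group_rows open_UNIV)

lemma left_invariant_group_theta: "left_invariant_form (model_group t) (group_theta Q t)"
proof -
  have "linear (group_theta Q t x)" for x
    unfolding group_theta_def[abs_def]
    using linear_compose[OF linear_group_rows linear_rotl] by (simp add: o_def)
  moreover have "smooth_on UNIV (\<lambda>x. group_theta Q t x v)" for v
    unfolding group_theta_def by (intro smooth_on_linear[OF _ linear_rotl] smooth_group_rows open_UNIV)
  moreover have "group_theta Q t (lmult (model_group t) a b) (dleft (model_group t) a b v) = group_theta Q t b v"
    if "(a, b) \<in> mult_dom (model_group t)" for a b v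
    using group_rows_left[OF that] by (simp only: group_theta_def)
  ultimately show ?thesis by (auto simp: left_invariant_form_def one_form_on_def simp del: model_group_simps(4,5))
qed

lemma left_invariant_group_gamma: "left_invariant_form (model_group t) (group_gamma t)"
  using linear_group_gamma smooth_group_gamma group_gamma_left
  by (auto simp: left_invariant_form_def one_form_on_def simp del: model_group_simps(4,5))

lemma linear_maprows_rot: "linear (maprows (\<lambda>i. rot h))"
  by (rule linear_maprows) (rule linear_rot)

lemma has_derivative_group_rows:
  "((\<lambda>a. group_rows t a w) has_derivative (\<lambda>u. maprows (\<lambda>i y. - 2 *\<^sub>R cross3 (cay_form 1 (q12 a) (q12 u)) y) (group_rows t a w)
      + maprows (\<lambda>i. rot (- q12 a)) (model_theta' t (p12 a) (p12 u) (p12 w)))) (at a)"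
proof -
  have L: "((\<lambda>a. maprows (\<lambda>i. rot (- q12 a)) X) has_derivative
      (\<lambda>u. mat9 (\<chi> i. - 2 *\<^sub>R cross3 (cay_form 1 (q12 a) (q12 u)) (rot (- q12 a) (sigma X $ i))))) (at a)" for X
    unfolding maprows_def
    by (rule has_derivative_maprows)
      (rule has_derivative_compose[OF has_derivative_q12[OF has_derivative_ident] has_derivative_rot_minus])
  have F: "((\<lambda>a. model_theta t (p12 a) (p12 w)) has_derivative (\<lambda>u. model_theta' t (p12 a) (p12 u) (p12 w))) (at a)"
    by (rule has_derivative_compose[OF has_derivative_p12[OF has_derivative_ident] has_derivative_model_theta])
  from has_derivative_linear_family[OF open_UNIV UNIV_I linear_maprows_rot L F]
  show ?thesis
    unfolding group_rows_def by (rule has_derivative_eq_rhs) (simp add: fun_eq_iff sigma_eq_iff)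
qed

text \<open>Compared with the equation on M, the moving rotation contributes the term with twice
  \<open>cay_form 1\<close>, which is exactly what \<gamma> has gained.\<close>

lemma ext_d_group_rows:
  "ext_d (group_rows t) a v w = - conn_wedge (conn_R (group_gamma t)) (group_rows t) a v w
     + Tvec (std_cubic t) (group_rows t a v) (group_rows t a w)"
proof -
  have fd: "frechet_derivative (\<lambda>a. group_rows t a w) (at a) u
      = maprows (\<lambda>i y. - 2 *\<^sub>R cross3 (cay_form 1 (q12 a) (q12 u)) y) (group_rows t a w)
      + maprows (\<lambda>i. rot (- q12 a)) (model_theta' t (p12 a) (p12 u) (p12 w))" for u w
    using frechet_derivative_at[OF has_derivative_group_rows, symmetric] by simp
  have "ext_d (group_rows t) a v w
      = maprows (\<lambda>i y. - 2 *\<^sub>R cross3 (cay_form 1 (q12 a) (q12 v)) y) (group_rows t a w)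
      - maprows (\<lambda>i y. - 2 *\<^sub>R cross3 (cay_form 1 (q12 a) (q12 w)) y) (group_rows t a v)
      + maprows (\<lambda>i. rot (- q12 a)) (model_theta' t (p12 a) (p12 v) (p12 w) - model_theta' t (p12 a) (p12 w) (p12 v))"
    unfolding ext_d_def fd linear_diff[OF linear_maprows_rot] by simp
  also have "maprows (\<lambda>i. rot (- q12 a)) (model_theta' t (p12 a) (p12 v) (p12 w) - model_theta' t (p12 a) (p12 w) (p12 v))
     = maprows (\<lambda>i y. t *\<^sub>R cross3 (sum_rows (group_rows t a v)) y) (group_rows t a w)
     - maprows (\<lambda>i y. t *\<^sub>R cross3 (sum_rows (group_rows t a w)) y) (group_rows t a v)
     + Tvec (std_cubic t) (group_rows t a v) (group_rows t a w)"
    unfolding model_structure group_rows_def Tvec_std_rot sum_rows_rot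
    by (simp add: sigma_eq_iff rot_cross)
  finally show ?thesis
    by (simp add: sigma_eq_iff conn_wedge_def conn_R_vec group_gamma_def Cross3.left_diff_distrib cross_mult_left algebra_simps)
qed

lemma differentiable_group_rows: "(\<lambda>y. group_rows t y w) differentiable (at x)"
  using has_derivative_group_rows by (auto simp: differentiable_def)

lemma rotl_row_action: "rotl Q (maprows (\<lambda>i y. cross3 c y) X) = maprows (\<lambda>i y. cross3 c y) (rotl Q X)"
  by (simp add: sigma_eq_iff sigma_rotl sum_3 cross_add_right cross_mult_right)

text \<open>Rotations of the row index commute with the action of \<gamma> on rows and only replace
  the cubic by its image under Q.\<close>

lemma ext_d_group_theta:
  assumes "orthogonal_matrix Q"
  shows "ext_d (group_theta Q t) a v w = - conn_wedge (conn_R (group_gamma t)) (group_theta Q t) a v w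
     + Tvec (act_cubic Q (std_cubic t)) (group_theta Q t a v) (group_theta Q t a w)"
proof -
  have c: "conn_R (group_gamma t) a v *v X = maprows (\<lambda>i y. cross3 (hat3 (group_gamma t a v)) y) X" for v X
    by (simp add: sigma_eq_iff conn_R_vec)
  have "ext_d (group_theta Q t) a v w = rotl Q (ext_d (group_rows t) a v w)"
    unfolding group_theta_def[abs_def] by (rule ext_d_linear[OF linear_rotl differentiable_group_rows])
  then show ?thesis
    unfolding ext_d_group_rows conn_wedge_def c group_theta_def Tvec_tact[OF assms]
      linear_add[OF linear_rotl] linear_neg[OF linear_rotl] linear_diff[OF linear_rotl] rotl_row_action .
qed

lemma ext_d_group_gamma:
  "hat3 (ext_d (group_gamma t) a v w) = - cross3 (hat3 (group_gamma t a v)) (hat3 (group_gamma t a w))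
     - t\<^sup>2 *\<^sub>R cross_rows (group_rows t a v) (group_rows t a w)"
proof -
  define N where "N v = cay_form 1 (q12 a) (q12 v)" for v
  have dN: "((\<lambda>a. cay_form 1 (q12 a) (q12 w)) has_derivative (\<lambda>u. cay_form_deriv 1 (q12 a) (q12 u) (q12 w))) (at a)" for w
    by (rule has_derivative_compose[OF has_derivative_q12[OF has_derivative_ident] has_derivative_cay_form])
  have "((\<lambda>a. group_gamma t a w) has_derivative (\<lambda>u. hat3 (2 *\<^sub>R cay_form_deriv 1 (q12 a) (q12 u) (q12 w)
      - t *\<^sub>R sum_rows (frechet_derivative (\<lambda>a. group_rows t a w) (at a) u)))) (at a)" for w
    unfolding group_gamma_def
    by (intro bounded_linear.has_derivative[OF linear_conv_bounded_linear[THEN iffD1, OF linear_hat3]]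
        has_derivative_diff has_derivative_scaleR_right dN
        bounded_linear.has_derivative[OF linear_conv_bounded_linear[THEN iffD1, OF linear_sum_rows]]
        differentiable_group_rows[unfolded frechet_derivative_works])
  from frechet_derivative_at[OF this, symmetric]
  have "hat3 (ext_d (group_gamma t) a v w) = 2 *\<^sub>R (cay_form_deriv 1 (q12 a) (q12 v) (q12 w) - cay_form_deriv 1 (q12 a) (q12 w) (q12 v))
      - t *\<^sub>R sum_rows (ext_d (group_rows t) a v w)"
    by (simp add: ext_d_def algebra_simps)
  also have "\<dots> = 2 *\<^sub>R (- 2 *\<^sub>R cross3 (N v) (N w))
      - t *\<^sub>R sum_rows (ext_d (group_rows t) a v w)"
    by (simp add: cay_form_deriv_antisym N_def)
  also have "\<dots> = - cross3 (hat3 (group_gamma t a v)) (hat3 (group_gamma t a w))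
     - t\<^sup>2 *\<^sub>R cross_rows (group_rows t a v) (group_rows t a w)"
    unfolding ext_d_group_rows conn_wedge_def sum_rows_def cross_rows_def sum_3 sigma_simps vector_add_component
      vector_minus_component vector_uminus_component conn_R_vec group_gamma_def hat3_hat3 N_def[symmetric]
    by (rule vec3_eqI; simp only: Tvec_std vec3_simps; algebra)
  finally show ?thesis .
qed

lemma system_S_group:
  assumes Q: "rotation_matrix Q" and S: "S_tensor u = act_cubic Q (std_cubic t)" and k: "k = t\<^sup>2"
  shows "system_S u k UNIV (group_theta Q t) (group_gamma t)"
proof -
  have o: "orthogonal_matrix Q" using Q by (simp add: rotation_matrix_def)
  have g: "ext_d (group_gamma t) a v w = - cross3 (group_gamma t a v) (group_gamma t a w)
     - t\<^sup>2 *\<^sub>R hat3 (cross_rows (group_rows t a v) (group_rows t a w))" for a v w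
  proof -
    have h: "hat3 (cross3 x y) = cross3 (hat3 x) (hat3 y)" for x y
      by (simp add: vec_eq_iff forall_3 hat3_nth cross_components)
    have "hat3 (hat3 (ext_d (group_gamma t) a v w)) = - hat3 (cross3 (hat3 (group_gamma t a v)) (hat3 (group_gamma t a w)))
       - t\<^sup>2 *\<^sub>R hat3 (cross_rows (group_rows t a v) (group_rows t a w))"
      unfolding ext_d_group_gamma by (simp only: hat3_simps)
    then show ?thesis by (simp add: h)
  qed
  have kap: "kappa0 A (group_theta Q t a v) (group_theta Q t a w) = - hat3 (cross_rows (group_rows t a v) (group_rows t a w)) $ A"
    for A a v w
    by (simp add: kappa0_cross_rows group_theta_def cross_rows_rotl[OF o])
  show ?thesis
    unfolding system_S_def T_form_axis S ext_d_group_theta[OF o] g kap k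
    by (auto simp: cross_components algebra_simps)
qed

section \<open>The homogeneous space and its symmetries\<close>

lemma frechet_derivative_p12: "frechet_derivative p12 (at a) = p12"
  using frechet_derivative_at[OF has_derivative_p12[OF has_derivative_ident], of a] by simp

text \<open>Clearing the denominator turns the equation into \<open>cay_frame s x y = 0\<close>, and
  \<open>cay_frame s x\<close> is injective.\<close>

lemma cay_mult_eq_left:
  assumes "1 - s\<^sup>2 * (x \<bullet> y) \<noteq> 0" "cay_mult s x y = x" shows "y = 0"
proof -
  define d where "d = 1 - s\<^sup>2 * (x \<bullet> y)"
  have d0: "d \<noteq> 0" using assms(1) by (simp add: d_def)
  have "d *\<^sub>R ((1 / d) *\<^sub>R (x + y + s *\<^sub>R cross3 x y)) = d *\<^sub>R x"
    using assms(2) by (simp add: cay_mult_def d_def)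
  then have "x + y + s *\<^sub>R cross3 x y = d *\<^sub>R x" using d0 by simp
  then have "cay_frame s x y = 0" by (simp add: cay_frame_def d_def algebra_simps)
  then have "cay_form s x (cay_frame s x y) = 0" by (simp add: linear_0[OF linear_cay_form])
  then show ?thesis by (simp add: cay_form_frame)
qed

lemma act_eq_iff:
  assumes "act_defined t a x" shows "act t a x = p12 a \<longleftrightarrow> x = 0"
proof
  assume e: "act t a x = p12 a"
  have "rot (q12 a) (sigma x $ i) = 0" for i
  proof (rule cay_mult_eq_left)
    show "cay_mult (2 * t) (sigma (p12 a) $ i) (rot (q12 a) (sigma x $ i)) = sigma (p12 a) $ i"
      using e sigma_act[of t a x i] by simp
  qed (use assms in \<open>simp add: act_defined_def\<close>)
  then have "rot (- q12 a) (rot (q12 a) (sigma x $ i)) = 0" for i by simp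
  then show "x = 0" by (simp add: sigma_eq_iff)
qed simp

lemma rotl_eq_0_iff: "orthogonal_matrix Q \<Longrightarrow> rotl Q X = 0 \<longleftrightarrow> X = 0"
  using inner_rotl[of Q X X] by (metis inner_eq_zero_iff linear_0 linear_rotl)

lemma model_theta_eq_0_iff: "model_theta t x v = 0 \<longleftrightarrow> v = 0"
  using model_frame_theta[of t x v] by (metis linear_0 linear_model_theta model.linE)

text \<open>The subgroup is the rotation factor, and the fibres of \<open>p12\<close> are affine
  subspaces, hence connected.\<close>

lemma homogeneous_model:
  assumes Q: "orthogonal_matrix Q"
  shows "local_homogeneous_space (model_group t) {a. p12 a = 0}
    {v. group_theta Q t (lone (model_group t)) v = 0} UNIV p12"
  unfolding local_homogeneous_space_def
proof (intro conjI)
  have surj: "surj p12" by (rule surjI[of _ "\<lambda>m. j12 m 0"]) simp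
  then show "p12 ` lcarrier (model_group t) = UNIV" by simp
  show "\<forall>a\<in>lcarrier (model_group t). surj (frechet_derivative p12 (at a))"
    using surj by (simp add: frechet_derivative_p12)
  show "smooth_on (lcarrier (model_group t)) p12"
    using smooth_on_p12[OF open_UNIV smooth_on_ident[OF open_UNIV]] by simp
  show "\<forall>(a, h)\<in>mult_dom (model_group t). p12 (lmult (model_group t) a h) = p12 a \<longleftrightarrow> h \<in> {a. p12 a = 0}"
    by (auto simp: act_eq_iff)
  show "\<forall>x\<in>UNIV. connected {a \<in> lcarrier (model_group t). p12 a = x}"
  proof
    fix x :: "real^9"
    have "convex {a. p12 a = x}" by (auto simp: convex_def simp flip: scaleR_add_left)
    then show "connected {a \<in> lcarrier (model_group t). p12 a = x}" by (simp add: convex_connected)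
  qed
  show "{v. frechet_derivative p12 (at (lone (model_group t))) v = 0}
      = {v. group_theta Q t (lone (model_group t)) v = 0}"
    by (simp add: frechet_derivative_p12 group_theta_def group_rows_def rotl_eq_0_iff[OF Q] maprows_def model_theta_eq_0_iff)
qed auto

lemma descends_model:
  assumes Q: "rotation_matrix Q"
  shows "descends UNIV (group_theta Q t) p12 (model_metric t) (model_Upsilon t) (model_omega t)"
proof -
  have Q: "orthogonal_matrix Q" "det Q = 1" using assms by (simp_all add: rotation_matrix_def)
  have i: "(\<Sum>i\<in>UNIV. x $ i * y $ i) = x \<bullet> y" for x y :: "real^9" by (simp add: inner_vec_def)
  show ?thesis
    unfolding descends_def Let_def frechet_derivative_p12 i group_theta_def inner_rotl[OF Q(1)] Upsilon0_rotl[OF Q(2)]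
      omega0_rotl[OF Q(1)] group_rows_def inner_rot Upsilon0_rot omega0_rot
    by (simp add: model_metric_def model_Upsilon_def model_omega_def)
qed

lemma rot_trivial:
  assumes "\<And>x. rot h x = x" shows "h = 0"
proof -
  have "cross3 h x = 0" for x
  proof -
    have N: "1 + h \<bullet> h \<noteq> 0" using denom_pos'[of h] by simp
    have "(1 + h \<bullet> h) *\<^sub>R ((1 / (1 + h \<bullet> h)) *\<^sub>R rot_num 1 h x) = (1 + h \<bullet> h) *\<^sub>R x"
      using assms[of x] by (simp add: rot_def)
    then have "rot_num 1 h x = (1 + h \<bullet> h) *\<^sub>R x" using N by simp
    then have "2 *\<^sub>R cross3 h x = 2 *\<^sub>R ((h \<bullet> h) *\<^sub>R x - (h \<bullet> x) *\<^sub>R h)"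
      by (simp add: rot_num_def vec_eq_iff algebra_simps)
    \<comment> \<open>The left side is orthogonal to h and x and the right side is a combination of
      them, so both vanish.\<close>
    then have e: "cross3 h x = (h \<bullet> h) *\<^sub>R x - (h \<bullet> x) *\<^sub>R h" by simp
    have "cross3 h x \<bullet> cross3 h x = ((h \<bullet> h) *\<^sub>R x - (h \<bullet> x) *\<^sub>R h) \<bullet> cross3 h x"
      by (simp flip: e)
    also have "\<dots> = 0" by (simp add: inner_diff_left dot_cross_self)
    finally show ?thesis by simp
  qed
  from this[of "axis 1 1"] this[of "axis 2 1"] show ?thesis
    by (simp add: vec_eq_iff forall_3 cross_components axis3_nth)
qed

text \<open>The group inverse acts as the inverse map, and its domain of definition is the image of
  \<open>act t a\<close>; openness and smoothness transfer in this way.\<close>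

lemma symmetry_on_act:
  "symmetry_on UNIV (model_metric t) (model_Upsilon t) {x. act_defined t a x} (act t a)"
proof -
  let ?W = "{x. act_defined t a x}" and ?b = "linv (model_group t) a"
  have image: "act t a ` ?W = {y. act_defined t ?b y}"
  proof (intro equalityI subsetI)
    fix y assume "y \<in> {y. act_defined t ?b y}"
    then have y: "act_defined t ?b y" by simp
    have "act_defined t a (act t ?b y)" "act t a (act t ?b y) = y"
      using act_defined_inverse[OF y] unfolding linv_linv by simp_all
    then show "y \<in> act t a ` ?W" by force
  qed (use act_defined_inverse(1) in auto)
  have inj: "inj_on (act t a) ?W"
    by (rule inj_on_inverseI[of _ "act t ?b"]) (use act_defined_inverse(2) in blast)
  have o: "open {x. act_defined t c x}" for c
    by (rule open_act_defined[OF smooth_on_const smooth_on_ident]; rule open_UNIV)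
  have sm: "smooth_on {x. act_defined t c x} (act t c)" for c
    using smooth_on_act[OF o smooth_on_const[OF o] smooth_on_ident[OF o], of c t c] by simp
  have inv: "inv_into ?W (act t a) y = act t ?b y" if y: "y \<in> act t a ` ?W" for y
  proof -
    obtain x where x: "act_defined t a x" "y = act t a x" using y by blast
    then have "inv_into ?W (act t a) y = x" using inv_into_f_f[OF inj] by simp
    then show ?thesis using act_defined_inverse(2)[OF x(1)] x(2) by simp
  qed
  have fd: "frechet_derivative (act t a) (at x) = act_deriv t a x" if "act_defined t a x" for x
    using frechet_derivative_at[OF has_derivative_act[OF that]] by simp
  show ?thesis
    unfolding symmetry_on_def
  proof (intro conjI)
    show "smooth_on (act t a ` ?W) (inv_into ?W (act t a))"
      using smooth_on_cong[of "act t a ` ?W" "inv_into ?W (act t a)" "act t ?b"] inv sm[of ?b] o[of ?b]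
      by (simp only: image)
    show "\<forall>x\<in>?W. let d = frechet_derivative (act t a) (at x) in
        \<forall>u b c. model_metric t (act t a x) (d u) (d b) = model_metric t x u b \<and>
          model_Upsilon t (act t a x) (d u) (d b) (d c) = model_Upsilon t x u b c"
      by (simp add: Let_def fd model_metric_def model_Upsilon_def model_theta_act inner_rot Upsilon0_rot)
  qed (use o sm inj image in simp_all)
qed

lemma symmetry_group_model: "symmetry_group (model_group t) UNIV p12 (model_metric t) (model_Upsilon t)"
proof -
  let ?D = "{z. act_defined t (fst z) (snd z)}"
  have oD: "open ?D"
    by (rule open_act_defined[OF smooth_on_fst_snd(1) smooth_on_fst_snd(2)]; rule open_UNIV)
  have "open ?D \<and> ?D \<subseteq> lcarrier (model_group t) \<times> UNIV \<and> {lone (model_group t)} \<times> UNIV \<subseteq> ?D \<and>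
     smooth_on ?D (\<lambda>(a, x). act t a x) \<and>
     (\<forall>a\<in>lcarrier (model_group t). symmetry_on UNIV (model_metric t) (model_Upsilon t) {x. (a, x) \<in> ?D} (act t a)) \<and>
     (\<forall>x\<in>UNIV. act t (lone (model_group t)) x = x) \<and>
     (\<forall>a b x. (a, b) \<in> mult_dom (model_group t) \<and> (b, x) \<in> ?D \<and> (a, act t b x) \<in> ?D \<and> (lmult (model_group t) a b, x) \<in> ?D \<longrightarrow>
        act t a (act t b x) = act t (lmult (model_group t) a b) x) \<and>
     (\<forall>a b. (a, b) \<in> mult_dom (model_group t) \<and> (a, p12 b) \<in> ?D \<longrightarrow> act t a (p12 b) = p12 (lmult (model_group t) a b)) \<and>
     (\<exists>N. open N \<and> lone (model_group t) \<in> N \<and> N \<subseteq> lcarrier (model_group t) \<and>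
        (\<forall>a\<in>N. (\<forall>x. (a, x) \<in> ?D \<longrightarrow> act t a x = x) \<longrightarrow> a = lone (model_group t)))"
  proof (intro conjI)
    show "smooth_on ?D (\<lambda>(a, x). act t a x)"
      unfolding case_prod_beta by (rule smooth_on_act[OF oD smooth_on_fst_snd(1)[OF oD] smooth_on_fst_snd(2)[OF oD]]) simp
    show "\<forall>a\<in>lcarrier (model_group t). symmetry_on UNIV (model_metric t) (model_Upsilon t) {x. (a, x) \<in> ?D} (act t a)"
      using symmetry_on_act by simp
    show "\<forall>a b x. (a, b) \<in> mult_dom (model_group t) \<and> (b, x) \<in> ?D \<and> (a, act t b x) \<in> ?D \<and> (lmult (model_group t) a b, x) \<in> ?D \<longrightarrow>
        act t a (act t b x) = act t (lmult (model_group t) a b) x"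
      using act_mult by (simp del: model_group_simps(5))
    show "\<exists>N. open N \<and> lone (model_group t) \<in> N \<and> N \<subseteq> lcarrier (model_group t) \<and>
        (\<forall>a\<in>N. (\<forall>x. (a, x) \<in> ?D \<longrightarrow> act t a x = x) \<longrightarrow> a = lone (model_group t))"
    proof (intro exI[of _ UNIV] conjI ballI impI)
      fix a assume fixes_all: "\<forall>x. (a, x) \<in> ?D \<longrightarrow> act t a x = x"
      \<comment> \<open>Fixing the origin removes the translation part; what is left acts on each
        row by \<open>rot\<close>, at every point.\<close>
      have "act_defined t a 0" by (simp add: act_defined_def)
      then have "act t a 0 = 0" using spec[OF fixes_all, of 0] by simp
      then have p: "p12 a = 0" by simp
      then have def: "act_defined t a x" for x by (simp add: act_defined_def)
      have "rot (q12 a) y = y" for y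
      proof -
        have "act t a (mat9 (\<chi> i. y)) = mat9 (\<chi> i. y)" using fixes_all def by simp
        then have "sigma (act t a (mat9 (\<chi> i. y))) $ 1 = sigma (mat9 (\<chi> i. y)) $ 1" by simp
        then show ?thesis unfolding sigma_act by (simp add: p)
      qed
      then have "q12 a = 0" by (rule rot_trivial)
      then show "a = lone (model_group t)" using p by (simp add: eq12_iff)
    qed simp_all
  qed (use oD in \<open>auto simp: act_defined_def\<close>)
  then show ?thesis unfolding symmetry_group_def by blast
qed

lemma bij_group_coframe:
  assumes Q: "orthogonal_matrix Q"
  shows "bij (\<lambda>v. (group_theta Q t a v, group_gamma t a v))"
proof (rule o_bij)
  let ?f = "\<lambda>v. (group_theta Q t a v, group_gamma t a v)"
  let ?r = "\<lambda>X. rotl (transpose Q) X"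
  let ?g = "\<lambda>(X, c). j12 (model_frame t (p12 a) (maprows (\<lambda>i. rot (q12 a)) (?r X)))
    (cay_frame 1 (q12 a) ((1/2) *\<^sub>R (hat3 c + t *\<^sub>R sum_rows (?r X))))"
  have r: "?r (rotl Q X) = X" "rotl Q (?r X) = X" for X
    using Q by (simp_all add: rotl_rotl orthogonal_matrix_def rotl_one)
  have g1: "group_rows t a (j12 (model_frame t (p12 a) (maprows (\<lambda>i. rot (q12 a)) X)) h) = X" for X h
    by (simp add: group_rows_def model_theta_frame sigma_eq_iff)
  have g2: "model_frame t (p12 a) (maprows (\<lambda>i. rot (q12 a)) (group_rows t a v)) = p12 v" for v
  proof -
    have "maprows (\<lambda>i. rot (q12 a)) (group_rows t a v) = model_theta t (p12 a) (p12 v)"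
      by (simp add: group_rows_def sigma_eq_iff)
    then show ?thesis by (simp add: model_frame_theta)
  qed
  show "?g \<circ> ?f = id"
    by (rule ext) (simp add: group_theta_def r g2 group_gamma_def cay_frame_form)
  show "?f \<circ> ?g = id"
    by (rule ext) (auto simp: group_theta_def r g1 group_gamma_def cay_form_frame)
qed

lemma maurer_cartan_model:
  assumes Q: "rotation_matrix Q" and S: "S_tensor u = act_cubic Q (std_cubic t)" and k: "k = t\<^sup>2"
  shows "maurer_cartan_system u k (model_group t) (group_theta Q t) (group_gamma t)"
proof -
  have "orthogonal_matrix Q" using Q by (simp add: rotation_matrix_def)
  then show ?thesis
    unfolding maurer_cartan_system_def
    by (auto simp: left_invariant_group_theta left_invariant_group_gamma bij_group_coframe system_S_group[OF Q S k]
        simp del: model_group_simps(4,5))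
qed

section \<open>The Killing form\<close>

lemma cay_mult_deriv_zero: "cay_mult_deriv s x 0 v = cay_frame s x v"
  by (simp add: cay_mult_deriv_def cay_frame_def scaleR_add_right)

lemma has_derivative_rot: "((\<lambda>h. rot h x) has_derivative (\<lambda>v. 2 *\<^sub>R cross3 v x)) (at 0)"
proof -
  have "((\<lambda>h. rot (- (- h)) x) has_derivative (\<lambda>v. - 2 *\<^sub>R cross3 (cay_form 1 (- 0) (- v)) (rot (- (- 0)) x))) (at 0)"
    by (rule has_derivative_compose[OF has_derivative_minus[OF has_derivative_ident]]) (rule has_derivative_rot_minus)
  then show ?thesis by simp
qed

lemma left_field_derivative:
  "((\<lambda>a. dleft (model_group t) a 0 v) has_derivative (\<lambda>w. j12 (mat9 (\<chi> i. 2 *\<^sub>R cross3 (q12 w) (sigma (p12 v) $ i)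
     + (2 * t) *\<^sub>R cross3 (sigma (p12 w) $ i) (sigma (p12 v) $ i))) (cross3 (q12 w) (q12 v)))) (at 0)"
proof -
  have e: "dleft (model_group t) a 0 v = j12 (mat9 (\<chi> i. cay_frame (2 * t) (sigma (p12 a) $ i) (rot (q12 a) (sigma (p12 v) $ i))))
      (cay_frame 1 (q12 a) (q12 v))" for a
    by (subst dleft_model) (simp_all add: act_defined_def act_deriv_def cay_mult_deriv_zero)
  have q: "((\<lambda>a. q12 a) has_derivative q12) (at 0)" and p: "((\<lambda>a. sigma (p12 a) $ i) has_derivative (\<lambda>w. sigma (p12 w) $ i)) (at 0)" for i
    by (rule has_derivative_q12[OF has_derivative_ident],
        rule has_derivative_sigma_row[OF has_derivative_p12[OF has_derivative_ident]])
  have frame: "((\<lambda>a. cay_frame s (f a) (g a)) has_derivative (\<lambda>w. g' w + s *\<^sub>R cross3 (f' w) (g 0))) (at 0)"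
    if f: "(f has_derivative f') (at 0)" "f 0 = 0" and g: "(g has_derivative g') (at 0)"
    for f g f' g' :: "real^12 \<Rightarrow> real^3" and s
    unfolding cay_frame_def
    by (rule has_derivative_eq_rhs, (rule has_derivative_add has_derivative_scaleR has_derivative_scaleR_right
        has_derivative_mult_right has_derivative_inner has_derivative_cross3 f g)+) (simp add: f(2) fun_eq_iff)
  have r: "((\<lambda>a. rot (q12 a) x) has_derivative (\<lambda>w. 2 *\<^sub>R cross3 (q12 w) x)) (at 0)" for x
    using has_derivative_compose[OF q, of "\<lambda>h. rot h x" "\<lambda>v. 2 *\<^sub>R cross3 v x"] has_derivative_rot by simp
  show ?thesis
    unfolding e
    by (rule has_derivative_eq_rhs, rule has_derivative_j12, rule has_derivative_maprows, rule frame[OF p _ r], simp,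
        rule frame[OF q _ has_derivative_const]) (simp_all add: fun_eq_iff)
qed

text \<open>Taking q and the three q + 2 t p_i as components, where q and p are the rotation and
  translation parts, gives four homomorphisms to so(3) with bracket 2 (x cross y). For nonzero t
  together they form an isomorphism.\<close>

definition bracket12 :: "real \<Rightarrow> real^12 \<Rightarrow> real^12 \<Rightarrow> real^12" where
  "bracket12 t v w = j12 (mat9 (\<chi> i. 2 *\<^sub>R (cross3 (q12 v) (sigma (p12 w) $ i) + cross3 (sigma (p12 v) $ i) (q12 w)
     + (2 * t) *\<^sub>R cross3 (sigma (p12 v) $ i) (sigma (p12 w) $ i)))) (2 *\<^sub>R cross3 (q12 v) (q12 w))"

lemma lie_alg_bracket_model: "lie_alg_bracket (model_group t) v w = bracket12 t v w"
proof -
  have fd: "frechet_derivative (\<lambda>a. dleft (model_group t) a 0 v) (at 0) w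
      = j12 (mat9 (\<chi> i. 2 *\<^sub>R cross3 (q12 w) (sigma (p12 v) $ i)
     + (2 * t) *\<^sub>R cross3 (sigma (p12 w) $ i) (sigma (p12 v) $ i))) (cross3 (q12 w) (q12 v))" for v w
    using frechet_derivative_at[OF left_field_derivative, symmetric] by simp
  have z: "dleft (model_group t) 0 0 v = v" for v
    by (subst dleft_model) (simp_all add: act_defined_def act_deriv_def cay_mult_deriv_zero cay_frame_def eq12_iff sigma_eq_iff)
  have skew: "cross3 (q12 w) (q12 v) = - cross3 (q12 v) (q12 w)"
    "cross3 (q12 w) (sigma (p12 v) $ i) = - cross3 (sigma (p12 v) $ i) (q12 w)"
    "cross3 (sigma (p12 w) $ i) (sigma (p12 v) $ i) = - cross3 (sigma (p12 v) $ i) (sigma (p12 w) $ i)" for i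
    by (rule cross_skew)+
  show ?thesis
    unfolding lie_alg_bracket_def lie_bracket_fields_def model_group_simps(3) fd z skew bracket12_def
    by (simp add: eq12_iff sigma_eq_iff algebra_simps) (simp add: vec_eq_iff)
qed

lemma axis_12:
  "axis 1 1 = j12 (axis 1 1) 0" "axis 2 1 = j12 (axis 2 1) 0" "axis 3 1 = j12 (axis 3 1) 0"
  "axis 4 1 = j12 (axis 4 1) 0" "axis 5 1 = j12 (axis 5 1) 0" "axis 6 1 = j12 (axis 6 1) 0"
  "axis 7 1 = j12 (axis 7 1) 0" "axis 8 1 = j12 (axis 8 1) 0" "axis 9 1 = j12 (axis 9 1) 0"
  "axis 10 1 = j12 0 (axis 1 1)" "axis 11 1 = j12 0 (axis 2 1)" "axis 12 1 = j12 0 (axis 3 1)"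
  by (simp_all add: vec_eq_iff forall_12 j12_nth axis_def)

lemma nth_12:
  "a $ 1 = sigma (p12 a) $ 1 $ 1" "a $ 2 = sigma (p12 a) $ 1 $ 2" "a $ 3 = sigma (p12 a) $ 1 $ 3"
  "a $ 4 = sigma (p12 a) $ 2 $ 1" "a $ 5 = sigma (p12 a) $ 2 $ 2" "a $ 6 = sigma (p12 a) $ 2 $ 3"
  "a $ 7 = sigma (p12 a) $ 3 $ 1" "a $ 8 = sigma (p12 a) $ 3 $ 2" "a $ 9 = sigma (p12 a) $ 3 $ 3"
  "a $ 10 = q12 a $ 1" "a $ 11 = q12 a $ 2" "a $ 12 = q12 a $ 3"
  by (simp_all add: sigma_nth p12_nth q12_nth)

text \<open>The Killing form is the sum over the four components q and q + 2 t p_i; the bracket 2 (x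
  cross y) has Killing form - 8 (x . y). The formula is polynomial in t and persists at t =
  0.\<close>

lemma killing_form_model:
  "killing_form (model_group t) v w = - 8 * (q12 v \<bullet> q12 w
     + (\<Sum>i\<in>UNIV. (q12 v + (2 * t) *\<^sub>R sigma (p12 v) $ i) \<bullet> (q12 w + (2 * t) *\<^sub>R sigma (p12 w) $ i)))"
proof -
  define x where "x r c = sigma (p12 v) $ r $ c" for r c
  define y where "y r c = sigma (p12 w) $ r $ c" for r c
  define h where "h c = q12 v $ c" for c
  define l where "l c = q12 w $ c" for c
  have "killing_form (model_group t) v w = (\<Sum>i\<in>UNIV. bracket12 t v (bracket12 t w (axis i 1)) $ i)"
    by (simp add: killing_form_def lie_alg_bracket_model trace_def matrix_def)
  also have "\<dots> = - 8 * (q12 v \<bullet> q12 w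
     + (\<Sum>i\<in>UNIV. (q12 v + (2 * t) *\<^sub>R sigma (p12 v) $ i) \<bullet> (q12 w + (2 * t) *\<^sub>R sigma (p12 w) $ i)))"
    unfolding sum_12 sum_3
    by (simp only: nth_12 axis_12 bracket12_def p12_j12 q12_j12 sigma_mat9 vec_lambda_beta component_simps flip: x_def y_def h_def l_def)
      algebra
  finally show ?thesis .
qed

text \<open>The four components are the halves of \<gamma> + t (sum of \<epsilon>_a \<theta>_a);
  orthogonality of the characters \<epsilon> removes the mixed terms from the sum of their
  squares.\<close>

lemma killing_form_coframe:
  assumes Q: "orthogonal_matrix Q"
  shows "killing_form (model_group t) v w = - 8 * (t\<^sup>2 * (group_theta Q t 0 v \<bullet> group_theta Q t 0 w)
     + group_gamma t 0 v \<bullet> group_gamma t 0 w)"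
proof -
  have r: "group_rows t 0 v = tetra (p12 v)" for v
    by (simp add: group_rows_def model_theta_def maprows_def)
  show ?thesis
    unfolding killing_form_model group_theta_def inner_rotl[OF Q] group_gamma_def r hat3_inner
    unfolding inner_sigma sum_3 sum_rows_tetra
    by (simp only: tetra_def sigma_mat9 vec_lambda_beta sum_rows_def vec3_simps pq12_simps cay_form_zero; algebra)
qed

lemma coframe_dual:
  assumes Q: "orthogonal_matrix Q"
  shows "group_theta Q t 0 (dual_theta (model_group t) (group_theta Q t) (group_gamma t) i) = axis i 1"
    "group_gamma t 0 (dual_theta (model_group t) (group_theta Q t) (group_gamma t) i) = 0"
    "group_theta Q t 0 (dual_gamma (model_group t) (group_theta Q t) (group_gamma t) A) = 0"
    "group_gamma t 0 (dual_gamma (model_group t) (group_theta Q t) (group_gamma t) A) = axis A 1"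
proof -
  have "surj (\<lambda>v. (group_theta Q t 0 v, group_gamma t 0 v))"
    using bij_group_coframe[OF Q] by (rule bij_is_surj)
  note s = surj_f_inv_f[OF this]
  show "group_theta Q t 0 (dual_theta (model_group t) (group_theta Q t) (group_gamma t) i) = axis i 1"
    "group_gamma t 0 (dual_theta (model_group t) (group_theta Q t) (group_gamma t) i) = 0"
    using s[of "(axis i 1, 0)"] by (simp_all add: dual_theta_def)
  show "group_theta Q t 0 (dual_gamma (model_group t) (group_theta Q t) (group_gamma t) A) = 0"
    "group_gamma t 0 (dual_gamma (model_group t) (group_theta Q t) (group_gamma t) A) = axis A 1"
    using s[of "(0, axis A 1)"] by (simp_all add: dual_gamma_def)
qed

theorem theorem6p13:
  fixes u :: "real^7" and k7 :: real
  assumes "relations u"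
    and "k7 = 2 * (u$1)\<^sup>2 + (u$2)\<^sup>2 + u$1 * u$3 + 2 * (u$4)\<^sup>2 + (u$5)\<^sup>2 + 3 * u$4 * u$6 + (u$6)\<^sup>2 + u$5 * u$7"
  shows "\<exists>(G :: (real^12) local_group) \<theta> \<gamma> H M \<pi> g \<Upsilon> \<omega>.
    local_lie_group G \<and> maurer_cartan_system u k7 G \<theta> \<gamma> \<and>
    local_homogeneous_space G H {v. \<theta> (lone G) v = 0} M \<pi> \<and>
    descends (lcarrier G) \<theta> \<pi> g \<Upsilon> \<omega> \<and>
    irreducible_geometry M g \<Upsilon> \<omega> \<and> nearly_integrable M g \<Upsilon> \<and>
    symmetry_group G M \<pi> g \<Upsilon> \<and>
    (\<exists>V. is_V06 V \<and>
      (\<forall>p\<in>M. \<exists>U \<theta>'. p \<in> U \<and> U \<subseteq> M \<and> adapted_coframe g \<Upsilon> \<omega> U \<theta>' \<and>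
        (\<exists>\<gamma>L \<gamma>R. characteristic_connection U \<theta>' \<gamma>L \<gamma>R) \<and>
        (\<forall>\<gamma>L \<gamma>R. characteristic_connection U \<theta>' \<gamma>L \<gamma>R \<longrightarrow>
          (\<comment> \<open>(a)\<close>
           \<forall>x\<in>U. torsion \<theta>' (conn \<gamma>L \<gamma>R) x \<in> V) \<and>
          (\<comment> \<open>(b)\<close>
           \<forall>x\<in>U. \<forall>v w. curvature_form (conn_L \<gamma>L) x v w = 0) \<and>
          (\<comment> \<open>(c)\<close>
           \<forall>x\<in>U. norm_sq3 (torsion \<theta>' (conn \<gamma>L \<gamma>R) x) = 36 * k7 \<and>
             (\<forall>v w. curvature_form (conn \<gamma>L \<gamma>R) x v w = curvature_form (conn_R \<gamma>R) x v w \<and>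
               curvature_form (conn_R \<gamma>R) x v w =
                 (1/36 * norm_sq3 (torsion \<theta>' (conn \<gamma>L \<gamma>R) x)) *\<^sub>R
                   (\<Sum>A\<in>UNIV. kappa0 A (\<theta>' x v) (\<theta>' x w) *\<^sub>R eR A))) \<and>
          (\<comment> \<open>(e), flatness of the characteristic connection\<close>
           k7 = 0 \<longrightarrow> (\<forall>x\<in>U. \<forall>v w. curvature_form (conn \<gamma>L \<gamma>R) x v w = 0)) \<and>
          (\<comment> \<open>(g)\<close>
           \<forall>x\<in>U. \<forall>i j. ricci_form \<theta>' (conn_R \<gamma>R) x i j = 2 * k7 * g x (frame \<theta>' x i) (frame \<theta>' x j)) \<and>
          ((\<forall>x\<in>U. \<forall>v w. curvature_form (conn_R \<gamma>R) x v w = 0) \<longleftrightarrow> k7 = 0)))) \<and>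
    (\<comment> \<open>(d)\<close>
     \<forall>i j A B.
      killing_form G (dual_theta G \<theta> \<gamma> i) (dual_theta G \<theta> \<gamma> j) = (if i = j then - 8 * k7 else 0) \<and>
      killing_form G (dual_theta G \<theta> \<gamma> i) (dual_gamma G \<theta> \<gamma> A) = 0 \<and>
      killing_form G (dual_gamma G \<theta> \<gamma> A) (dual_theta G \<theta> \<gamma> i) = 0 \<and>
      killing_form G (dual_gamma G \<theta> \<gamma> A) (dual_gamma G \<theta> \<gamma> B) = (if A = B then - 8 else 0)) \<and>
    (\<comment> \<open>(e)\<close>
     k7 \<noteq> 0 \<longrightarrow> \<not> locally_symmetric M g) \<and>
    (k7 = 0 \<longrightarrow> locally_symmetric M g) \<and>
    (\<comment> \<open>(f)\<close>
     \<forall>x\<in>M. \<forall>v w. ricci g x v w = 3 * k7 * g x v w) \<and>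
    (u \<noteq> 0 \<longrightarrow> \<not> conformally_flat M g)"
proof -
  \<comment> \<open>In particular k7 is a square, hence never negative.\<close>
  obtain Q t where Q: "rotation_matrix Q" and S: "S_tensor u = act_cubic Q (std_cubic t)" and k: "t\<^sup>2 = k7"
    using exists_std_frame[OF symmetric_S_tensor traceless_S_tensor relations_gram[OF assms]] .
  have o: "orthogonal_matrix Q" using Q by (simp add: rotation_matrix_def)
  have t0: "t = 0 \<longleftrightarrow> k7 = 0" using k by auto
  have u0: "t \<noteq> 0" if "u \<noteq> 0"
  proof
    assume "t = 0"
    moreover have "std_cubic 0 i j l = 0" for i j l by (simp add: std_cubic_def)
    ultimately have "S_tensor u a b c = 0" for a b c by (simp add: S tact_sum)
    then have "u = 0" using coords_S_tensor[of u] by (simp add: vec_eq_iff forall_7 coords_nth)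
    then show False using that by simp
  qed
  show ?thesis
    apply (rule exI[of _ "model_group t"], rule exI[of _ "group_theta Q t"], rule exI[of _ "group_gamma t"],
        rule exI[of _ "{a. p12 a = 0}"], rule exI[of _ UNIV], rule exI[of _ p12], rule exI[of _ "model_metric t"],
        rule exI[of _ "model_Upsilon t"], rule exI[of _ "model_omega t"], intro conjI)
    subgoal by (rule local_lie_group_model)
    subgoal by (rule maurer_cartan_model[OF Q S k[symmetric]])
    subgoal by (rule homogeneous_model[OF o])
    subgoal using descends_model[OF Q] by simp
    subgoal by (rule irreducible_model)
    subgoal by (rule nearly_integrable_model)
    subgoal by (rule symmetry_group_model)
    \<comment> \<open>The model coframe is global, so U is all of M at every point, and uniqueness
      reduces the claims on arbitrary characteristic connections to the explicit one.\<close>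
    subgoal
      by (rule exI[of _ "range cubic_forms"], rule conjI[OF is_V06_cubic_forms], rule ballI, rule exI[of _ UNIV],
          rule exI[of _ "model_theta t"], intro conjI UNIV_I subset_UNIV adapted_model, (rule exI)+,
          rule characteristic_model, intro allI impI, rule model_characteristic_properties[OF _ k[symmetric]])
    subgoal by (simp add: killing_form_coframe[OF o] coframe_dual[OF o] inner_axis_axis k)
    subgoal by (simp add: locally_symmetric_model t0)
    subgoal by (simp add: locally_symmetric_model t0)
    subgoal by (simp add: ricci_model k)
    subgoal using u0 not_conformally_flat_model by blast
    done
qed

end
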